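(* Let $\mathcal{A}=(A;\theta)$ be a countable connected monounary algebra. Then the following are equivalent: (1) $\mathcal{A}$ is $\omega$-categorical; (2) $\mathrm{cyc}(\mathcal{A})$ is nonempty and $\mathcal{A}_c$ is $\omega$-categorical for each $c\in\mathrm{cyc}(\mathcal{A})$; (3) $\mathrm{cyc}(\mathcal{A})$ is nonempty and $(A_c;\leq)$ is $\omega$-categorical for each $c\in\mathrm{cyc}(\mathcal{A})$; (4) $\mathrm{ht}(\mathcal{A})\in\omega$ and $\{\mathcal{A}_x:x\in A\}$ is finite, up to isomorphism; (5) $\mathcal{A}$ is locally finite and has finitely many $1$-orbits.
   Context: A monounary algebra is a pair $\mathcal{A}=(A;\theta)$ where $A$ is a nonempty set and $\theta\colon A\to A$. It is connected if for all $x,y\in A$ there are $n,m\geq 0$ with $\theta^n(x)=\theta^m(y)$. It is locally finite if every finitely generated subalgebra (nonempty subset closed under $\theta$) is finite. $\mathbb{N}=\{1,2,\dots\}$, $\omega=\mathbb{N}\cup\{0\}$. An element $x$ is cyclic if $\theta^n(x)=x$ for some $n\in\mathbb{N}$; $\mathrm{cyc}(\mathcal{A})$ is the set of cyclic elements. $\mathrm{ht}(x)$ is the least $n\in\omega$ with $\theta^n(x)$ cyclic, or $\infty$ if there is none; $\mathrm{ht}(\mathcal{A})$ is the least $n\in\omega$ with $\mathrm{ht}(x)\leq n$ for all $x\in A$, or $\infty$ if there is none. For $z\in A$ let $$A_z=\{z\}\cup\{x\in A\setminus\mathrm{cyc}(\mathcal{A}):(\exists n\in\mathbb{N})\ \theta^n(x)=z,\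 \theta^{n-1}(x)\notin\mathrm{cyc}(\mathcal{A})\},$$ and let $\mathcal{A}_z$ be the partial monounary algebra on $A_z$ whose operation is $\theta$ restricted to $\{x\in A_z:\theta(x)\in A_z\}$. An isomorphism of partial monounary algebras $(B;\theta)\to(B';\theta')$ is a bijection $\phi$ with $x\in\mathrm{dom}(\theta)$ iff $\phi(x)\in\mathrm{dom}(\theta')$, and then $\phi(\theta(x))=\theta'(\phi(x))$; automorphisms are defined accordingly. For $c\in\mathrm{cyc}(\mathcal{A})$, $\leq$ is the partial order on $A_c$ given by $a\geq b$ iff $\theta^k(a)=b$ for some $k\in\omega$. A countable structure is $\omega$-categorical if every countable structure with the same first-order theory is isomorphic to it; equivalently (Ryll-Nardzewski), its automorphism group is oligomorphic, i.e. has only finitely many orbits on $n$-tuples for every $n\geq 1$. A (countable) partial monounary algebra is called $\omega$-categorical if its automorphism group is oligomorphic. The $1$-orbits of $\mathcal{A}$ are the orbits of $\mathrm{Aut}(\mathcal{A})$ on $A$. *)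

theory Defs
  imports Main "HOL-Library.Countable_Set" "HOL-Library.Extended_Nat"
begin

section \<open>First-order logic with equality\<close>

text \<open>A signature lists its function and relation symbols together with their arities.\<close>

record ('f, 'r) signature =
  fun_syms :: "('f \<times> nat) set"
  rel_syms :: "('r \<times> nat) set"

datatype 'f trm = Var nat | Fun 'f "'f trm list"

datatype ('f, 'r) form =
    Equal "'f trm" "'f trm"
  | Rel 'r "'f trm list"
  | Neg "('f, 'r) form"
  | Conj "('f, 'r) form" "('f, 'r) form"
  | Exists nat "('f, 'r) form"

fun wf_trm :: "('f, 'r) signature \<Rightarrow> 'f trm \<Rightarrow> bool" where
  "wf_trm \<Sigma> (Var i) \<longleftrightarrow> True"
| "wf_trm \<Sigma> (Fun f ts) \<longleftrightarrow> (f, length ts) \<in> fun_syms \<Sigma> \<and> (\<forall>t\<in>set ts. wf_trm \<Sigma> t)"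

fun wf_form :: "('f, 'r) signature \<Rightarrow> ('f, 'r) form \<Rightarrow> bool" where
  "wf_form \<Sigma> (Equal t u) \<longleftrightarrow> wf_trm \<Sigma> t \<and> wf_trm \<Sigma> u"
| "wf_form \<Sigma> (Rel r ts) \<longleftrightarrow> (r, length ts) \<in> rel_syms \<Sigma> \<and> (\<forall>t\<in>set ts. wf_trm \<Sigma> t)"
| "wf_form \<Sigma> (Neg \<phi>) \<longleftrightarrow> wf_form \<Sigma> \<phi>"
| "wf_form \<Sigma> (Conj \<phi> \<psi>) \<longleftrightarrow> wf_form \<Sigma> \<phi> \<and> wf_form \<Sigma> \<psi>"
| "wf_form \<Sigma> (Exists i \<phi>) \<longleftrightarrow> wf_form \<Sigma> \<phi>"

fun vars_trm :: "'f trm \<Rightarrow> nat set" where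
  "vars_trm (Var i) = {i}"
| "vars_trm (Fun f ts) = (\<Union>t\<in>set ts. vars_trm t)"

fun free_vars :: "('f, 'r) form \<Rightarrow> nat set" where
  "free_vars (Equal t u) = vars_trm t \<union> vars_trm u"
| "free_vars (Rel r ts) = (\<Union>t\<in>set ts. vars_trm t)"
| "free_vars (Neg \<phi>) = free_vars \<phi>"
| "free_vars (Conj \<phi> \<psi>) = free_vars \<phi> \<union> free_vars \<psi>"
| "free_vars (Exists i \<phi>) = free_vars \<phi> - {i}"

definition sentence :: "('f, 'r) signature \<Rightarrow> ('f, 'r) form \<Rightarrow> bool" where
  "sentence \<Sigma> \<phi> \<longleftrightarrow> wf_form \<Sigma> \<phi> \<and> free_vars \<phi> = {}"

record ('f, 'r, 'a) struc =
  universe :: "'a set"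
  fun_interp :: "'f \<Rightarrow> 'a list \<Rightarrow> 'a"
  rel_interp :: "'r \<Rightarrow> 'a list \<Rightarrow> bool"

definition is_structure :: "('f, 'r) signature \<Rightarrow> ('f, 'r, 'a) struc \<Rightarrow> bool" where
  "is_structure \<Sigma> M \<longleftrightarrow> universe M \<noteq> {} \<and>
     (\<forall>(f, n)\<in>fun_syms \<Sigma>. \<forall>xs. length xs = n \<and> set xs \<subseteq> universe M
        \<longrightarrow> fun_interp M f xs \<in> universe M)"

fun eval_trm :: "('f, 'r, 'a) struc \<Rightarrow> (nat \<Rightarrow> 'a) \<Rightarrow> 'f trm \<Rightarrow> 'a" where
  "eval_trm M s (Var i) = s i"
| "eval_trm M s (Fun f ts) = fun_interp M f (map (eval_trm M s) ts)"

fun sat :: "('f, 'r, 'a) struc \<Rightarrow> (nat \<Rightarrow> 'a) \<Rightarrow> ('f, 'r) form \<Rightarrow> bool" where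
  "sat M s (Equal t u) \<longleftrightarrow> eval_trm M s t = eval_trm M s u"
| "sat M s (Rel r ts) \<longleftrightarrow> rel_interp M r (map (eval_trm M s) ts)"
| "sat M s (Neg \<phi>) \<longleftrightarrow> \<not> sat M s \<phi>"
| "sat M s (Conj \<phi> \<psi>) \<longleftrightarrow> sat M s \<phi> \<and> sat M s \<psi>"
| "sat M s (Exists i \<phi>) \<longleftrightarrow> (\<exists>a\<in>universe M. sat M (s(i := a)) \<phi>)"

definition theory_of :: "('f, 'r) signature \<Rightarrow> ('f, 'r, 'a) struc \<Rightarrow> ('f, 'r) form set" where
  "theory_of \<Sigma> M = {\<phi>. sentence \<Sigma> \<phi> \<and> (\<forall>s. range s \<subseteq> universe M \<longrightarrow> sat M s \<phi>)}"

definition isomorphism ::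
  "('f, 'r) signature \<Rightarrow> ('f, 'r, 'a) struc \<Rightarrow> ('f, 'r, 'b) struc \<Rightarrow> ('a \<Rightarrow> 'b) \<Rightarrow> bool" where
  "isomorphism \<Sigma> M N h \<longleftrightarrow> bij_betw h (universe M) (universe N) \<and>
     (\<forall>(f, n)\<in>fun_syms \<Sigma>. \<forall>xs. length xs = n \<and> set xs \<subseteq> universe M
        \<longrightarrow> h (fun_interp M f xs) = fun_interp N f (map h xs)) \<and>
     (\<forall>(r, n)\<in>rel_syms \<Sigma>. \<forall>xs. length xs = n \<and> set xs \<subseteq> universe M
        \<longrightarrow> (rel_interp M r xs \<longleftrightarrow> rel_interp N r (map h xs)))"

text \<open>
  The competing countable structures are taken with universe a set of natural numbers. This
  is no restriction: every countable structure, on whatever type, is isomorphic to one of this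
  form. Here, as in \<^const>\<open>countable\<close>, finite structures count as countable.
\<close>

definition omega_categorical :: "('f, 'r) signature \<Rightarrow> ('f, 'r, 'a) struc \<Rightarrow> bool" where
  "omega_categorical \<Sigma> M \<longleftrightarrow> is_structure \<Sigma> M \<and> countable (universe M) \<and>
     (\<forall>N :: ('f, 'r, nat) struc. is_structure \<Sigma> N \<and> theory_of \<Sigma> N = theory_of \<Sigma> M
        \<longrightarrow> (\<exists>h. isomorphism \<Sigma> M N h))"


section \<open>Monounary algebras\<close>

definition monounary_algebra :: "'a set \<Rightarrow> ('a \<Rightarrow> 'a) \<Rightarrow> bool" where
  "monounary_algebra A \<theta> \<longleftrightarrow> A \<noteq> {} \<and> (\<forall>x\<in>A. \<theta> x \<in> A)"

definition connected_algebra :: "'a set \<Rightarrow> ('a \<Rightarrow> 'a) \<Rightarrow> bool" where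
  "connected_algebra A \<theta> \<longleftrightarrow> (\<forall>x\<in>A. \<forall>y\<in>A. \<exists>n m. (\<theta> ^^ n) x = (\<theta> ^^ m) y)"

definition subalgebra :: "'a set \<Rightarrow> ('a \<Rightarrow> 'a) \<Rightarrow> 'a set \<Rightarrow> bool" where
  "subalgebra A \<theta> B \<longleftrightarrow> B \<noteq> {} \<and> B \<subseteq> A \<and> (\<forall>x\<in>B. \<theta> x \<in> B)"

definition locally_finite :: "'a set \<Rightarrow> ('a \<Rightarrow> 'a) \<Rightarrow> bool" where
  "locally_finite A \<theta> \<longleftrightarrow>
     (\<forall>S. S \<noteq> {} \<and> S \<subseteq> A \<and> finite S \<longrightarrow> finite (subalgebra A \<theta> hull S))"

definition cyc :: "'a set \<Rightarrow> ('a \<Rightarrow> 'a) \<Rightarrow> 'a set" where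
  "cyc A \<theta> = {x \<in> A. \<exists>n\<ge>1. (\<theta> ^^ n) x = x}"

text \<open>In \<^typ>\<open>enat\<close> the infimum of the empty set is \<open>\<infinity>\<close>.\<close>

definition height :: "'a set \<Rightarrow> ('a \<Rightarrow> 'a) \<Rightarrow> 'a \<Rightarrow> enat" where
  "height A \<theta> x = Inf {enat n | n. (\<theta> ^^ n) x \<in> cyc A \<theta>}"

definition algebra_height :: "'a set \<Rightarrow> ('a \<Rightarrow> 'a) \<Rightarrow> enat" where
  "algebra_height A \<theta> = Inf {enat n | n. \<forall>x\<in>A. height A \<theta> x \<le> enat n}"

definition monounary_sig :: "(unit, unit) signature" where
  "monounary_sig = \<lparr>fun_syms = {((), 1)}, rel_syms = {}\<rparr>"

definition algebra_struc :: "'a set \<Rightarrow> ('a \<Rightarrow> 'a) \<Rightarrow> (unit, unit, 'a) struc" where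
  "algebra_struc A \<theta> =
     \<lparr>universe = A, fun_interp = (\<lambda>_ xs. \<theta> (hd xs)), rel_interp = (\<lambda>_ _. False)\<rparr>"

text \<open>
  Automorphisms are represented by functions on the whole type, of which only the restriction to
  the universe matters.
\<close>

definition algebra_automorphisms :: "'a set \<Rightarrow> ('a \<Rightarrow> 'a) \<Rightarrow> ('a \<Rightarrow> 'a) set" where
  "algebra_automorphisms A \<theta> = {g. bij_betw g A A \<and> (\<forall>x\<in>A. g (\<theta> x) = \<theta> (g x))}"

definition one_orbits :: "'a set \<Rightarrow> ('a \<Rightarrow> 'a) \<Rightarrow> 'a set set" where
  "one_orbits A \<theta> = (\<lambda>x. (\<lambda>g. g x) ` algebra_automorphisms A \<theta>) ` A"


section \<open>Partial monounary algebras\<close>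

record 'a partial_algebra =
  carrier :: "'a set"
  oper :: "'a \<rightharpoonup> 'a"

definition partial_isomorphism ::
  "'a partial_algebra \<Rightarrow> 'b partial_algebra \<Rightarrow> ('a \<Rightarrow> 'b) \<Rightarrow> bool" where
  "partial_isomorphism P Q h \<longleftrightarrow> bij_betw h (carrier P) (carrier Q) \<and>
     (\<forall>x\<in>carrier P. (x \<in> dom (oper P) \<longleftrightarrow> h x \<in> dom (oper Q)) \<and>
        (x \<in> dom (oper P) \<longrightarrow> h (the (oper P x)) = the (oper Q (h x))))"

definition partial_isomorphic :: "'a partial_algebra \<Rightarrow> 'b partial_algebra \<Rightarrow> bool" where
  "partial_isomorphic P Q \<longleftrightarrow> (\<exists>h. partial_isomorphism P Q h)"

definition finite_up_to_iso :: "'a partial_algebra set \<Rightarrow> bool" where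
  "finite_up_to_iso \<P> \<longleftrightarrow> finite (\<P> // {(P, Q). P \<in> \<P> \<and> Q \<in> \<P> \<and> partial_isomorphic P Q})"

definition oligomorphic :: "('a \<Rightarrow> 'a) set \<Rightarrow> 'a set \<Rightarrow> bool" where
  "oligomorphic G X \<longleftrightarrow>
     (\<forall>n\<ge>1. finite ((\<lambda>xs. (\<lambda>g. map g xs) ` G) ` {xs. length xs = n \<and> set xs \<subseteq> X}))"

definition partial_omega_categorical :: "'a partial_algebra \<Rightarrow> bool" where
  "partial_omega_categorical P \<longleftrightarrow>
     countable (carrier P) \<and> oligomorphic {g. partial_isomorphism P P g} (carrier P)"

definition branch_set :: "'a set \<Rightarrow> ('a \<Rightarrow> 'a) \<Rightarrow> 'a \<Rightarrow> 'a set" where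
  "branch_set A \<theta> z = {z} \<union>
     {x \<in> A - cyc A \<theta>. \<exists>n\<ge>1. (\<theta> ^^ n) x = z \<and> (\<theta> ^^ (n - 1)) x \<notin> cyc A \<theta>}"

definition branch_algebra :: "'a set \<Rightarrow> ('a \<Rightarrow> 'a) \<Rightarrow> 'a \<Rightarrow> 'a partial_algebra" where
  "branch_algebra A \<theta> z = \<lparr>carrier = branch_set A \<theta> z,
     oper = (\<lambda>x. if x \<in> branch_set A \<theta> z \<and> \<theta> x \<in> branch_set A \<theta> z then Some (\<theta> x) else None)\<rparr>"

definition order_sig :: "(unit, unit) signature" where
  "order_sig = \<lparr>fun_syms = {}, rel_syms = {((), 2)}\<rparr>"

text \<open>
  The relation symbol is read as \<open>\<le>\<close>, with \<open>a \<le> b\<close> iff \<open>a\<close> is an iterated image of \<open>b\<close>; the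
  point \<open>c\<close> is thus the least element. The signature has no function symbols, so
  \<^const>\<open>fun_interp\<close> is irrelevant.
\<close>

definition order_struc :: "'a set \<Rightarrow> ('a \<Rightarrow> 'a) \<Rightarrow> 'a \<Rightarrow> (unit, unit, 'a) struc" where
  "order_struc A \<theta> c = \<lparr>universe = branch_set A \<theta> c, fun_interp = (\<lambda>_. hd),
     rel_interp = (\<lambda>_ xs. \<exists>k. (\<theta> ^^ k) (xs ! 1) = xs ! 0)\<rparr>"

end

theory Submission
  imports Defs
begin

text \<open>
  By the theorem of Ryll-Nardzewski, \<open>\<omega>\<close>-categoricity of \<open>\<A>\<close> and of the orders \<open>(A\<^sub>c; \<le>)\<close>
  amounts to oligomorphicity of their automorphism groups. One direction of it is back-and-forth.
  For the other, in an \<open>\<omega>\<close>-categorical structure every finitely satisfiable type is realised (a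
  countable Skolem hull in an ultrapower realises it, and is isomorphic to the given structure);
  hence isolated types are dense, an elementary substructure all of whose tuples are isolated can be
  enumerated, and it is again isomorphic to the given structure.

  If finitely many branches occur up to isomorphism and the height is bounded, the group of
  automorphisms fixing the cycle pointwise is already oligomorphic: a tuple is contained in an
  enumeration of a finite subalgebra of bounded length, which can be moved to a representative one
  element at a time by exchanging two isomorphic branches attached to the same point. This group
  acts on \<open>\<A>\<close>, on each \<open>\<A>\<^sub>c\<close> and on each \<open>(A\<^sub>c; \<le>)\<close>. Conversely, an automorphism of a single
  \<open>\<A>\<^sub>c\<close> or \<open>(A\<^sub>c; \<le>)\<close> extends by the identity to \<open>\<A>\<close>, so (2) and (3) yield (5); and automorphic
  elements have the same height and isomorphic branches, so (5) yields (4).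
\<close>

text \<open>Categoricity is tested against structures on sets of natural numbers, so every model
  built on the way must be countable and concretely coded. This shapes the ultrapower: its elements
  are numbers coding Skolem terms, which needs a countable syntax. With countable syntax and a
  countable structure, the types to be realised come as sequences of formulas, and an ultrafilter on
  the natural numbers suffices. On the algebraic side the height bound \<open>N\<close> fixes the
  length of the enumerations: an entry \<open>x\<close> contributes the chain from
  \<open>(\<theta> ^^ N) x\<close> to \<open>x\<close>, that is \<open>Suc N\<close> elements.
  Connectedness enters through the finiteness of the cycle and through the fact that every element
  runs into a nonempty cycle. For (3) the operation has to be recovered from the order, which
  succeeds because \<open>\<theta> x\<close> is the only lower cover of \<open>x\<close> away from
  the root.\<close>

instance trm :: (countable) countable by countable_datatype
instance form :: (countable, countable) countable by countable_datatype

section \<open>Satisfaction under assignments given by tuples\<close>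

text \<open>The bound on the free variables lets a tuple of length \<open>n\<close> serve as an
  assignment through \<open>(!)\<close>; the unspecified entries beyond its end are never
  read.\<close>

definition formulas :: "('f, 'r) signature \<Rightarrow> nat \<Rightarrow> ('f, 'r) form set" where
  "formulas \<Sigma> n = {\<phi>. wf_form \<Sigma> \<phi> \<and> free_vars \<phi> \<subseteq> {..<n}}"

definition tuples :: "'a set \<Rightarrow> nat \<Rightarrow> 'a list set" where
  "tuples X n = {xs. length xs = n \<and> set xs \<subseteq> X}"

lemma tuplesD:
  assumes "xs \<in> tuples X n"
  shows "length xs = n" "set xs \<subseteq> X" "i < n \<Longrightarrow> xs ! i \<in> X"
  using assms by (auto simp: tuples_def)

lemma tuples_snoc: "xs \<in> tuples X n \<Longrightarrow> a \<in> X \<Longrightarrow> xs @ [a] \<in> tuples X (Suc n)"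
  by (auto simp: tuples_def)

lemma tuples_map_bij: "bij_betw h X Y \<Longrightarrow> xs \<in> tuples X n \<Longrightarrow> map h xs \<in> tuples Y n"
  by (auto simp: tuples_def bij_betw_def)

lemma tuples_Suc_cases:
  assumes "xs \<in> tuples X (Suc n)"
  obtains ys a where "xs = ys @ [a]" "ys \<in> tuples X n" "a \<in> X"
  using assms by (cases xs rule: rev_cases) (auto simp: tuples_def)

lemma countable_tuples: "countable X \<Longrightarrow> countable (tuples X n)"
  by (rule countable_subset[OF _ countable_lists]) (auto simp: tuples_def lists_eq_set)

lemma formulas_mono: "m \<le> n \<Longrightarrow> formulas \<Sigma> m \<subseteq> formulas \<Sigma> n"
  by (force simp: formulas_def)

lemma formulas_Neg [simp]: "Neg \<phi> \<in> formulas \<Sigma> n \<longleftrightarrow> \<phi> \<in> formulas \<Sigma> n"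
  and formulas_Conj [simp]: "Conj \<phi> \<psi> \<in> formulas \<Sigma> n \<longleftrightarrow> \<phi> \<in> formulas \<Sigma> n \<and> \<psi> \<in> formulas \<Sigma> n"
  by (auto simp: formulas_def)

lemma formulas_Exists: "\<phi> \<in> formulas \<Sigma> (Suc n) \<Longrightarrow> Exists n \<phi> \<in> formulas \<Sigma> n"
  by (auto simp: formulas_def lessThan_Suc)

lemma finite_vars_trm: "finite (vars_trm t)"
  by (induct t) auto

lemma finite_free_vars: "finite (free_vars \<phi>)"
  by (induct \<phi>) (auto simp: finite_vars_trm)

lemma eval_trm_cong:
  "(\<And>v. v \<in> vars_trm t \<Longrightarrow> s v = s' v) \<Longrightarrow> eval_trm M s t = eval_trm M s' t"
proof (induct t)
  case (Fun f ts)
  then have "map (eval_trm M s) ts = map (eval_trm M s') ts"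
    by (auto intro!: map_cong)
  then show ?case by (simp only: eval_trm.simps)
qed auto

lemma sat_cong:
  "(\<And>v. v \<in> free_vars \<phi> \<Longrightarrow> s v = s' v) \<Longrightarrow> sat M s \<phi> \<longleftrightarrow> sat M s' \<phi>"
proof (induct \<phi> arbitrary: s s')
  case (Equal t u)
  then show ?case using eval_trm_cong[of t s s' M] eval_trm_cong[of u s s' M] by auto
next
  case (Rel r ts)
  then have "map (eval_trm M s) ts = map (eval_trm M s') ts"
    by (auto intro!: map_cong eval_trm_cong)
  then show ?case by (simp only: sat.simps)
next
  case (Neg \<phi>)
  then show ?case by (metis free_vars.simps(3) sat.simps(3))
next
  case (Conj \<phi> \<psi>)
  from Conj(1)[of s s'] Conj(2)[of s s'] Conj(3) show ?case by auto
next
  case (Exists i \<phi>)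
  have "sat M (s(i := a)) \<phi> \<longleftrightarrow> sat M (s'(i := a)) \<phi>" for a
    by (rule Exists(1)) (use Exists(2) in auto)
  then show ?case by simp
qed

lemma sat_formulas_cong:
  "\<phi> \<in> formulas \<Sigma> n \<Longrightarrow> (\<And>v. v < n \<Longrightarrow> s v = s' v) \<Longrightarrow> sat M s \<phi> \<longleftrightarrow> sat M s' \<phi>"
  by (rule sat_cong) (auto simp: formulas_def)

lemma sat_append:
  "\<phi> \<in> formulas \<Sigma> n \<Longrightarrow> length xs = n \<Longrightarrow> sat M ((!) (xs @ ys)) \<phi> \<longleftrightarrow> sat M ((!) xs) \<phi>"
  by (rule sat_formulas_cong) (auto simp: nth_append)

lemma sat_fun_upd_snoc:
  "\<phi> \<in> formulas \<Sigma> (Suc n) \<Longrightarrow> length xs = n \<Longrightarrow>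
     sat M (((!) xs)(n := a)) \<phi> \<longleftrightarrow> sat M ((!) (xs @ [a])) \<phi>"
  by (rule sat_formulas_cong) (auto simp: nth_append)

text \<open>Binding the index just past the tuple makes a witness the entry appended to it; the
  extension steps for types use this form.\<close>

lemma sat_Exists_snoc:
  "\<phi> \<in> formulas \<Sigma> (Suc n) \<Longrightarrow> length xs = n \<Longrightarrow>
     sat M ((!) xs) (Exists n \<phi>) \<longleftrightarrow> (\<exists>a\<in>universe M. sat M ((!) (xs @ [a])) \<phi>)"
  by (simp add: sat_fun_upd_snoc)

text \<open>The innermost quantifier binds the highest index: each bound variable is then the last
  entry of a tuple, as in \<open>sat_Exists_snoc\<close>.\<close>

fun exists_block :: "nat \<Rightarrow> nat \<Rightarrow> ('f, 'r) form \<Rightarrow> ('f, 'r) form" where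
  "exists_block n 0 \<phi> = \<phi>"
| "exists_block n (Suc k) \<phi> = exists_block n k (Exists (n + k) \<phi>)"

lemma exists_block_formulas:
  "\<phi> \<in> formulas \<Sigma> (n + k) \<Longrightarrow> exists_block n k \<phi> \<in> formulas \<Sigma> n"
  by (induct k arbitrary: \<phi>) (auto simp: formulas_Exists)

lemma sat_exists_block:
  "\<phi> \<in> formulas \<Sigma> (n + k) \<Longrightarrow> length xs = n \<Longrightarrow>
     sat M ((!) xs) (exists_block n k \<phi>) \<longleftrightarrow> (\<exists>ys\<in>tuples (universe M) k. sat M ((!) (xs @ ys)) \<phi>)"
proof (induct k arbitrary: \<phi>)
  case 0
  then show ?case by (simp add: tuples_def)
next
  case (Suc k)
  have "sat M ((!) xs) (exists_block n (Suc k) \<phi>) \<longleftrightarrow>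
      (\<exists>ys\<in>tuples (universe M) k. sat M ((!) (xs @ ys)) (Exists (n + k) \<phi>))"
    using Suc by (simp add: formulas_Exists)
  also have "\<dots> \<longleftrightarrow> (\<exists>ys\<in>tuples (universe M) k. \<exists>a\<in>universe M. sat M ((!) ((xs @ ys) @ [a])) \<phi>)"
    using Suc(2,3) by (intro bex_cong refl sat_Exists_snoc) (auto simp: tuples_def)
  also have "\<dots> \<longleftrightarrow> (\<exists>ys\<in>tuples (universe M) (Suc k). sat M ((!) (xs @ ys)) \<phi>)"
    (is "?l = ?r")
  proof
    assume ?l
    then show ?r using tuples_snoc by fastforce
  next
    assume ?r
    then show ?l by (metis append_assoc tuples_Suc_cases)
  qed
  finally show ?case .
qed

text \<open>Stands for the empty conjunction, which the syntax lacks; it holds because universes are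
  nonempty.\<close>

definition truth :: "('f, 'r) form" where
  "truth = Exists 0 (Equal (Var 0) (Var 0))"

lemma truth_formulas [simp]: "truth \<in> formulas \<Sigma> n"
  by (simp add: truth_def formulas_def)

lemma sat_truth [simp]: "is_structure \<Sigma> M \<Longrightarrow> sat M s truth"
  by (auto simp: truth_def is_structure_def)

fun conjs :: "('f, 'r) form list \<Rightarrow> ('f, 'r) form" where
  "conjs [] = truth"
| "conjs (\<phi> # \<phi>s) = Conj \<phi> (conjs \<phi>s)"

lemma conjs_formulas [simp]: "conjs \<phi>s \<in> formulas \<Sigma> n \<longleftrightarrow> set \<phi>s \<subseteq> formulas \<Sigma> n"
  by (induct \<phi>s) auto

lemma sat_conjs: "is_structure \<Sigma> M \<Longrightarrow> sat M s (conjs \<phi>s) \<longleftrightarrow> (\<forall>\<phi>\<in>set \<phi>s. sat M s \<phi>)"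
  by (induct \<phi>s) auto

section \<open>Renaming of variables\<close>

fun rename_trm :: "(nat \<Rightarrow> nat) \<Rightarrow> 'f trm \<Rightarrow> 'f trm" where
  "rename_trm e (Var i) = Var (e i)"
| "rename_trm e (Fun f ts) = Fun f (map (rename_trm e) ts)"

text \<open>The bound variable is replaced by a fresh one, so that \<open>e\<close> need not be injective.\<close>

fun rename :: "(nat \<Rightarrow> nat) \<Rightarrow> ('f, 'r) form \<Rightarrow> ('f, 'r) form" where
  "rename e (Equal t u) = Equal (rename_trm e t) (rename_trm e u)"
| "rename e (Rel r ts) = Rel r (map (rename_trm e) ts)"
| "rename e (Neg \<phi>) = Neg (rename e \<phi>)"
| "rename e (Conj \<phi> \<psi>) = Conj (rename e \<phi>) (rename e \<psi>)"
| "rename e (Exists i \<phi>) =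
     (let k = Suc (Max (insert 0 (e ` free_vars \<phi>))) in Exists k (rename (e(i := k)) \<phi>))"

lemma vars_rename_trm: "vars_trm (rename_trm e t) = e ` vars_trm t"
  by (induct t) auto

lemma wf_rename_trm: "wf_trm \<Sigma> t \<Longrightarrow> wf_trm \<Sigma> (rename_trm e t)"
  by (induct t) auto

lemma eval_rename_trm: "eval_trm M s (rename_trm e t) = eval_trm M (\<lambda>v. s (e v)) t"
proof (induct t)
  case (Fun f ts)
  then have "map (eval_trm M s) (map (rename_trm e) ts) = map (eval_trm M (\<lambda>v. s (e v))) ts"
    by auto
  then show ?case by (simp only: eval_trm.simps rename_trm.simps)
qed auto

lemma wf_rename: "wf_form \<Sigma> \<phi> \<Longrightarrow> wf_form \<Sigma> (rename e \<phi>)"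
  by (induct \<phi> arbitrary: e) (auto simp: wf_rename_trm Let_def)

lemma free_vars_rename: "free_vars (rename e \<phi>) \<subseteq> e ` free_vars \<phi>"
proof (induct \<phi> arbitrary: e)
  case (Exists i \<phi>)
  define k where "k = Suc (Max (insert 0 (e ` free_vars \<phi>)))"
  have "free_vars (rename e (Exists i \<phi>)) = free_vars (rename (e(i := k)) \<phi>) - {k}"
    by (simp add: k_def Let_def)
  also have "\<dots> \<subseteq> (e(i := k)) ` free_vars \<phi> - {k}"
    using Exists by blast
  also have "\<dots> \<subseteq> e ` (free_vars \<phi> - {i})" by auto
  finally show ?case by simp
qed (force simp: vars_rename_trm)+

lemma sat_rename: "sat M s (rename e \<phi>) \<longleftrightarrow> sat M (\<lambda>v. s (e v)) \<phi>"
proof (induct \<phi> arbitrary: e s)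
  case (Equal t u)
  then show ?case by (simp add: eval_rename_trm)
next
  case (Rel r ts)
  have "map (eval_trm M s) (map (rename_trm e) ts) = map (eval_trm M (\<lambda>v. s (e v))) ts"
    by (auto simp: eval_rename_trm)
  then show ?case by (simp only: sat.simps rename.simps)
next
  case (Exists i \<phi>)
  define k where "k = Suc (Max (insert 0 (e ` free_vars \<phi>)))"
  have fresh: "e v \<noteq> k" if "v \<in> free_vars \<phi>" for v
  proof -
    have "e v \<le> Max (insert 0 (e ` free_vars \<phi>))"
      using that by (intro Max_ge) (auto simp: finite_free_vars)
    then show ?thesis by (simp add: k_def)
  qed
  \<comment> \<open>\<open>k\<close> lies above every value of \<open>e\<close> on the free
    variables of \<open>\<phi>\<close>, so reassigning it affects the bound variable alone.\<close>
  have "sat M (s(k := a)) (rename (e(i := k)) \<phi>) \<longleftrightarrow> sat M ((\<lambda>v. s (e v))(i := a)) \<phi>" for a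
    unfolding Exists by (rule sat_cong) (auto simp: fresh)
  then show ?case by (simp add: k_def Let_def)
qed auto

lemma rename_formulas:
  "\<phi> \<in> formulas \<Sigma> m \<Longrightarrow> (\<And>i. i < m \<Longrightarrow> e i < n) \<Longrightarrow> rename e \<phi> \<in> formulas \<Sigma> n"
  using free_vars_rename[of e \<phi>] by (fastforce simp: formulas_def wf_rename)

text \<open>A sentence ignores its assignment, so the empty tuple represents all of them; a nonempty
  universe keeps the quantification over assignments from being vacuous.\<close>

lemma theory_of_eq:
  assumes "is_structure \<Sigma> M"
  shows "theory_of \<Sigma> M = {\<phi> \<in> formulas \<Sigma> 0. sat M ((!) []) \<phi>}"
proof -
  obtain a where a: "a \<in> universe M" using assms by (auto simp: is_structure_def)
  have "(\<forall>s. range s \<subseteq> universe M \<longrightarrow> sat M s \<phi>) \<longleftrightarrow> sat M ((!) []) \<phi>"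
    if "free_vars \<phi> = {}" for \<phi> :: "('a, 'b) form"
  proof -
    have "sat M s \<phi> \<longleftrightarrow> sat M ((!) []) \<phi>" for s
      by (rule sat_cong) (simp add: that)
    then show ?thesis using a by (auto dest: spec[of _ "\<lambda>_. a"])
  qed
  then show ?thesis by (auto simp: theory_of_def sentence_def formulas_def)
qed

section \<open>Isomorphisms and transport of satisfaction\<close>

lemma is_structureI:
  assumes "universe M \<noteq> {}"
    and "\<And>f xs. (f, length xs) \<in> fun_syms \<Sigma> \<Longrightarrow> set xs \<subseteq> universe M \<Longrightarrow> fun_interp M f xs \<in> universe M"
  shows "is_structure \<Sigma> M"
  using assms by (auto simp: is_structure_def)

lemma is_structure_fun_interp:
  "is_structure \<Sigma> M \<Longrightarrow> (f, length xs) \<in> fun_syms \<Sigma> \<Longrightarrow> set xs \<subseteq> universe M \<Longrightarrow>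
     fun_interp M f xs \<in> universe M"
  by (force simp: is_structure_def)

lemma isomorphismI:
  assumes "bij_betw h (universe M) (universe N)"
    and "\<And>f xs. (f, length xs) \<in> fun_syms \<Sigma> \<Longrightarrow> set xs \<subseteq> universe M \<Longrightarrow>
           h (fun_interp M f xs) = fun_interp N f (map h xs)"
    and "\<And>r xs. (r, length xs) \<in> rel_syms \<Sigma> \<Longrightarrow> set xs \<subseteq> universe M \<Longrightarrow>
           rel_interp M r xs \<longleftrightarrow> rel_interp N r (map h xs)"
  shows "isomorphism \<Sigma> M N h"
  using assms by (auto simp: isomorphism_def)

lemma isomorphism_bij: "isomorphism \<Sigma> M N h \<Longrightarrow> bij_betw h (universe M) (universe N)"
  by (simp add: isomorphism_def)

lemma isomorphism_fun_interp:
  "isomorphism \<Sigma> M N h \<Longrightarrow> (f, length xs) \<in> fun_syms \<Sigma> \<Longrightarrow> set xs \<subseteq> universe M \<Longrightarrow>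
     h (fun_interp M f xs) = fun_interp N f (map h xs)"
  by (force simp: isomorphism_def)

lemma isomorphism_rel_interp:
  "isomorphism \<Sigma> M N h \<Longrightarrow> (r, length xs) \<in> rel_syms \<Sigma> \<Longrightarrow> set xs \<subseteq> universe M \<Longrightarrow>
     rel_interp N r (map h xs) \<longleftrightarrow> rel_interp M r xs"
  by (force simp: isomorphism_def)

lemma eval_trm_closed:
  "is_structure \<Sigma> M \<Longrightarrow> wf_trm \<Sigma> t \<Longrightarrow> (\<And>v. v \<in> vars_trm t \<Longrightarrow> s v \<in> universe M) \<Longrightarrow>
     eval_trm M s t \<in> universe M"
proof (induct t)
  case (Fun f ts)
  have "set (map (eval_trm M s) ts) \<subseteq> universe M" using Fun by auto
  then show ?case using Fun(2,3) is_structure_fun_interp[of \<Sigma> M f "map (eval_trm M s) ts"] by simp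
qed auto

lemma eval_trm_isomorphism:
  assumes "is_structure \<Sigma> M" "isomorphism \<Sigma> M N h"
  shows "wf_trm \<Sigma> t \<Longrightarrow> (\<And>v. v \<in> vars_trm t \<Longrightarrow> s v \<in> universe M) \<Longrightarrow>
     eval_trm N (\<lambda>v. h (s v)) t = h (eval_trm M s t)"
proof (induct t)
  case (Fun f ts)
  have "set (map (eval_trm M s) ts) \<subseteq> universe M"
    using Fun eval_trm_closed[OF assms(1)] by fastforce
  moreover have "map (eval_trm N (\<lambda>v. h (s v))) ts = map h (map (eval_trm M s) ts)"
    using Fun by auto
  ultimately show ?case
    using Fun(2) isomorphism_fun_interp[OF assms(2), of f "map (eval_trm M s) ts"]
    by (simp del: map_map)
qed auto

lemma sat_isomorphism:
  assumes "is_structure \<Sigma> M" "isomorphism \<Sigma> M N h"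
  shows "wf_form \<Sigma> \<phi> \<Longrightarrow> (\<And>v. v \<in> free_vars \<phi> \<Longrightarrow> s v \<in> universe M) \<Longrightarrow>
     sat N (\<lambda>v. h (s v)) \<phi> \<longleftrightarrow> sat M s \<phi>"
proof (induct \<phi> arbitrary: s)
  case (Equal t u)
  have "eval_trm M s t \<in> universe M" "eval_trm M s u \<in> universe M"
    using Equal by (auto intro!: eval_trm_closed[OF assms(1)])
  moreover have "inj_on h (universe M)"
    using assms(2) by (auto simp: isomorphism_def bij_betw_def)
  ultimately show ?case using Equal
    by (simp add: eval_trm_isomorphism[OF assms] inj_on_eq_iff)
next
  case (Rel r ts)
  have "set (map (eval_trm M s) ts) \<subseteq> universe M"
    using Rel eval_trm_closed[OF assms(1)] by fastforce
  moreover have "map (eval_trm N (\<lambda>v. h (s v))) ts = map h (map (eval_trm M s) ts)"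
    using Rel by (auto intro!: eval_trm_isomorphism[OF assms])
  ultimately show ?case
    using Rel(1) isomorphism_rel_interp[OF assms(2), of r "map (eval_trm M s) ts"]
    by (simp del: map_map)
next
  case (Exists i \<phi>)
  \<comment> \<open>Values of \<open>h\<close> suffice as witnesses in \<open>N\<close>, as
    \<open>h\<close> is onto.\<close>
  have "sat N ((\<lambda>v. h (s v))(i := h a)) \<phi> \<longleftrightarrow> sat M (s(i := a)) \<phi>" if "a \<in> universe M" for a
    using Exists(1)[of "s(i := a)"] Exists(2,3) that by (auto simp: fun_upd_def if_distrib[of h])
  moreover have "universe N = h ` universe M"
    using assms(2) by (auto simp: isomorphism_def bij_betw_def)
  ultimately show ?case by simp
next
  case (Neg \<phi>)
  then show ?case by simp
next
  case (Conj \<phi> \<psi>)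
  then show ?case by simp
qed

lemma sat_isomorphism_tuple:
  assumes "is_structure \<Sigma> M" "isomorphism \<Sigma> M N h" "xs \<in> tuples (universe M) n"
    "\<phi> \<in> formulas \<Sigma> n"
  shows "sat N ((!) (map h xs)) \<phi> \<longleftrightarrow> sat M ((!) xs) \<phi>"
proof -
  have "sat N ((!) (map h xs)) \<phi> \<longleftrightarrow> sat N (\<lambda>v. h (xs ! v)) \<phi>"
    using assms(3,4) by (intro sat_formulas_cong[of \<phi> \<Sigma> n]) (auto simp: tuples_def)
  also have "\<dots> \<longleftrightarrow> sat M ((!) xs) \<phi>"
    using assms(3,4) by (intro sat_isomorphism[OF assms(1,2)]) (force simp: formulas_def tuples_def)+
  finally show ?thesis .
qed

lemma theory_of_isomorphism:
  assumes "is_structure \<Sigma> M" "is_structure \<Sigma> N" "isomorphism \<Sigma> M N h"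
  shows "theory_of \<Sigma> N = theory_of \<Sigma> M"
  using sat_isomorphism_tuple[OF assms(1,3), of "[]" 0] assms(1,2)
  by (auto simp: theory_of_eq tuples_def)

lemma isomorphism_comp:
  assumes "isomorphism \<Sigma> M N h" "isomorphism \<Sigma> N P g"
  shows "isomorphism \<Sigma> M P (g \<circ> h)"
proof (rule isomorphismI)
  have h: "bij_betw h (universe M) (universe N)" using assms(1) by (rule isomorphism_bij)
  show "bij_betw (g \<circ> h) (universe M) (universe P)"
    using h isomorphism_bij[OF assms(2)] by (rule bij_betw_trans)
  fix xs assume xs: "set xs \<subseteq> universe M"
  then have hs: "set (map h xs) \<subseteq> universe N" using h by (auto simp: bij_betw_def)
  show "(g \<circ> h) (fun_interp M f xs) = fun_interp P f (map (g \<circ> h) xs)"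
    if "(f, length xs) \<in> fun_syms \<Sigma>" for f
    using isomorphism_fun_interp[OF assms(1) that xs] isomorphism_fun_interp[OF assms(2) _ hs, of f] that
    by simp
  show "rel_interp M r xs = rel_interp P r (map (g \<circ> h) xs)"
    if "(r, length xs) \<in> rel_syms \<Sigma>" for r
    using isomorphism_rel_interp[OF assms(1) that xs] isomorphism_rel_interp[OF assms(2) _ hs, of r] that
    by simp
qed

lemma isomorphism_id: "isomorphism \<Sigma> M M id"
  by (auto simp: isomorphism_def)

lemma isomorphism_inv:
  assumes "is_structure \<Sigma> M" "isomorphism \<Sigma> M N h"
  shows "isomorphism \<Sigma> N M (inv_into (universe M) h)"
proof (rule isomorphismI)
  have h: "bij_betw h (universe M) (universe N)" using assms(2) by (rule isomorphism_bij)
  define g where "g = inv_into (universe M) h"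
  show "bij_betw g (universe N) (universe M)"
    using h by (simp add: g_def bij_betw_inv_into)
  fix ys assume ys: "set ys \<subseteq> universe N"
  define xs where "xs = map g ys"
  have xs: "set xs \<subseteq> universe M" "map h xs = ys"
    using ys h by (auto simp: xs_def g_def bij_betw_def inv_into_into f_inv_into_f
        intro!: map_idI)
  have gh: "g (h x) = x" if "x \<in> universe M" for x
    using that h by (simp add: g_def bij_betw_def)
  have len: "length ys = length xs" by (simp add: xs_def)
  show "g (fun_interp N f ys) = fun_interp M f (map g ys)"
    if "(f, length ys) \<in> fun_syms \<Sigma>" for f
  proof -
    have f: "(f, length xs) \<in> fun_syms \<Sigma>" using that by (simp add: len)
    show ?thesis
      using isomorphism_fun_interp[OF assms(2) f xs(1)] is_structure_fun_interp[OF assms(1) f xs(1)] xs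
      by (metis gh xs_def)
  qed
  show "rel_interp N r ys = rel_interp M r (map g ys)"
    if "(r, length ys) \<in> rel_syms \<Sigma>" for r
    using isomorphism_rel_interp[OF assms(2) _ xs(1)] xs that len by (metis xs_def)
qed

text \<open>Transport along an injection into the natural numbers brings any countable structure
  into the range of the quantifier in \<open>omega_categorical\<close>.\<close>

lemma countable_structure_copy:
  assumes "is_structure \<Sigma> M" "countable (universe M)"
  obtains N :: "('f, 'r, nat) struc" and h where "is_structure \<Sigma> N" "isomorphism \<Sigma> M N h"
proof -
  define h where "h = to_nat_on (universe M)"
  define g where "g = inv_into (universe M) h"
  have inj: "inj_on h (universe M)" unfolding h_def using assms(2) by (rule inj_on_to_nat_on)
  have gh: "g (h x) = x" if "x \<in> universe M" for x using inj that by (simp add: g_def)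
  have mgh: "map g (map h xs) = xs" if "set xs \<subseteq> universe M" for xs
    using that gh by (auto intro!: map_idI)
  define N :: "('f, 'r, nat) struc" where
    "N = \<lparr>universe = h ` universe M, fun_interp = (\<lambda>f xs. h (fun_interp M f (map g xs))),
          rel_interp = (\<lambda>r xs. rel_interp M r (map g xs))\<rparr>"
  have "is_structure \<Sigma> N"
  proof (rule is_structureI)
    show "universe N \<noteq> {}" using assms(1) by (auto simp: N_def is_structure_def)
    fix f and ys :: "nat list" assume f: "(f, length ys) \<in> fun_syms \<Sigma>" "set ys \<subseteq> universe N"
    then have "set (map g ys) \<subseteq> universe M" by (auto simp: N_def gh)
    then have "fun_interp M f (map g ys) \<in> universe M"
      using is_structure_fun_interp[OF assms(1), of f "map g ys"] f(1) by simp
    then show "fun_interp N f ys \<in> universe N" by (simp add: N_def)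
  qed
  moreover have "isomorphism \<Sigma> M N h"
    by (rule isomorphismI) (auto simp: N_def bij_betw_def inj mgh simp del: map_map)
  ultimately show ?thesis using that by blast
qed

section \<open>Isolated types and back-and-forth\<close>

definition type_eq ::
  "('f, 'r) signature \<Rightarrow> ('f, 'r, 'a) struc \<Rightarrow> 'a list \<Rightarrow> ('f, 'r, 'b) struc \<Rightarrow> 'b list \<Rightarrow> bool" where
  "type_eq \<Sigma> M xs N ys \<longleftrightarrow> length xs = length ys \<and>
     (\<forall>\<phi>\<in>formulas \<Sigma> (length xs). sat M ((!) xs) \<phi> \<longleftrightarrow> sat N ((!) ys) \<phi>)"

text \<open>An unsatisfied formula counts as complete too; in \<open>isolated\<close> the tuple
  itself provides satisfaction.\<close>

definition complete_formula ::
  "('f, 'r) signature \<Rightarrow> ('f, 'r, 'a) struc \<Rightarrow> nat \<Rightarrow> ('f, 'r) form \<Rightarrow> bool" where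
  "complete_formula \<Sigma> M n \<phi> \<longleftrightarrow> \<phi> \<in> formulas \<Sigma> n \<and>
     (\<forall>xs\<in>tuples (universe M) n. \<forall>ys\<in>tuples (universe M) n.
        sat M ((!) xs) \<phi> \<longrightarrow> sat M ((!) ys) \<phi> \<longrightarrow> type_eq \<Sigma> M xs M ys)"

definition isolated :: "('f, 'r) signature \<Rightarrow> ('f, 'r, 'a) struc \<Rightarrow> 'a list \<Rightarrow> bool" where
  "isolated \<Sigma> M xs \<longleftrightarrow> (\<exists>\<phi>. complete_formula \<Sigma> M (length xs) \<phi> \<and> sat M ((!) xs) \<phi>)"

definition atomic_structure :: "('f, 'r) signature \<Rightarrow> ('f, 'r, 'a) struc \<Rightarrow> bool" where
  "atomic_structure \<Sigma> M \<longleftrightarrow> (\<forall>xs. set xs \<subseteq> universe M \<longrightarrow> isolated \<Sigma> M xs)"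

lemma type_eqD:
  "type_eq \<Sigma> M xs N ys \<Longrightarrow> \<phi> \<in> formulas \<Sigma> (length xs) \<Longrightarrow> sat N ((!) ys) \<phi> \<longleftrightarrow> sat M ((!) xs) \<phi>"
  by (simp add: type_eq_def)

lemma type_eq_sym: "type_eq \<Sigma> M xs N ys \<Longrightarrow> type_eq \<Sigma> N ys M xs"
  by (auto simp: type_eq_def)

lemma type_eq_trans: "type_eq \<Sigma> M xs N ys \<Longrightarrow> type_eq \<Sigma> N ys P zs \<Longrightarrow> type_eq \<Sigma> M xs P zs"
  by (auto simp: type_eq_def)

text \<open>Closing under negation makes one implication between the types suffice.\<close>

lemma type_eqI:
  assumes "length xs = length ys"
    and "\<And>\<phi>. \<phi> \<in> formulas \<Sigma> (length xs) \<Longrightarrow> sat M ((!) xs) \<phi> \<Longrightarrow> sat N ((!) ys) \<phi>"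
  shows "type_eq \<Sigma> M xs N ys"
  unfolding type_eq_def
proof (intro conjI ballI iffI)
  fix \<phi> assume "\<phi> \<in> formulas \<Sigma> (length xs)" "sat N ((!) ys) \<phi>"
  then show "sat M ((!) xs) \<phi>" using assms(2)[of "Neg \<phi>"] by auto
qed (use assms in blast)+

lemma type_eq_isomorphism:
  assumes "is_structure \<Sigma> M" "isomorphism \<Sigma> M N h" "set xs \<subseteq> universe M"
  shows "type_eq \<Sigma> M xs N (map h xs)"
proof (rule type_eqI)
  fix \<phi> assume "\<phi> \<in> formulas \<Sigma> (length xs)" "sat M ((!) xs) \<phi>"
  moreover have "xs \<in> tuples (universe M) (length xs)" using assms(3) by (simp add: tuples_def)
  ultimately show "sat N ((!) (map h xs)) \<phi>"
    using sat_isomorphism_tuple[OF assms(1,2)] by blast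
qed simp

text \<open>Elementary equivalence becomes the case of empty tuples, from which back-and-forth can
  start.\<close>

lemma type_eq_Nil_iff:
  assumes "is_structure \<Sigma> M" "is_structure \<Sigma> N"
  shows "type_eq \<Sigma> M [] N [] \<longleftrightarrow> theory_of \<Sigma> N = theory_of \<Sigma> M"
  unfolding type_eq_def theory_of_eq[OF assms(1)] theory_of_eq[OF assms(2)] by auto

lemma type_eq_append: "type_eq \<Sigma> M (xs @ us) N (ys @ vs) \<Longrightarrow> length xs = length ys \<Longrightarrow> type_eq \<Sigma> M xs N ys"
proof (rule type_eqI)
  assume t: "type_eq \<Sigma> M (xs @ us) N (ys @ vs)" and l: "length xs = length ys"
  fix \<phi> assume \<phi>: "\<phi> \<in> formulas \<Sigma> (length xs)" "sat M ((!) xs) \<phi>"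
  then have "\<phi> \<in> formulas \<Sigma> (length (xs @ us))"
    using formulas_mono[of "length xs" "length (xs @ us)" \<Sigma>] by auto
  then show "sat N ((!) ys) \<phi>"
    using type_eqD[OF t, of \<phi>] sat_append[OF \<phi>(1)] \<phi>(2) l by metis
qed simp

lemma type_eq_Nil: "type_eq \<Sigma> M xs N ys \<Longrightarrow> type_eq \<Sigma> M [] N []"
  using type_eq_append[of \<Sigma> M "[]" xs N "[]" ys] by simp

text \<open>Completeness of \<open>\<phi>\<close> is a family of sentences: for no
  \<open>\<psi>\<close> are both \<open>Conj \<phi> \<psi>\<close> and
  \<open>Conj \<phi> (Neg \<psi>)\<close> realised. Elementarily equivalent structures agree on each
  of them.\<close>

lemma complete_formula_transfer:
  assumes "type_eq \<Sigma> M [] N []" and c: "complete_formula \<Sigma> M n \<phi>"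
  shows "complete_formula \<Sigma> N n \<phi>"
  unfolding complete_formula_def
proof (intro conjI ballI impI)
  show \<phi>: "\<phi> \<in> formulas \<Sigma> n" using c by (simp add: complete_formula_def)
  have ex: "\<exists>xs\<in>tuples (universe M) n. sat M ((!) xs) \<psi>"
    if "\<psi> \<in> formulas \<Sigma> n" "xs \<in> tuples (universe N) n" "sat N ((!) xs) \<psi>" for \<psi> xs
  proof -
    have "sat N ((!) []) (exists_block 0 n \<psi>)"
      using sat_exists_block[of \<psi> \<Sigma> 0 n "[]" N] that by auto
    then have "sat M ((!) []) (exists_block 0 n \<psi>)"
      using type_eqD[OF assms(1), of "exists_block 0 n \<psi>"] exists_block_formulas[of \<psi> \<Sigma> 0 n] that(1)
      by simp
    then show ?thesis using sat_exists_block[of \<psi> \<Sigma> 0 n "[]" M] that by auto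
  qed
  fix xs ys
  assume xs: "xs \<in> tuples (universe N) n" "sat N ((!) xs) \<phi>"
    and ys: "ys \<in> tuples (universe N) n" "sat N ((!) ys) \<phi>"
  show "type_eq \<Sigma> N xs N ys"
  proof (rule type_eqI)
    show "length xs = length ys" using xs ys by (simp add: tuples_def)
    fix \<psi> assume "\<psi> \<in> formulas \<Sigma> (length xs)" and sx: "sat N ((!) xs) \<psi>"
    then have \<psi>: "\<psi> \<in> formulas \<Sigma> n" using xs by (simp add: tuples_def)
    show "sat N ((!) ys) \<psi>"
    proof (rule ccontr)
      assume "\<not> sat N ((!) ys) \<psi>"
      then obtain us vs where "us \<in> tuples (universe M) n" "sat M ((!) us) (Conj \<phi> \<psi>)"
        "vs \<in> tuples (universe M) n" "sat M ((!) vs) (Conj \<phi> (Neg \<psi>))"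
        using ex[of "Conj \<phi> \<psi>" xs] ex[of "Conj \<phi> (Neg \<psi>)" ys] xs ys sx \<phi> \<psi> by auto
      then show False
        using c \<psi> unfolding complete_formula_def
        by (metis sat.simps(3,4) tuplesD(1) type_eqD)
    qed
  qed
qed

text \<open>One back-and-forth step. A formula isolating \<open>xs @ [a]\<close> is realised over
  \<open>ys\<close> because its existential quantification belongs to the common type, and
  completeness, transferred to \<open>N\<close>, fixes the type of whatever realises it.\<close>

lemma type_eq_extend:
  assumes "type_eq \<Sigma> M xs N ys" "isolated \<Sigma> M (xs @ [a])"
    and "set xs \<subseteq> universe M" "a \<in> universe M" "set ys \<subseteq> universe N"
  shows "\<exists>b\<in>universe N. type_eq \<Sigma> M (xs @ [a]) N (ys @ [b])"
proof -
  define n where "n = length xs"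
  have ly: "length ys = n" using assms(1) by (simp add: type_eq_def n_def)
  obtain \<phi> where \<phi>: "complete_formula \<Sigma> M (Suc n) \<phi>" "sat M ((!) (xs @ [a])) \<phi>"
    using assms(2) by (auto simp: isolated_def n_def)
  then have F: "\<phi> \<in> formulas \<Sigma> (Suc n)" by (simp add: complete_formula_def)
  have lift: "\<exists>b\<in>universe N. sat N ((!) (ys @ [b])) \<psi>"
    if "\<psi> \<in> formulas \<Sigma> (Suc n)" "sat M ((!) (xs @ [a])) \<psi>" for \<psi>
  proof -
    have "sat M ((!) xs) (Exists n \<psi>)"
      unfolding sat_Exists_snoc[OF that(1) n_def[symmetric]] using that(2) assms(4) by blast
    then have "sat N ((!) ys) (Exists n \<psi>)"
      using type_eqD[OF assms(1), of "Exists n \<psi>"] formulas_Exists[OF that(1)]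
      unfolding n_def by blast
    then show ?thesis unfolding sat_Exists_snoc[OF that(1) ly] .
  qed
  obtain b where b: "b \<in> universe N" "sat N ((!) (ys @ [b])) \<phi>"
    using lift F \<phi>(2) by blast
  have c: "complete_formula \<Sigma> N (Suc n) \<phi>"
    by (rule complete_formula_transfer[OF type_eq_Nil[OF assms(1)] \<phi>(1)])
  have "type_eq \<Sigma> M (xs @ [a]) N (ys @ [b])"
  proof (rule type_eqI)
    show "length (xs @ [a]) = length (ys @ [b])" by (simp add: ly n_def)
    fix \<psi> assume "\<psi> \<in> formulas \<Sigma> (length (xs @ [a]))" and s: "sat M ((!) (xs @ [a])) \<psi>"
    then have \<psi>: "\<psi> \<in> formulas \<Sigma> (Suc n)" by (simp add: n_def)
    \<comment> \<open>The element realising \<open>Conj \<phi> \<psi>\<close> may differ from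
      \<open>b\<close>, but both satisfy the complete formula \<open>\<phi>\<close>, so
      \<open>\<psi>\<close> passes to \<open>b\<close>.\<close>
    have "\<exists>b'\<in>universe N. sat N ((!) (ys @ [b'])) (Conj \<phi> \<psi>)"
      by (rule lift) (use \<psi> F s \<phi>(2) in simp_all)
    then obtain b' where b': "b' \<in> universe N" "sat N ((!) (ys @ [b'])) (Conj \<phi> \<psi>)" by blast
    have t: "ys @ [b] \<in> tuples (universe N) (Suc n)" "ys @ [b'] \<in> tuples (universe N) (Suc n)"
      using b(1) b'(1) assms(5) ly by (auto simp: tuples_def)
    then have "type_eq \<Sigma> N (ys @ [b']) N (ys @ [b])"
      using c b(2) b'(2) by (auto simp: complete_formula_def)
    then show "sat N ((!) (ys @ [b])) \<psi>"
      using type_eqD[of \<Sigma> N "ys @ [b']" N "ys @ [b]" \<psi>] b'(2) \<psi> ly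
      by (metis length_append_singleton sat.simps(4))
  qed
  then show ?thesis using b(1) by blast
qed

lemma list_as_map_nth:
  assumes "set as \<subseteq> set us"
  obtains "is" where "as = map ((!) us) is" "set is \<subseteq> {..<length us}"
proof -
  define g where "g a = (SOME i. i < length us \<and> us ! i = a)" for a
  have g: "g a < length us \<and> us ! g a = a" if "a \<in> set us" for a
    unfolding g_def by (rule someI_ex) (use that in \<open>auto simp: in_set_conv_nth\<close>)
  have "as = map ((!) us) (map g as)"
    using assms g by (auto intro!: map_idI[symmetric])
  moreover have "set (map g as) \<subseteq> {..<length us}" using assms g by auto
  ultimately show ?thesis using that by blast
qed

text \<open>Finite partial elementary maps are kept as pairs of tuples of equal type. Repetitions in
  the tuples are allowed, so finite and infinite universes are treated alike.\<close>

lemma back_and_forth: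
  fixes M :: "('f, 'r, 'a) struc" and N :: "('f, 'r, 'b) struc"
  assumes M: "is_structure \<Sigma> M" "countable (universe M)" "atomic_structure \<Sigma> M"
    and N: "is_structure \<Sigma> N" "countable (universe N)" "atomic_structure \<Sigma> N"
    and te: "type_eq \<Sigma> M xs N ys" and sub: "set xs \<subseteq> universe M" "set ys \<subseteq> universe N"
  obtains h where "isomorphism \<Sigma> M N h" "map h xs = ys"
proof -
  have MN: "universe M \<noteq> {}" "universe N \<noteq> {}" using M(1) N(1) by (auto simp: is_structure_def)
  define good where "good p \<longleftrightarrow> type_eq \<Sigma> M (fst p) N (snd p) \<and>
      set (fst p) \<subseteq> universe M \<and> set (snd p) \<subseteq> universe N" for p :: "'a list \<times> 'b list"
  have forward: "\<exists>b. good (fst p @ [a], snd p @ [b])" if g: "good p" "a \<in> universe M" for p a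
  proof -
    have "isolated \<Sigma> M (fst p @ [a])"
      using M(3) g by (auto simp: atomic_structure_def good_def)
    then obtain b where "b \<in> universe N" "type_eq \<Sigma> M (fst p @ [a]) N (snd p @ [b])"
      using type_eq_extend[of \<Sigma> M "fst p" N "snd p" a] g by (auto simp: good_def)
    then show ?thesis using g by (fastforce simp: good_def)
  qed
  have backward: "\<exists>a. good (fst p @ [a], snd p @ [b])" if g: "good p" "b \<in> universe N" for p b
  proof -
    have "isolated \<Sigma> N (snd p @ [b])"
      using N(3) g by (auto simp: atomic_structure_def good_def)
    moreover have "type_eq \<Sigma> N (snd p) M (fst p)"
      using g type_eq_sym by (auto simp: good_def)
    ultimately obtain a where "a \<in> universe M" "type_eq \<Sigma> N (snd p @ [b]) M (fst p @ [a])"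
      using type_eq_extend[of \<Sigma> N "snd p" M "fst p" b] g by (auto simp: good_def)
    then show ?thesis using type_eq_sym g by (fastforce simp: good_def)
  qed
  \<comment> \<open>Stage \<open>k\<close> takes in the \<open>k\<close>-th element of either
    universe, so every element is reached.\<close>
  define step where "step k p p' \<longleftrightarrow> (\<exists>us vs. p' = (fst p @ us, snd p @ vs)) \<and>
      from_nat_into (universe M) k \<in> set (fst p') \<and> from_nat_into (universe N) k \<in> set (snd p')"
    for k :: nat and p p' :: "'a list \<times> 'b list"
  \<comment> \<open>The clause for \<open>k = 0\<close> pins the start of the sequence, so that the
    resulting isomorphism maps \<open>xs\<close> to \<open>ys\<close>.\<close>
  have "\<exists>f. \<forall>k. (good (f k) \<and> (k = 0 \<longrightarrow> f k = (xs, ys))) \<and> step k (f k) (f (Suc k))"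
  proof (rule dependent_nat_choice)
    show "\<exists>p. good p \<and> ((0::nat) = 0 \<longrightarrow> p = (xs, ys))" using te sub by (simp add: good_def)
    fix p and k :: nat assume "good p \<and> (k = 0 \<longrightarrow> p = (xs, ys))"
    then have p: "good p" by simp
    obtain b where b: "good (fst p @ [from_nat_into (universe M) k], snd p @ [b])"
      using forward[OF p from_nat_into] MN by blast
    obtain a where "good ((fst p @ [from_nat_into (universe M) k]) @ [a],
        (snd p @ [b]) @ [from_nat_into (universe N) k])"
      using backward[OF b from_nat_into, of k] MN by auto
    then show "\<exists>p'. (good p' \<and> (Suc k = 0 \<longrightarrow> p' = (xs, ys))) \<and> step k p p'"
      by (intro exI conjI, assumption) (auto simp: step_def)
  qed
  then obtain f where f: "\<And>k. good (f k)" "f 0 = (xs, ys)" "\<And>k. step k (f k) (f (Suc k))"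
    by blast
  define us where "us k = fst (f k)" for k
  define vs where "vs k = snd (f k)" for k
  have uv: "type_eq \<Sigma> M (us k) N (vs k)" "set (us k) \<subseteq> universe M" "set (vs k) \<subseteq> universe N" for k
    using f(1)[of k] by (auto simp: good_def us_def vs_def)
  then have len: "length (vs k) = length (us k)" for k by (simp add: type_eq_def)
  have mono: "\<exists>us' vs'. us k' = us k @ us' \<and> vs k' = vs k @ vs'" if "k \<le> k'" for k k'
    using that
  proof (induct rule: dec_induct)
    case (step n)
    then show ?case using f(3)[of n] by (auto simp: step_def us_def vs_def)
  qed simp
  have mono_set: "set (us k) \<subseteq> set (us k')" "set (vs k) \<subseteq> set (vs k')" if "k \<le> k'" for k k'
    using mono[OF that] by auto
  have cover: "\<exists>k. a \<in> set (us k)" if "a \<in> universe M" for a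
    using from_nat_into_surj[OF M(2) that] f(3) unfolding step_def us_def by blast
  have cover': "\<exists>k. b \<in> set (vs k)" if "b \<in> universe N" for b
    using from_nat_into_surj[OF N(2) that] f(3) unfolding step_def vs_def by blast
  have cover_list: "\<exists>k. set as \<subseteq> set (us k)" if "set as \<subseteq> universe M" for as
    using that
  proof (induct as)
    case (Cons a as)
    then obtain k where "set as \<subseteq> set (us k)" by auto
    moreover obtain k' where "a \<in> set (us k')" using cover[of a] Cons(2) by auto
    ultimately show ?case using mono_set(1)[of k "max k k'"] mono_set(1)[of k' "max k k'"] by auto
  qed simp
  have len0: "us 0 = xs" "vs 0 = ys" using f(2) by (simp_all add: us_def vs_def)
  \<comment> \<open>Equations between variables belong to the type; this makes \<open>h\<close> both
    well defined and injective.\<close>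
  have eq_iff: "us k ! i = us k ! j \<longleftrightarrow> vs k ! i = vs k ! j"
    if "i < length (us k)" "j < length (us k)" for k i j
    using type_eqD[OF uv(1), of "Equal (Var i) (Var j)" k] that by (simp add: formulas_def)
  define h where "h a = (SOME b. \<exists>k i. i < length (us k) \<and> us k ! i = a \<and> vs k ! i = b)" for a
  have h: "h (us k ! i) = vs k ! i" if i: "i < length (us k)" for k i
  proof -
    have "\<exists>k' i'. i' < length (us k') \<and> us k' ! i' = us k ! i \<and> vs k' ! i' = h (us k ! i)"
      unfolding h_def by (rule someI_ex) (use i in blast)
    then obtain k' i' where i': "i' < length (us k')" "us k' ! i' = us k ! i" "vs k' ! i' = h (us k ! i)"
      by blast
    \<comment> \<open>Two stages mentioning the same element are compared at a common later
      stage.\<close>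
    define m where "m = max k k'"
    have "us m ! i = us k ! i \<and> vs m ! i = vs k ! i \<and> i < length (us m)"
      using mono[of k m] i len[of k] by (auto simp: m_def nth_append)
    moreover have "us m ! i' = us k' ! i' \<and> vs m ! i' = vs k' ! i' \<and> i' < length (us m)"
      using mono[of k' m] i' len[of k'] by (auto simp: m_def nth_append)
    ultimately show ?thesis using eq_iff[of i m i'] i' by metis
  qed
  have hmap: "map h (map ((!) (us k)) is) = map ((!) (vs k)) is" if "set is \<subseteq> {..<length (us k)}" for k "is"
    using that h by auto
  have "isomorphism \<Sigma> M N h"
  proof (rule isomorphismI)
    show "bij_betw h (universe M) (universe N)"
      unfolding bij_betw_def
    proof
      show "inj_on h (universe M)"
      proof (rule inj_onI)
        fix a a' assume a: "a \<in> universe M" "a' \<in> universe M" "h a = h a'"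
        then obtain k where "set [a, a'] \<subseteq> set (us k)" using cover_list[of "[a, a']"] by auto
        then obtain i i' where "i < length (us k)" "i' < length (us k)" "a = us k ! i" "a' = us k ! i'"
          by (auto simp: in_set_conv_nth)
        then show "a = a'" using a(3) eq_iff[of i k i'] h by metis
      qed
      show "h ` universe M = universe N"
      proof (intro equalityI subsetI)
        fix b assume "b \<in> h ` universe M"
        then obtain a k where "b = h a" "a \<in> set (us k)" using cover by blast
        then show "b \<in> universe N"
          using h uv(3)[of k] len[of k] by (metis in_set_conv_nth subset_code(1))
      next
        fix b assume "b \<in> universe N"
        then obtain k i where "b = vs k ! i" "i < length (us k)"
          using cover' len by (metis in_set_conv_nth)
        then show "b \<in> h ` universe M"
          using h uv(2)[of k] by (metis image_eqI nth_mem subset_code(1))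
      qed
    qed
  next
    fix g as assume g: "(g, length as) \<in> fun_syms \<Sigma>" "set as \<subseteq> universe M"
    then have "set (fun_interp M g as # as) \<subseteq> universe M"
      using is_structure_fun_interp[OF M(1)] by simp
    then obtain k where k: "set (fun_interp M g as # as) \<subseteq> set (us k)" using cover_list by blast
    then obtain j where j: "us k ! j = fun_interp M g as" "j < length (us k)"
      by (auto simp: in_set_conv_nth)
    obtain "is" where "is": "as = map ((!) (us k)) is" "set is \<subseteq> {..<length (us k)}"
      using list_as_map_nth[of as "us k"] k by auto
    \<comment> \<open>The arguments and the value of the operation all occur at stage
      \<open>k\<close>, so the equation between them is a formula on that tuple.\<close>
    let ?\<phi> = "Equal (Var j) (Fun g (map Var is))"
    have "?\<phi> \<in> formulas \<Sigma> (length (us k))" using g(1) j(2) "is" by (auto simp: formulas_def)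
    moreover have "sat M ((!) (us k)) ?\<phi>" using j(1) "is"(1) by (simp add: comp_def)
    ultimately have "sat N ((!) (vs k)) ?\<phi>" using type_eqD[OF uv(1)] by blast
    then have "vs k ! j = fun_interp N g (map ((!) (vs k)) is)" by (simp add: comp_def)
    then show "h (fun_interp M g as) = fun_interp N g (map h as)"
      using h[OF j(2)] hmap[OF "is"(2)] j(1) "is"(1) by metis
  next
    fix r as assume r: "(r, length as) \<in> rel_syms \<Sigma>" "set as \<subseteq> universe M"
    then obtain k where k: "set as \<subseteq> set (us k)" using cover_list by blast
    then obtain "is" where "is": "as = map ((!) (us k)) is" "set is \<subseteq> {..<length (us k)}"
      using list_as_map_nth[of as "us k"] by blast
    let ?\<phi> = "Rel r (map Var is)"
    have "?\<phi> \<in> formulas \<Sigma> (length (us k))" using r(1) "is" by (auto simp: formulas_def)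
    then have "sat N ((!) (vs k)) ?\<phi> \<longleftrightarrow> sat M ((!) (us k)) ?\<phi>" using type_eqD[OF uv(1)] by blast
    then have "rel_interp N r (map ((!) (vs k)) is) \<longleftrightarrow> rel_interp M r (map ((!) (us k)) is)"
      by (simp add: comp_def)
    then show "rel_interp M r as \<longleftrightarrow> rel_interp N r (map h as)"
      using hmap[OF "is"(2)] by (simp only: "is"(1))
  qed
  moreover have "map h xs = ys"
    by (rule nth_equalityI) (use h[of _ 0] len[of 0] in \<open>simp_all add: len0\<close>)
  ultimately show ?thesis using that by blast
qed

section \<open>Realising types in countable structures\<close>

text \<open>In the order of filters, ultrafilters are the minimal proper ones; Zorn's lemma applies
  since the infimum of a chain of proper filters is proper.\<close>

lemma ultrafilter_below:
  fixes F :: "'a filter"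
  assumes "F \<noteq> bot"
  obtains U where "U \<le> F" "U \<noteq> bot" "\<And>P. eventually P U \<or> eventually (\<lambda>x. \<not> P x) U"
proof -
  define A where "A = {G. G \<noteq> bot \<and> G \<le> F}"
  have "\<exists>m\<in>A. \<forall>G\<in>A. m \<ge> G \<longrightarrow> G = m"
  proof (rule predicate_Zorn)
    show "partial_order_on A (relation_of (\<ge>) A)"
      by (rule partial_order_on_relation_ofI) auto
    fix C assume C: "C \<in> Chains (relation_of (\<ge>) A)"
    show "\<exists>u\<in>A. \<forall>G\<in>C. G \<ge> u"
    proof (cases "C = {}")
      case True
      then show ?thesis using assms by (auto simp: A_def)
    next
      case False
      have "C \<subseteq> A" using C by (auto simp: Chains_def relation_of_def)
      \<comment> \<open>A chain is directed, so an event of the infimum is already an event of one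
        of its members.\<close>
      have "eventually P (Inf C) \<longleftrightarrow> (\<exists>G\<in>C. eventually P G)" for P
      proof (rule eventually_Inf_base[OF False])
        fix G H assume "G \<in> C" "H \<in> C"
        then have "G \<le> H \<or> H \<le> G" using C by (auto simp: Chains_def relation_of_def)
        then show "\<exists>x\<in>C. x \<le> inf G H" using \<open>G \<in> C\<close> \<open>H \<in> C\<close> by (auto intro: bexI)
      qed
      then have "Inf C \<noteq> bot"
        using \<open>C \<subseteq> A\<close> by (auto simp: trivial_limit_def A_def)
      moreover have "Inf C \<le> F" using False \<open>C \<subseteq> A\<close> by (auto simp: A_def intro: Inf_lower2)
      ultimately show ?thesis by (intro bexI[of _ "Inf C"]) (auto simp: A_def Inf_lower)
    qed
  qed
  then obtain U where "U \<in> A" and min: "\<And>G. G \<in> A \<Longrightarrow> G \<le> U \<Longrightarrow> G = U"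
    by blast
  then have U: "U \<noteq> bot" "U \<le> F" by (auto simp: A_def)
  have "eventually P U \<or> eventually (\<lambda>x. \<not> P x) U" for P
  \<comment> \<open>If adding \<open>P\<close> to \<open>U\<close> gives the improper filter, then
    \<open>U\<close> contains the negation; otherwise minimality makes the enlarged filter equal to
    \<open>U\<close>.\<close>
  proof (cases "inf U (principal {x. P x}) = bot")
    case True
    then have "eventually (\<lambda>x. False) (inf U (principal {x. P x}))" by simp
    then show ?thesis by (simp add: eventually_inf_principal)
  next
    case False
    then have "inf U (principal {x. P x}) = U"
      using U(2) by (intro min) (auto simp: A_def intro: le_infI1)
    moreover have "eventually P (inf U (principal {x. P x}))"
      by (simp add: eventually_inf_principal)
    ultimately show ?thesis by simp
  qed
  then show ?thesis using that U by blast
qed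

text \<open>
  Names for the elements of the countable Skolem hull of a sequence of tuples in a power of a
  structure.
\<close>

datatype ('f, 'r) skolem = Base nat | Choice "('f, 'r) form" nat "('f, 'r) skolem list"

instance skolem :: (countable, countable) countable by countable_datatype

text \<open>In a nonempty universe the value stays inside even if nothing satisfies the formula, so
  Skolem terms can be evaluated everywhere.\<close>

definition witness :: "('f, 'r, 'a) struc \<Rightarrow> ('f, 'r) form \<Rightarrow> nat \<Rightarrow> (nat \<Rightarrow> 'a) \<Rightarrow> 'a" where
  "witness M \<phi> v s = (SOME a. a \<in> universe M \<and>
     ((\<exists>b\<in>universe M. sat M (s(v := b)) \<phi>) \<longrightarrow> sat M (s(v := a)) \<phi>))"

lemma witness:
  assumes "universe M \<noteq> {}"
  shows "witness M \<phi> v s \<in> universe M"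
    and "b \<in> universe M \<Longrightarrow> sat M (s(v := b)) \<phi> \<Longrightarrow> sat M (s(v := witness M \<phi> v s)) \<phi>"
proof -
  have "\<exists>a. a \<in> universe M \<and> ((\<exists>b\<in>universe M. sat M (s(v := b)) \<phi>) \<longrightarrow> sat M (s(v := a)) \<phi>)"
    using assms by auto
  from someI_ex[OF this] show "witness M \<phi> v s \<in> universe M"
    and "b \<in> universe M \<Longrightarrow> sat M (s(v := b)) \<phi> \<Longrightarrow> sat M (s(v := witness M \<phi> v s)) \<phi>"
    unfolding witness_def by blast+
qed

text \<open>\<open>Choice \<phi> v ts\<close> is the Skolem function of \<open>\<phi>\<close> for
  the variable \<open>v\<close>, with \<open>ts\<close> as values of the variables \<open>0\<close>,
  \<open>1\<close> and so on. Variables beyond the list receive the default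
  \<open>x 0\<close>.\<close>

fun skolem_val :: "('f, 'r, 'a) struc \<Rightarrow> (nat \<Rightarrow> 'a) \<Rightarrow> ('f, 'r) skolem \<Rightarrow> 'a" where
  "skolem_val M x (Base j) = x j"
| "skolem_val M x (Choice \<phi> v ts) = witness M \<phi> v
     (let as = map (skolem_val M x) ts in (\<lambda>u. if u < length as then as ! u else x 0))"

lemma skolem_val_closed:
  "universe M \<noteq> {} \<Longrightarrow> (\<And>j. x j \<in> universe M) \<Longrightarrow> skolem_val M x t \<in> universe M"
  by (cases t) (auto simp: witness(1))

text \<open>The Skolem function of this formula is \<open>f\<close> itself, so the hull is closed
  under the operations without a constructor for function symbols.\<close>

definition graph_form :: "'f \<Rightarrow> nat \<Rightarrow> ('f, 'r) form" where
  "graph_form f n = Equal (Var n) (Fun f (map Var [0..<n]))"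

lemma sat_graph_form: "sat M s (graph_form f n) \<longleftrightarrow> s n = fun_interp M f (map s [0..<n])"
  by (simp add: graph_form_def comp_def)

lemma witness_graph_form:
  assumes "is_structure \<Sigma> M" "(f, n) \<in> fun_syms \<Sigma>" "\<And>v. v < n \<Longrightarrow> s v \<in> universe M"
  shows "witness M (graph_form f n) n s = fun_interp M f (map s [0..<n])"
proof -
  have cl: "fun_interp M f (map s [0..<n]) \<in> universe M"
    by (rule is_structure_fun_interp[OF assms(1)]) (use assms(2,3) in auto)
  have map: "map (s(n := a)) [0..<n] = map s [0..<n]" for a by auto
  have "sat M (s(n := witness M (graph_form f n) n s)) (graph_form f n)"
    by (rule witness(2)[OF _ cl]) (use cl in \<open>auto simp: sat_graph_form map\<close>)
  then show ?thesis by (simp add: sat_graph_form map)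
qed

text \<open>Row \<open>X i\<close> lives in the \<open>i\<close>-th factor, and column
  \<open>j\<close> is the sequence named by \<open>Base j\<close>. An element of the hull is a
  number coding a Skolem term, evaluated in each factor by \<open>elt\<close>.\<close>

locale skolem_ultrapower =
  fixes \<Sigma> :: "('f::countable, 'r::countable) signature"
    and M :: "('f, 'r, 'a) struc" and X :: "nat \<Rightarrow> nat \<Rightarrow> 'a" and U :: "nat filter"
  assumes str: "is_structure \<Sigma> M"
    and X: "X i j \<in> universe M"
    and nontriv: "U \<noteq> bot"
    and ultra: "eventually P U \<or> eventually (\<lambda>i. \<not> P i) U"
begin

definition elt :: "nat \<Rightarrow> nat \<Rightarrow> 'a" where
  "elt k i = skolem_val M (X i) (from_nat k)"

definition eqv :: "nat \<Rightarrow> nat \<Rightarrow> bool" where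
  "eqv j k \<longleftrightarrow> eventually (\<lambda>i. elt j i = elt k i) U"

text \<open>Least representatives replace equivalence classes, so that the universe consists of numbers.\<close>

definition rep :: "nat \<Rightarrow> nat" where
  "rep k = (LEAST j. eqv j k)"

definition pow :: "('f, 'r, nat) struc" where
  "pow = \<lparr>universe = range rep,
     fun_interp = (\<lambda>f ks. rep (to_nat (Choice (graph_form f (length ks)) (length ks)
        (map from_nat ks) :: ('f, 'r) skolem))),
     rel_interp = (\<lambda>r ks. eventually (\<lambda>i. rel_interp M r (map (\<lambda>k. elt k i) ks)) U)\<rparr>"

lemma ne: "universe M \<noteq> {}"
  using X by auto

lemma elt_closed: "elt k i \<in> universe M"
  by (simp add: elt_def skolem_val_closed ne X)

lemma eqv_refl: "eqv k k"
  by (simp add: eqv_def)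

lemma eqv_sym: "eqv j k \<Longrightarrow> eqv k j"
  unfolding eqv_def by (auto elim: eventually_mono)

lemma eqv_trans: "eqv j k \<Longrightarrow> eqv k l \<Longrightarrow> eqv j l"
  unfolding eqv_def by (auto elim: eventually_elim2)

lemma eqv_rep: "eqv (rep k) k"
  unfolding rep_def by (rule LeastI, rule eqv_refl)

lemma elt_rep: "eventually (\<lambda>i. elt (rep k) i = elt k i) U"
  using eqv_rep unfolding eqv_def .

lemma rep_eq_iff: "rep j = rep k \<longleftrightarrow> eqv j k"
proof
  assume "rep j = rep k"
  then show "eqv j k" using eqv_rep eqv_sym eqv_trans by metis
next
  assume "eqv j k"
  then have "eqv i j \<longleftrightarrow> eqv i k" for i using eqv_sym eqv_trans by blast
  then show "rep j = rep k" by (simp add: rep_def)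
qed

lemma eqv_universe: "j \<in> universe pow \<Longrightarrow> k \<in> universe pow \<Longrightarrow> eqv j k \<longleftrightarrow> j = k"
proof -
  assume "j \<in> universe pow" "k \<in> universe pow"
  then obtain j' k' where "j = rep j'" "k = rep k'" by (auto simp: pow_def)
  then show ?thesis using eqv_rep eqv_sym eqv_trans rep_eq_iff by metis
qed

lemma is_structure_pow: "is_structure \<Sigma> pow"
  by (rule is_structureI) (auto simp: pow_def)

lemma elt_fun_interp:
  assumes "(f, length ks) \<in> fun_syms \<Sigma>"
  shows "eventually (\<lambda>i. elt (fun_interp pow f ks) i = fun_interp M f (map (\<lambda>k. elt k i) ks)) U"
proof -
  define n where "n = length ks"
  define t :: "('f, 'r) skolem" where "t = Choice (graph_form f n) n (map from_nat ks)"
  have "elt (to_nat t) i = fun_interp M f (map (\<lambda>k. elt k i) ks)" for i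
  proof -
    define s where "s u = (if u < n then elt (ks ! u) i else X i 0)" for u
    have "elt (to_nat t) i = witness M (graph_form f n) n s"
      unfolding elt_def t_def s_def by (simp add: n_def comp_def elt_def cong: if_cong)
    also have "\<dots> = fun_interp M f (map s [0..<n])"
      by (rule witness_graph_form[OF str]) (use assms in \<open>auto simp: n_def s_def elt_closed\<close>)
    also have "map s [0..<n] = map (\<lambda>k. elt k i) ks"
      by (rule nth_equalityI) (auto simp: n_def s_def)
    finally show ?thesis .
  qed
  moreover have "fun_interp pow f ks = rep (to_nat t)" by (simp add: pow_def t_def n_def)
  ultimately show ?thesis using elt_rep[of "to_nat t"] by simp
qed

lemma elt_eval_trm:
  assumes "\<And>v. \<sigma> v \<in> universe pow"
  shows "wf_trm \<Sigma> t \<Longrightarrow> eventually (\<lambda>i. elt (eval_trm pow \<sigma> t) i = eval_trm M (\<lambda>v. elt (\<sigma> v) i) t) U"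
proof (induct t)
  case (Fun f ts)
  have "eventually (\<lambda>i. \<forall>t\<in>set ts. elt (eval_trm pow \<sigma> t) i = eval_trm M (\<lambda>v. elt (\<sigma> v) i) t) U"
    using Fun by (intro eventually_ball_finite) auto
  moreover have "eventually (\<lambda>i. elt (eval_trm pow \<sigma> (Fun f ts)) i =
      fun_interp M f (map (\<lambda>k. elt k i) (map (eval_trm pow \<sigma>) ts))) U"
    using elt_fun_interp[of f "map (eval_trm pow \<sigma>) ts"] Fun(2) by simp
  ultimately show ?case
  proof eventually_elim
    case (elim i)
    have "map (\<lambda>k. elt k i) (map (eval_trm pow \<sigma>) ts) = map (eval_trm M (\<lambda>v. elt (\<sigma> v) i)) ts"
      using elim(1) by simp
    then show ?case using elim(2) by (simp only: eval_trm.simps)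
  qed
qed simp

lemma eventually_iff_cong:
  "eventually (\<lambda>i. P i \<longleftrightarrow> Q i) U \<Longrightarrow> eventually P U \<longleftrightarrow> eventually Q U"
  by (rule eventually_subst)

text \<open>The theorem of Los for the hull. Negation rests on the ultrafilter property, and the
  existential case on the fact that the hull contains a sequence of witnesses, one chosen in each
  factor.\<close>

lemma Los:
  "wf_form \<Sigma> \<phi> \<Longrightarrow> (\<And>v. \<sigma> v \<in> universe pow) \<Longrightarrow>
     sat pow \<sigma> \<phi> \<longleftrightarrow> eventually (\<lambda>i. sat M (\<lambda>v. elt (\<sigma> v) i) \<phi>) U"
proof (induct \<phi> arbitrary: \<sigma>)
  case (Equal t u)
  have "eval_trm pow \<sigma> t \<in> universe pow" "eval_trm pow \<sigma> u \<in> universe pow"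
    using Equal by (auto intro!: eval_trm_closed[OF is_structure_pow])
  then have "sat pow \<sigma> (Equal t u) \<longleftrightarrow> eventually (\<lambda>i. elt (eval_trm pow \<sigma> t) i = elt (eval_trm pow \<sigma> u) i) U"
    using eqv_universe by (simp add: eqv_def)
  also have "\<dots> \<longleftrightarrow> eventually (\<lambda>i. sat M (\<lambda>v. elt (\<sigma> v) i) (Equal t u)) U"
  proof (rule eventually_iff_cong)
    have "eventually (\<lambda>i. elt (eval_trm pow \<sigma> t) i = eval_trm M (\<lambda>v. elt (\<sigma> v) i) t) U"
      "eventually (\<lambda>i. elt (eval_trm pow \<sigma> u) i = eval_trm M (\<lambda>v. elt (\<sigma> v) i) u) U"
      using elt_eval_trm[OF Equal(2)] Equal(1) by simp_all
    then show "eventually (\<lambda>i. elt (eval_trm pow \<sigma> t) i = elt (eval_trm pow \<sigma> u) i \<longleftrightarrow>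
        sat M (\<lambda>v. elt (\<sigma> v) i) (Equal t u)) U"
      by eventually_elim simp
  qed
  finally show ?case .
next
  case (Rel r ts)
  have "sat pow \<sigma> (Rel r ts) \<longleftrightarrow>
      eventually (\<lambda>i. rel_interp M r (map (\<lambda>k. elt k i) (map (eval_trm pow \<sigma>) ts))) U"
    by (simp add: pow_def)
  also have "\<dots> \<longleftrightarrow> eventually (\<lambda>i. sat M (\<lambda>v. elt (\<sigma> v) i) (Rel r ts)) U"
  proof (rule eventually_iff_cong)
    have "eventually (\<lambda>i. \<forall>t\<in>set ts. elt (eval_trm pow \<sigma> t) i = eval_trm M (\<lambda>v. elt (\<sigma> v) i) t) U"
      using Rel elt_eval_trm[OF Rel(2)] by (intro eventually_ball_finite) auto
    then show "eventually (\<lambda>i. rel_interp M r (map (\<lambda>k. elt k i) (map (eval_trm pow \<sigma>) ts)) \<longleftrightarrow>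
        sat M (\<lambda>v. elt (\<sigma> v) i) (Rel r ts)) U"
    proof eventually_elim
      case (elim i)
      have "map (\<lambda>k. elt k i) (map (eval_trm pow \<sigma>) ts) = map (eval_trm M (\<lambda>v. elt (\<sigma> v) i)) ts"
        using elim by simp
      then show ?case by (simp only: sat.simps)
    qed
  qed
  finally show ?case .
next
  case (Neg \<phi>)
  let ?P = "\<lambda>i. sat M (\<lambda>v. elt (\<sigma> v) i) \<phi>"
  have "\<not> eventually ?P U \<longleftrightarrow> eventually (\<lambda>i. \<not> ?P i) U"
    using ultra[of ?P] nontriv eventually_conj[of ?P U "\<lambda>i. \<not> ?P i"]
    by (auto simp: trivial_limit_def)
  then show ?case using Neg by simp
next
  case (Conj \<phi> \<psi>)
  then show ?case by (simp add: eventually_conj_iff)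
next
  case (Exists v \<phi>)
  have wf: "wf_form \<Sigma> \<phi>" using Exists(2) by simp
  have upd: "(\<lambda>u. elt ((\<sigma>(v := k)) u) i) = (\<lambda>u. elt (\<sigma> u) i)(v := elt k i)" for k i
    by auto
  have IH: "sat pow (\<sigma>(v := k)) \<phi> \<longleftrightarrow> eventually (\<lambda>i. sat M ((\<lambda>u. elt (\<sigma> u) i)(v := elt k i)) \<phi>) U"
    if "k \<in> universe pow" for k
    unfolding upd[symmetric] by (rule Exists(1)[OF wf]) (use Exists(3) that in simp)
  show ?case
  proof
    assume "sat pow \<sigma> (Exists v \<phi>)"
    then obtain k where "k \<in> universe pow" "sat pow (\<sigma>(v := k)) \<phi>" by auto
    then have "eventually (\<lambda>i. sat M ((\<lambda>u. elt (\<sigma> u) i)(v := elt k i)) \<phi>) U" using IH by simp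
    then show "eventually (\<lambda>i. sat M (\<lambda>v. elt (\<sigma> v) i) (Exists v \<phi>)) U"
      by (rule eventually_mono) (use elt_closed in auto)
  next
    assume ev: "eventually (\<lambda>i. sat M (\<lambda>v. elt (\<sigma> v) i) (Exists v \<phi>)) U"
    \<comment> \<open>A Skolem term has finitely many arguments, so only the variables below
      \<open>m\<close>, a bound for the free ones, are passed to it.\<close>
    define m where "m = Suc (Max (insert 0 (free_vars \<phi>)))"
    have m: "u < m" if "u \<in> free_vars \<phi>" for u
      using that finite_free_vars[of \<phi>] by (auto simp: m_def less_Suc_eq_le)
    define t where "t = Choice \<phi> v (map (\<lambda>u. from_nat (\<sigma> u)) [0..<m])"
    define k where "k = to_nat t"
    define s where "s i u = (if u < m then elt (\<sigma> u) i else X i 0)" for i u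
    have k: "elt k i = witness M \<phi> v (s i)" for i
      unfolding elt_def k_def t_def s_def by (simp add: comp_def elt_def cong: if_cong)
    have s: "sat M ((s i)(v := a)) \<phi> \<longleftrightarrow> sat M ((\<lambda>u. elt (\<sigma> u) i)(v := a)) \<phi>" for i a
      by (rule sat_cong) (use m in \<open>auto simp: s_def\<close>)
    have "eventually (\<lambda>i. sat M ((\<lambda>u. elt (\<sigma> u) i)(v := elt (rep k) i)) \<phi>) U"
      using ev elt_rep[of k]
    proof eventually_elim
      case (elim i)
      then obtain b where "b \<in> universe M" "sat M ((\<lambda>u. elt (\<sigma> u) i)(v := b)) \<phi>" by auto
      then have "sat M ((s i)(v := witness M \<phi> v (s i))) \<phi>"
        using witness(2)[OF ne] s by blast
      then show ?case using elim(2) k s by simp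
    qed
    moreover have "rep k \<in> universe pow" by (simp add: pow_def)
    ultimately show "sat pow \<sigma> (Exists v \<phi>)" using IH by auto
  qed
qed

lemma theory_of_pow: "theory_of \<Sigma> pow = theory_of \<Sigma> M"
proof -
  have "sat pow ((!) []) \<phi> \<longleftrightarrow> sat M ((!) []) \<phi>" if \<phi>: "\<phi> \<in> formulas \<Sigma> 0" for \<phi>
  proof -
    \<comment> \<open>\<open>Los\<close> asks for values in the universe at all indices, which
      \<open>(!) []\<close> does not guarantee; a constant assignment does.\<close>
    define \<sigma> :: "nat \<Rightarrow> nat" where "\<sigma> v = rep 0" for v
    have "sat pow ((!) []) \<phi> \<longleftrightarrow> sat pow \<sigma> \<phi>" using sat_formulas_cong[OF \<phi>] by blast
    also have "\<dots> \<longleftrightarrow> eventually (\<lambda>i. sat M (\<lambda>v. elt (\<sigma> v) i) \<phi>) U"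
      using \<phi> by (intro Los) (auto simp: formulas_def \<sigma>_def pow_def)
    also have "\<dots> \<longleftrightarrow> eventually (\<lambda>i. sat M ((!) []) \<phi>) U"
      using sat_formulas_cong[OF \<phi>] by (intro eventually_iff_cong always_eventually) blast
    also have "\<dots> \<longleftrightarrow> sat M ((!) []) \<phi>" using nontriv by (cases "sat M ((!) []) \<phi>") auto
    finally show ?thesis .
  qed
  then show ?thesis by (auto simp: theory_of_eq str is_structure_pow)
qed

text \<open>The classes of the first \<open>n\<close> columns of \<open>X\<close>; by
  \<open>Los\<close> they satisfy what almost all rows satisfy.\<close>

definition base_tuple :: "nat \<Rightarrow> nat list" where
  "base_tuple n = map (\<lambda>j. rep (to_nat (Base j :: ('f, 'r) skolem))) [0..<n]"

lemma base_tuple: "base_tuple n \<in> tuples (universe pow) n"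
  by (auto simp: base_tuple_def tuples_def pow_def)

lemma sat_base_tuple:
  assumes \<phi>: "\<phi> \<in> formulas \<Sigma> n"
  shows "sat pow ((!) (base_tuple n)) \<phi> \<longleftrightarrow> eventually (\<lambda>i. sat M (X i) \<phi>) U"
proof -
  define \<sigma> where "\<sigma> j = rep (to_nat (Base j :: ('f, 'r) skolem))" for j
  have "sat pow ((!) (base_tuple n)) \<phi> \<longleftrightarrow> sat pow \<sigma> \<phi>"
    by (rule sat_formulas_cong[OF \<phi>]) (auto simp: base_tuple_def \<sigma>_def)
  also have "\<dots> \<longleftrightarrow> eventually (\<lambda>i. sat M (\<lambda>v. elt (\<sigma> v) i) \<phi>) U"
    using \<phi> by (intro Los) (auto simp: formulas_def \<sigma>_def pow_def)
  also have "\<dots> \<longleftrightarrow> eventually (\<lambda>i. sat M (X i) \<phi>) U"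
  proof (rule eventually_iff_cong)
    have "eventually (\<lambda>i. elt (\<sigma> v) i = X i v) U" for v
      using elt_rep[of "to_nat (Base v :: ('f, 'r) skolem)"] by (simp add: \<sigma>_def elt_def)
    then have "eventually (\<lambda>i. \<forall>v\<in>{..<n}. elt (\<sigma> v) i = X i v) U"
      by (intro eventually_ball_finite) auto
    then show "eventually (\<lambda>i. sat M (\<lambda>v. elt (\<sigma> v) i) \<phi> \<longleftrightarrow> sat M (X i) \<phi>) U"
      by eventually_elim (rule sat_formulas_cong[OF \<phi>], auto)
  qed
  finally show ?thesis .
qed

end

text \<open>Compactness through an ultrapower: row \<open>k\<close> satisfies \<open>p 0\<close> to
  \<open>p k\<close>, so each \<open>p i\<close> holds in all rows from \<open>i\<close> on, and
  every filter below \<open>sequentially\<close> contains this event.\<close>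

lemma realise_type:
  fixes M :: "('f::countable, 'r::countable, 'a) struc"
  assumes str: "is_structure \<Sigma> M" and p: "\<And>k. p k \<in> formulas \<Sigma> n"
    and fin: "\<And>k::nat. \<exists>xs\<in>tuples (universe M) n. \<forall>i\<le>k. sat M ((!) xs) (p i)"
  obtains N :: "('f, 'r, nat) struc" and ys where "is_structure \<Sigma> N" "theory_of \<Sigma> N = theory_of \<Sigma> M"
    "ys \<in> tuples (universe N) n" "\<And>k. sat N ((!) ys) (p k)"
proof -
  obtain x where x: "\<And>k. x k \<in> tuples (universe M) n" "\<And>i k. i \<le> k \<Longrightarrow> sat M ((!) (x k)) (p i)"
    using fin by metis
  obtain a where a: "a \<in> universe M" using str by (auto simp: is_structure_def)
  \<comment> \<open>Columns from \<open>n\<close> on are filled with an arbitrary element, since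
    rows are total assignments.\<close>
  define X where "X k j = (if j < n then x k ! j else a)" for k j
  obtain U :: "nat filter" where U: "U \<le> sequentially" "U \<noteq> bot"
    "\<And>P. eventually P U \<or> eventually (\<lambda>x. \<not> P x) U"
    using ultrafilter_below[of sequentially] by auto
  interpret skolem_ultrapower \<Sigma> M X U
    by unfold_locales (use str U a x(1) in \<open>auto simp: X_def tuplesD(3)[OF x(1)]\<close>)
  have "sat pow ((!) (base_tuple n)) (p i)" for i
  proof -
    have "eventually (\<lambda>k. sat M (X k) (p i)) sequentially"
    proof (rule eventually_sequentiallyI)
      fix k assume "i \<le> k"
      then show "sat M (X k) (p i)"
        using x(2) sat_formulas_cong[OF p, of "X k" "(!) (x k)" M] by (simp add: X_def)
    qed
    then show ?thesis using sat_base_tuple[OF p] U(1) by (simp add: le_filter_def)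
  qed
  then show ?thesis using that is_structure_pow theory_of_pow base_tuple by blast
qed

section \<open>Oligomorphic group actions\<close>

text \<open>Automorphisms matter on \<open>X\<close> alone, so inverses are required there only and
  \<open>G\<close> need not be a group of functions on the whole type.\<close>

definition acts_on :: "('a \<Rightarrow> 'a) set \<Rightarrow> 'a set \<Rightarrow> bool" where
  "acts_on G X \<longleftrightarrow> id \<in> G \<and> (\<forall>g\<in>G. \<forall>h\<in>G. g \<circ> h \<in> G) \<and>
     (\<forall>g\<in>G. g ` X \<subseteq> X \<and> (\<exists>g'\<in>G. \<forall>x\<in>X. g' (g x) = x))"

text \<open>\<open>R\<close> is a finite set of representatives, possibly several for one orbit;
  oligomorphicity is proved and used in this form.\<close>

definition covers_tuples :: "('a \<Rightarrow> 'a) set \<Rightarrow> 'a set \<Rightarrow> nat \<Rightarrow> 'a list set \<Rightarrow> bool" where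
  "covers_tuples G X n R \<longleftrightarrow> finite R \<and> R \<subseteq> tuples X n \<and> (\<forall>xs\<in>tuples X n. \<exists>r\<in>R. \<exists>g\<in>G. map g r = xs)"

lemma covers_tuplesE:
  assumes "covers_tuples G X n R" "xs \<in> tuples X n"
  obtains r g where "r \<in> R" "r \<in> tuples X n" "g \<in> G" "map g r = xs"
  using assms unfolding covers_tuples_def by blast

lemma acts_on_inverse:
  assumes "acts_on G X" "g \<in> G"
  obtains g' where "g' \<in> G" "\<And>x. x \<in> X \<Longrightarrow> g' (g x) = x" "\<And>xs. set xs \<subseteq> X \<Longrightarrow> map g' (map g xs) = xs"
proof -
  obtain g' where g': "g' \<in> G" "\<forall>x\<in>X. g' (g x) = x" using assms unfolding acts_on_def by blast
  then have "map g' (map g xs) = xs" if "set xs \<subseteq> X" for xs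
    using that by (auto intro!: map_idI)
  then show ?thesis using that g' by blast
qed

lemma finite_orbits_iff:
  assumes "acts_on G X"
  shows "finite ((\<lambda>xs. (\<lambda>g. map g xs) ` G) ` tuples X n) \<longleftrightarrow> (\<exists>R. covers_tuples G X n R)"
proof -
  define orb where "orb xs = (\<lambda>g. map g xs) ` G" for xs
  have orb_self: "xs \<in> orb xs" for xs
    using assms unfolding orb_def acts_on_def by (metis image_eqI map_idI id_apply)
  have orb_eq: "orb (map g xs) = orb xs" if g: "g \<in> G" and xs: "set xs \<subseteq> X" for g xs
  proof -
    have comp: "h \<circ> k \<in> G" if "h \<in> G" "k \<in> G" for h k
      using assms that by (auto simp: acts_on_def)
    have sub: "orb (map h ys) \<subseteq> orb ys" if "h \<in> G" for h ys
      using comp that by (force simp: orb_def)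
    obtain g' where "g' \<in> G" "map g' (map g xs) = xs"
      using acts_on_inverse[OF assms g] xs by metis
    then show ?thesis using sub[of g' "map g xs"] sub[OF g, of xs] by auto
  qed
  have "finite (orb ` tuples X n) \<longleftrightarrow> (\<exists>R. covers_tuples G X n R)" 
  proof
    assume "finite (orb ` tuples X n)"
    then obtain R where R: "R \<subseteq> tuples X n" "finite R" "orb ` tuples X n = orb ` R"
      using finite_subset_image[of "orb ` tuples X n" orb "tuples X n"] by auto
    have "\<exists>r\<in>R. \<exists>g\<in>G. map g r = xs" if xs: "xs \<in> tuples X n" for xs
    proof -
      have "orb xs \<in> orb ` R" using xs unfolding R(3)[symmetric] by (rule imageI)
      then obtain r where "r \<in> R" "orb xs = orb r" by blast
      then have "xs \<in> orb r" using orb_self by blast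
      then show ?thesis using \<open>r \<in> R\<close> by (auto simp: orb_def)
    qed
    then show "\<exists>R. covers_tuples G X n R" using R by (auto simp: covers_tuples_def)
  next
    assume "\<exists>R. covers_tuples G X n R"
    then obtain R where R: "covers_tuples G X n R" by blast
    have "orb ` tuples X n \<subseteq> orb ` R"
    proof (intro image_subsetI)
      fix xs assume "xs \<in> tuples X n"
      then obtain r g where "r \<in> R" "r \<in> tuples X n" "g \<in> G" "map g r = xs"
        using R covers_tuplesE by metis
      then show "orb xs \<in> orb ` R" using orb_eq[of g r] tuplesD(2) by blast
    qed
    then show "finite (orb ` tuples X n)"
      using R finite_subset[of "orb ` tuples X n" "orb ` R"] by (simp add: covers_tuples_def)
  qed
  then show ?thesis by (simp add: orb_def)
qed

lemma oligomorphic_iff: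
  assumes "acts_on G X"
  shows "oligomorphic G X \<longleftrightarrow> (\<forall>n\<ge>1. \<exists>R. covers_tuples G X n R)"
  using finite_orbits_iff[OF assms] by (simp add: oligomorphic_def tuples_def)

section \<open>The theorem of Ryll-Nardzewski\<close>

lemma acts_on_automorphisms:
  assumes "is_structure \<Sigma> M"
  shows "acts_on {h. isomorphism \<Sigma> M M h} (universe M)"
proof -
  have "\<exists>g'. isomorphism \<Sigma> M M g' \<and> (\<forall>x\<in>universe M. g' (g x) = x)" if "isomorphism \<Sigma> M M g" for g
    using isomorphism_inv[OF assms that] isomorphism_bij[OF that]
    by (intro exI[of _ "inv_into (universe M) g"]) (auto simp: bij_betw_def)
  then show ?thesis
    using isomorphism_bij[of \<Sigma> M M]
    by (auto simp: acts_on_def bij_betw_def isomorphism_id intro: isomorphism_comp)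
qed

text \<open>For each representative of another type choose a formula true of \<open>xs\<close> and
  false of it. The finite conjunction of these excludes all other types.\<close>

lemma finitely_many_types_isolated:
  assumes str: "is_structure \<Sigma> M" and R: "finite R" "R \<subseteq> tuples (universe M) n"
    and cover: "\<And>xs. xs \<in> tuples (universe M) n \<Longrightarrow> \<exists>r\<in>R. type_eq \<Sigma> M r M xs"
    and xs: "xs \<in> tuples (universe M) n"
  obtains \<phi> where "complete_formula \<Sigma> M n \<phi>" "sat M ((!) xs) \<phi>"
proof -
  define Q where "Q = {r \<in> R. \<not> type_eq \<Sigma> M xs M r}"
  have "\<exists>\<phi>\<in>formulas \<Sigma> n. sat M ((!) xs) \<phi> \<and> \<not> sat M ((!) r) \<phi>" if "r \<in> Q" for r
  proof (rule ccontr)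
    assume "\<not> ?thesis"
    then have "type_eq \<Sigma> M xs M r"
      using that R(2) xs by (intro type_eqI) (auto simp: Q_def tuples_def)
    then show False using that by (simp add: Q_def)
  qed
  then obtain F where F: "\<And>r. r \<in> Q \<Longrightarrow> F r \<in> formulas \<Sigma> n \<and> sat M ((!) xs) (F r) \<and> \<not> sat M ((!) r) (F r)"
    by metis
  have "finite Q" using R(1) by (simp add: Q_def)
  then obtain rs where rs: "set rs = Q" using finite_list by blast
  define \<phi> where "\<phi> = conjs (map F rs)"
  have \<phi>: "sat M ((!) ys) \<phi> \<longleftrightarrow> (\<forall>r\<in>Q. sat M ((!) ys) (F r))" for ys
    by (simp add: \<phi>_def sat_conjs[OF str] rs)
  have \<phi>F: "\<phi> \<in> formulas \<Sigma> n" using F by (auto simp: \<phi>_def rs)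
  have eq: "type_eq \<Sigma> M xs M ys" if ys: "ys \<in> tuples (universe M) n" "sat M ((!) ys) \<phi>" for ys
  proof -
    obtain r where r: "r \<in> R" "type_eq \<Sigma> M r M ys" using cover ys by blast
    have "r \<notin> Q"
    proof
      assume "r \<in> Q"
      then have Fr: "F r \<in> formulas \<Sigma> n" "\<not> sat M ((!) r) (F r)" using F by auto
      have "length r = n" using r(1) R(2) by (auto simp: tuples_def)
      then have "\<not> sat M ((!) ys) (F r)" using type_eqD[OF r(2)] Fr by blast
      then show False using ys(2) \<phi> \<open>r \<in> Q\<close> by blast
    qed
    then have "type_eq \<Sigma> M xs M r" using r(1) by (simp add: Q_def)
    then show ?thesis using r(2) type_eq_trans by blast
  qed
  have "complete_formula \<Sigma> M n \<phi>"
    unfolding complete_formula_def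
    by (intro conjI ballI impI \<phi>F type_eq_trans[OF type_eq_sym[OF eq] eq])
  moreover have "sat M ((!) xs) \<phi>" using \<phi> F by blast
  ultimately show ?thesis using that by blast
qed

text \<open>In \<open>M\<close> the types of \<open>n\<close>-tuples are finitely many and isolated,
  and that the isolating formulas exhaust all \<open>n\<close>-tuples is a sentence. Hence any
  competitor is atomic as well, and back-and-forth applies.\<close>

lemma omega_categorical_if_oligomorphic:
  assumes str: "is_structure \<Sigma> M" and "countable (universe M)"
    and olig: "oligomorphic {h. isomorphism \<Sigma> M M h} (universe M)"
  shows "omega_categorical \<Sigma> M"
proof -
  have "\<exists>R. finite R \<and> R \<subseteq> tuples (universe M) n \<and>
      (\<forall>xs\<in>tuples (universe M) n. \<exists>r\<in>R. type_eq \<Sigma> M r M xs)" for n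
  \<comment> \<open>\<open>oligomorphic\<close> speaks of \<open>n \<ge> 1\<close>; the empty tuple
    is treated by hand.\<close>
  proof (cases "n = 0")
    case True
    then show ?thesis
      by (intro exI[of _ "{[]}"]) (auto simp: tuples_def type_eq_def)
  next
    case False
    then have "1 \<le> n" by simp
    then obtain R where R: "covers_tuples {h. isomorphism \<Sigma> M M h} (universe M) n R"
      using olig oligomorphic_iff[OF acts_on_automorphisms[OF str]] by blast
    have "\<exists>r\<in>R. type_eq \<Sigma> M r M xs" if "xs \<in> tuples (universe M) n" for xs
      using covers_tuplesE[OF R that] type_eq_isomorphism[OF str] tuplesD(2)
      by (metis mem_Collect_eq)
    then show ?thesis using R unfolding covers_tuples_def by blast
  qed
  then obtain R where R: "\<And>n. finite (R n)" "\<And>n. R n \<subseteq> tuples (universe M) n"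
    "\<And>n xs. xs \<in> tuples (universe M) n \<Longrightarrow> \<exists>r\<in>R n. type_eq \<Sigma> M r M xs"
    by metis
  note iso = finitely_many_types_isolated[OF str R(1) R(2) R(3)]
  have atM: "atomic_structure \<Sigma> M"
    unfolding atomic_structure_def isolated_def
  proof (intro allI impI)
    fix xs assume "set xs \<subseteq> universe M"
    then have "xs \<in> tuples (universe M) (length xs)" by (simp add: tuples_def)
    then show "\<exists>\<phi>. complete_formula \<Sigma> M (length xs) \<phi> \<and> sat M ((!) xs) \<phi>" using iso by metis
  qed
  have "\<exists>h. isomorphism \<Sigma> M N h"
    if N: "is_structure \<Sigma> N" "theory_of \<Sigma> N = theory_of \<Sigma> M" for N :: "('a, 'b, nat) struc"
  proof -
    have MN: "type_eq \<Sigma> M [] N []" using type_eq_Nil_iff[OF str N(1)] N(2) by simp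
    have atN: "atomic_structure \<Sigma> N"
      unfolding atomic_structure_def isolated_def
    proof (intro allI impI)
      fix ys assume "set ys \<subseteq> universe N"
      define n where "n = length ys"
      have ys: "ys \<in> tuples (universe N) n" using \<open>set ys \<subseteq> _\<close> by (simp add: tuples_def n_def)
      have "\<forall>r\<in>R n. \<exists>\<phi>. complete_formula \<Sigma> M n \<phi> \<and> sat M ((!) r) \<phi>"
        using iso R(2) by blast
      then obtain F where F: "\<And>r. r \<in> R n \<Longrightarrow> complete_formula \<Sigma> M n (F r)"
        "\<And>r. r \<in> R n \<Longrightarrow> sat M ((!) r) (F r)" by metis
      have FF: "F r \<in> formulas \<Sigma> n" if "r \<in> R n" for r
        using F(1)[OF that] by (simp add: complete_formula_def)
      obtain rs where rs: "set rs = R n" using finite_list[OF R(1)] by blast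
      \<comment> \<open>\<open>\<psi>\<close> denies all isolating formulas; that no tuple satisfies
        it is a sentence true in \<open>M\<close>, hence in \<open>N\<close>.\<close>
      define \<psi> where "\<psi> = conjs (map (\<lambda>r. Neg (F r)) rs)"
      have \<psi>: "\<psi> \<in> formulas \<Sigma> (0 + n)" unfolding \<psi>_def conjs_formulas by (auto simp: rs FF)
      have "\<not> sat M ((!) xs) \<psi>" if xs: "xs \<in> tuples (universe M) n" for xs
      proof -
        obtain r where r: "r \<in> R n" "type_eq \<Sigma> M r M xs" using R(3) xs by blast
        have "length r = n" using r(1) R(2) by (auto simp: tuples_def)
        then have "sat M ((!) xs) (F r)"
          using type_eqD[OF r(2)] F(2) FF r(1) by blast
        then show ?thesis using r(1) by (auto simp: \<psi>_def sat_conjs[OF str] rs)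
      qed
      then have "\<not> sat M ((!) []) (exists_block 0 n \<psi>)"
        unfolding sat_exists_block[OF \<psi> list.size(3)] by simp
      then have "\<not> sat N ((!) []) (exists_block 0 n \<psi>)"
        using type_eqD[OF MN] exists_block_formulas[OF \<psi>] by (metis list.size(3))
      then have "\<not> sat N ((!) ys) \<psi>"
        unfolding sat_exists_block[OF \<psi> list.size(3)] using ys by simp
      then obtain r where "r \<in> R n" "sat N ((!) ys) (F r)"
        by (auto simp: \<psi>_def sat_conjs[OF N(1)] rs)
      then show "\<exists>\<phi>. complete_formula \<Sigma> N (length ys) \<phi> \<and> sat N ((!) ys) \<phi>"
        using F(1) complete_formula_transfer[OF MN] n_def by blast
    qed
    show ?thesis
      using back_and_forth[OF str assms(2) atM N(1) _ atN MN] by auto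
  qed
  then show ?thesis using assms(1,2) by (simp add: omega_categorical_def)
qed

text \<open>Frees the competitor from living on the natural numbers: it is replaced by a copy
  there.\<close>

lemma omega_categorical_isomorphic:
  fixes N :: "('f, 'r, 'b) struc"
  assumes "omega_categorical \<Sigma> M" "is_structure \<Sigma> N" "countable (universe N)"
    and "theory_of \<Sigma> N = theory_of \<Sigma> M"
  obtains h where "isomorphism \<Sigma> M N h"
proof -
  obtain P :: "('f, 'r, nat) struc" and g where P: "is_structure \<Sigma> P" "isomorphism \<Sigma> N P g"
    using countable_structure_copy[OF assms(2,3)] by blast
  have "theory_of \<Sigma> P = theory_of \<Sigma> M"
    using theory_of_isomorphism[OF assms(2) P] assms(4) by simp
  then obtain h where "isomorphism \<Sigma> M P h"
    using assms(1) P(1) unfolding omega_categorical_def by blast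
  then show ?thesis
    using that isomorphism_comp isomorphism_inv[OF assms(2) P(2)] by blast
qed

lemma isolated_isomorphism:
  assumes "is_structure \<Sigma> M" "isomorphism \<Sigma> M N h" "set xs \<subseteq> universe M" "isolated \<Sigma> N (map h xs)"
  shows "isolated \<Sigma> M xs"
proof -
  obtain \<phi> where \<phi>: "complete_formula \<Sigma> N (length xs) \<phi>" "sat N ((!) (map h xs)) \<phi>"
    using assms(4) by (auto simp: isolated_def)
  have "type_eq \<Sigma> N [] M []"
    using type_eq_isomorphism[OF assms(1,2), of "[]"] type_eq_sym by fastforce
  then have "complete_formula \<Sigma> M (length xs) \<phi>"
    using complete_formula_transfer \<phi>(1) by blast
  moreover have "sat M ((!) xs) \<phi>"
    using type_eqD[OF type_eq_isomorphism[OF assms(1,2,3)]] \<phi> unfolding complete_formula_def by blast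
  ultimately show ?thesis by (auto simp: isolated_def)
qed

text \<open>Compactness gives a countable model realising the type, and categoricity carries the
  realisation back to \<open>M\<close>.\<close>

lemma omega_categorical_realises:
  fixes M :: "('f::countable, 'r::countable, 'a) struc"
  assumes oc: "omega_categorical \<Sigma> M" and p: "\<And>k. p k \<in> formulas \<Sigma> n"
    and fin: "\<And>k::nat. \<exists>xs\<in>tuples (universe M) n. \<forall>i\<le>k. sat M ((!) xs) (p i)"
  obtains xs where "xs \<in> tuples (universe M) n" "\<And>k. sat M ((!) xs) (p k)"
proof -
  have str: "is_structure \<Sigma> M" using oc by (simp add: omega_categorical_def)
  obtain N :: "('f, 'r, nat) struc" and ys where N: "is_structure \<Sigma> N" "theory_of \<Sigma> N = theory_of \<Sigma> M"
    "ys \<in> tuples (universe N) n" "\<And>k. sat N ((!) ys) (p k)"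
    using realise_type[OF str p fin] by metis
  obtain h where "isomorphism \<Sigma> M N h" using oc N(1,2) unfolding omega_categorical_def by blast
  then have g: "isomorphism \<Sigma> N M (inv_into (universe M) h)" using isomorphism_inv[OF str] by blast
  have "sat M ((!) (map (inv_into (universe M) h) ys)) (p k)" for k
    using sat_isomorphism_tuple[OF N(1) g N(3) p] N(4) by blast
  moreover have "map (inv_into (universe M) h) ys \<in> tuples (universe M) n"
    using tuples_map_bij[OF isomorphism_bij[OF g] N(3)] .
  ultimately show ?thesis using that by blast
qed

text \<open>
  If no tuple satisfying \<open>\<psi>\<close> were isolated, \<open>\<psi>\<close> could be strengthened step by step so as to exclude
  each tuple of the structure in turn, and the resulting type would not be realised.
\<close>

lemma omega_categorical_isolated_dense:
  fixes M :: "('f::countable, 'r::countable, 'a) struc"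
  assumes oc: "omega_categorical \<Sigma> M" and \<psi>: "\<psi> \<in> formulas \<Sigma> n"
    and xs: "xs \<in> tuples (universe M) n" "sat M ((!) xs) \<psi>"
  obtains ys where "ys \<in> tuples (universe M) n" "sat M ((!) ys) \<psi>" "isolated \<Sigma> M ys"
proof (rule ccontr)
  assume "\<not> thesis"
  then have nis: "\<not> isolated \<Sigma> M ys" if "ys \<in> tuples (universe M) n" "sat M ((!) ys) \<psi>" for ys
    using that \<open>\<And>ys. ys \<in> tuples (universe M) n \<Longrightarrow> sat M ((!) ys) \<psi> \<Longrightarrow> isolated \<Sigma> M ys \<Longrightarrow> thesis\<close> by blast
  let ?T = "tuples (universe M) n"
  define b where "b = from_nat_into ?T"
  have b: "b k \<in> ?T" for k using xs(1) by (auto simp: b_def intro: from_nat_into)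
  have "countable ?T" using oc countable_tuples by (auto simp: omega_categorical_def)
  then have b_surj: "\<exists>k. b k = ys" if "ys \<in> ?T" for ys
    using from_nat_into_surj that unfolding b_def by metis
  define P where "P \<chi> \<longleftrightarrow> \<chi> \<in> formulas \<Sigma> n \<and> (\<exists>ys\<in>?T. sat M ((!) ys) \<chi>) \<and>
      (\<forall>ys\<in>?T. sat M ((!) ys) \<chi> \<longrightarrow> sat M ((!) ys) \<psi>)" for \<chi>
  define S where "S k \<chi> \<chi>' \<longleftrightarrow> (\<forall>ys\<in>?T. sat M ((!) ys) \<chi>' \<longrightarrow> sat M ((!) ys) \<chi>) \<and>
      \<not> sat M ((!) (b k)) \<chi>'" for k \<chi> \<chi>'
  have "\<exists>f. \<forall>k. P (f k) \<and> S k (f k) (f (Suc k))"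
  proof (rule dependent_nat_choice)
    show "\<exists>\<chi>. P \<chi>" using \<psi> xs unfolding P_def by blast
    fix \<chi> k assume \<chi>: "P \<chi>"
    show "\<exists>\<chi>'. P \<chi>' \<and> S k \<chi> \<chi>'"
    proof (cases "sat M ((!) (b k)) \<chi>")
      case False
      then show ?thesis using \<chi> unfolding S_def by blast
    next
      case True
      have "\<not> isolated \<Sigma> M (b k)" using nis b True \<chi> unfolding P_def by blast
      then have "\<not> complete_formula \<Sigma> M n \<chi>"
        using True tuplesD(1)[OF b] unfolding isolated_def by metis
      then obtain us vs where uv: "us \<in> ?T" "vs \<in> ?T" "sat M ((!) us) \<chi>" "sat M ((!) vs) \<chi>"
        "\<not> type_eq \<Sigma> M us M vs"
        using \<chi> unfolding complete_formula_def P_def by blast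
      then obtain \<theta> where \<theta>: "\<theta> \<in> formulas \<Sigma> n" "sat M ((!) us) \<theta> \<noteq> sat M ((!) vs) \<theta>"
        unfolding type_eq_def using tuplesD(1) by metis
      \<comment> \<open>\<open>us\<close> and \<open>vs\<close> show that both halves of
        \<open>\<chi>\<close>, split by \<open>\<theta>\<close>, are satisfiable; the half rejecting
        \<open>b k\<close> is kept.\<close>
      define \<chi>' where "\<chi>' = (if sat M ((!) (b k)) \<theta> then Conj \<chi> (Neg \<theta>) else Conj \<chi> \<theta>)"
      have "P \<chi>'" using \<chi> uv \<theta> unfolding P_def \<chi>'_def by auto
      moreover have "S k \<chi> \<chi>'" unfolding S_def \<chi>'_def by auto
      ultimately show ?thesis by blast
    qed
  qed
  then obtain f where f: "\<And>k. P (f k)" "\<And>k. S k (f k) (f (Suc k))" by blast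
  have dec: "sat M ((!) ys) (f i)" if "i \<le> k" "ys \<in> ?T" "sat M ((!) ys) (f k)" for i k ys
    using that
  proof (induct rule: dec_induct)
    case (step k)
    then show ?case using f(2)[of k] unfolding S_def by blast
  qed
  have "\<exists>ys\<in>?T. \<forall>i\<le>k. sat M ((!) ys) (f i)" for k
    using f(1)[of k] dec[of _ k] unfolding P_def by blast
  then obtain ys where ys: "ys \<in> ?T" "\<And>k. sat M ((!) ys) (f k)"
    using omega_categorical_realises[OF oc, of f n] f(1) unfolding P_def by blast
  then show False using b_surj[OF ys(1)] f(2) unfolding S_def by blast
qed

text \<open>Density applied to \<open>Conj \<chi> \<psi>\<close> gives an isolated tuple
  \<open>bs @ [d]\<close>, in general over another \<open>bs\<close>. As \<open>\<chi>\<close>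
  isolates the type of \<open>as\<close>, \<open>type_eq_extend\<close> moves \<open>d\<close> to an
  element over \<open>as\<close>.\<close>

lemma isolated_extend:
  fixes M :: "('f::countable, 'r::countable, 'a) struc"
  assumes oc: "omega_categorical \<Sigma> M" and as: "as \<in> tuples (universe M) n" "isolated \<Sigma> M as"
    and \<psi>: "\<psi> \<in> formulas \<Sigma> (Suc n)" and a: "a \<in> universe M" "sat M ((!) (as @ [a])) \<psi>"
  obtains c where "c \<in> universe M" "sat M ((!) (as @ [c])) \<psi>" "isolated \<Sigma> M (as @ [c])"
proof -
  have len: "length as = n" using as(1) by (rule tuplesD(1))
  obtain \<chi> where \<chi>: "complete_formula \<Sigma> M n \<chi>" "sat M ((!) as) \<chi>"
    using as(2) len by (auto simp: isolated_def)
  then have \<chi>F: "\<chi> \<in> formulas \<Sigma> n" "\<chi> \<in> formulas \<Sigma> (Suc n)"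
    using formulas_mono[of n "Suc n" \<Sigma>] by (auto simp: complete_formula_def)
  have "sat M ((!) (as @ [a])) (Conj \<chi> \<psi>)"
    using sat_append[OF \<chi>F(1) len] \<chi>(2) a(2) by (metis sat.simps(4))
  moreover have "Conj \<chi> \<psi> \<in> formulas \<Sigma> (Suc n)" using \<chi>F \<psi> by simp
  ultimately obtain zs where zs: "zs \<in> tuples (universe M) (Suc n)" "sat M ((!) zs) (Conj \<chi> \<psi>)"
    "isolated \<Sigma> M zs"
    using omega_categorical_isolated_dense[OF oc _ tuples_snoc[OF as(1) a(1)]] by metis
  obtain bs d where d: "zs = bs @ [d]" "bs \<in> tuples (universe M) n" "d \<in> universe M"
    using tuples_Suc_cases[OF zs(1)] by metis
  have "sat M ((!) bs) \<chi>"
    using sat_append[OF \<chi>F(1) tuplesD(1)[OF d(2)], of M "[d]"] zs(2) d(1) by simp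
  then have "type_eq \<Sigma> M bs M as"
    using \<chi> d(2) as(1) unfolding complete_formula_def by blast
  then obtain c where c: "c \<in> universe M" "type_eq \<Sigma> M zs M (as @ [c])"
    using type_eq_extend[of \<Sigma> M bs M as d] zs(3) d tuplesD(2) as(1) by metis
  have lz: "length zs = Suc n" "length (as @ [c]) = Suc n" using zs(1) len by (auto simp: tuples_def)
  have "sat M ((!) (as @ [c])) \<psi>" using type_eqD[OF c(2)] \<psi> zs(2) lz by simp
  moreover have "isolated \<Sigma> M (as @ [c])"
    using zs(3) type_eqD[OF c(2)] lz unfolding isolated_def complete_formula_def by metis
  ultimately show ?thesis using that c(1) by blast
qed

text \<open>Evaluation at the reindexed tuple is evaluation of a renamed formula at the original
  one; indices may repeat, hence renaming along maps that need not be injective.\<close>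

lemma type_eq_reindex:
  assumes "type_eq \<Sigma> M xs N ys" "set is \<subseteq> {..<length xs}"
  shows "type_eq \<Sigma> M (map ((!) xs) is) N (map ((!) ys) is)"
proof (rule type_eqI)
  fix \<phi> assume "\<phi> \<in> formulas \<Sigma> (length (map ((!) xs) is))" and s: "sat M ((!) (map ((!) xs) is)) \<phi>"
  then have \<phi>: "\<phi> \<in> formulas \<Sigma> (length is)" by simp
  have satN: "sat K ((!) zs) (rename ((!) is) \<phi>) \<longleftrightarrow> sat K ((!) (map ((!) zs) is)) \<phi>" for K :: "('a, 'b, 'd) struc" and zs
    unfolding sat_rename by (rule sat_formulas_cong[OF \<phi>]) simp
  have satM: "sat K ((!) zs) (rename ((!) is) \<phi>) \<longleftrightarrow> sat K ((!) (map ((!) zs) is)) \<phi>" for K :: "('a, 'b, 'c) struc" and zs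
    unfolding sat_rename by (rule sat_formulas_cong[OF \<phi>]) simp
  have "rename ((!) is) \<phi> \<in> formulas \<Sigma> (length xs)"
    by (rule rename_formulas[OF \<phi>]) (use assms(2) in \<open>auto simp: subset_iff\<close>)
  then show "sat N ((!) (map ((!) ys) is)) \<phi>"
    using type_eqD[OF assms(1)] s satM satN by metis
qed simp

text \<open>If \<open>\<chi>\<close> isolates \<open>ys\<close>, then the selected entries are
  isolated by the statement that they are selected in this way from some tuple satisfying
  \<open>\<chi>\<close>. This passes from initial segments of an enumeration to arbitrary
  tuples.\<close>

lemma isolated_reindex:
  assumes str: "is_structure \<Sigma> M" and ys: "set ys \<subseteq> universe M" "isolated \<Sigma> M ys"
    and "is": "set is \<subseteq> {..<length ys}"
  shows "isolated \<Sigma> M (map ((!) ys) is)"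
proof -
  define k where "k = length ys"
  define n where "n = length is"
  have yk: "ys \<in> tuples (universe M) k" using ys(1) by (simp add: k_def tuples_def)
  have nth: "is ! j < k" if "j < n" for j using "is" that by (auto simp: n_def k_def subset_iff)
  obtain \<chi> where \<chi>: "complete_formula \<Sigma> M k \<chi>" "sat M ((!) ys) \<chi>"
    using ys(2) by (auto simp: isolated_def k_def)
  then have \<chi>F: "\<chi> \<in> formulas \<Sigma> k" by (simp add: complete_formula_def)
  \<comment> \<open>Variables below \<open>n\<close> stand for the selected entries, those from
    \<open>n\<close> to \<open>n + k - 1\<close> for the whole tuple.\<close>
  define \<beta> where "\<beta> = Conj (rename (\<lambda>i. n + i) \<chi>)
      (conjs (map (\<lambda>j. Equal (Var j) (Var (n + is ! j))) [0..<n]))"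
  have \<beta>F: "\<beta> \<in> formulas \<Sigma> (n + k)"
  proof -
    have "Equal (Var j) (Var (n + is ! j)) \<in> formulas \<Sigma> (n + k)" if "j < n" for j
      using nth[OF that] that by (simp add: formulas_def)
    then show ?thesis
      using rename_formulas[OF \<chi>F, of "\<lambda>i. n + i" "n + k"] by (auto simp: \<beta>_def)
  qed
  have sat\<beta>: "sat M ((!) (us @ zs)) \<beta> \<longleftrightarrow> sat M ((!) zs) \<chi> \<and> us = map ((!) zs) is"
    if "length us = n" "length zs = k" for us zs
  proof -
    have "sat M ((!) (us @ zs)) (rename (\<lambda>i. n + i) \<chi>) \<longleftrightarrow> sat M ((!) zs) \<chi>"
      unfolding sat_rename by (rule sat_formulas_cong[OF \<chi>F]) (use that in \<open>auto simp: nth_append\<close>)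
    moreover have "(\<forall>j<n. (us @ zs) ! j = (us @ zs) ! (n + is ! j)) \<longleftrightarrow> us = map ((!) zs) is"
      using that by (auto simp: nth_append n_def list_eq_iff_nth_eq)
    ultimately show ?thesis
      by (simp add: \<beta>_def sat_conjs[OF str] atLeast0LessThan ball_simps lessThan_def)
  qed
  define \<delta> where "\<delta> = exists_block n k \<beta>"
  have sat\<delta>: "sat M ((!) us) \<delta> \<longleftrightarrow> (\<exists>zs\<in>tuples (universe M) k. sat M ((!) zs) \<chi> \<and> us = map ((!) zs) is)"
    if "length us = n" for us
    unfolding \<delta>_def sat_exists_block[OF \<beta>F that] using sat\<beta>[OF that] by (auto simp: tuples_def)
  have eq: "type_eq \<Sigma> M (map ((!) ys) is) M us" if us: "length us = n" "sat M ((!) us) \<delta>" for us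
  proof -
    obtain zs where zs: "zs \<in> tuples (universe M) k" "sat M ((!) zs) \<chi>" "us = map ((!) zs) is"
      using us sat\<delta> by blast
    then have "type_eq \<Sigma> M ys M zs" using \<chi> yk unfolding complete_formula_def by blast
    then show ?thesis unfolding zs(3) using type_eq_reindex "is" by blast
  qed
  have "complete_formula \<Sigma> M n \<delta>"
    unfolding complete_formula_def
  proof (intro conjI ballI impI)
    show "\<delta> \<in> formulas \<Sigma> n" unfolding \<delta>_def by (rule exists_block_formulas[OF \<beta>F])
    fix us vs assume "us \<in> tuples (universe M) n" "vs \<in> tuples (universe M) n"
      and "sat M ((!) us) \<delta>" "sat M ((!) vs) \<delta>"
    then show "type_eq \<Sigma> M us M vs"
      by (intro type_eq_trans[OF type_eq_sym[OF eq] eq]) (auto dest: tuplesD(1))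
  qed
  moreover have "sat M ((!) (map ((!) ys) is)) \<delta>"
    using sat\<delta>[of "map ((!) ys) is"] yk \<chi>(2) by (auto simp: n_def)
  ultimately show ?thesis by (auto simp: isolated_def n_def)
qed

lemma atomic_structure_isomorphism:
  assumes "is_structure \<Sigma> M" "isomorphism \<Sigma> M N h" "atomic_structure \<Sigma> N"
  shows "atomic_structure \<Sigma> M"
  unfolding atomic_structure_def
proof (intro allI impI)
  fix xs assume xs: "set xs \<subseteq> universe M"
  then have "set (map h xs) \<subseteq> universe N"
    using isomorphism_bij[OF assms(2)] by (auto simp: bij_betw_def)
  then show "isolated \<Sigma> M xs"
    using isolated_isomorphism[OF assms(1,2) xs] assms(3) unfolding atomic_structure_def by blast
qed

section \<open>Elementary substructures and the prime model\<close>

lemma eval_trm_universe_update: "eval_trm (M\<lparr>universe := Y\<rparr>) s t = eval_trm M s t"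
proof (induct t)
  case (Fun f ts)
  then have "map (eval_trm (M\<lparr>universe := Y\<rparr>) s) ts = map (eval_trm M s) ts" by simp
  then show ?case by (simp only: eval_trm.simps) simp
qed simp

text \<open>Parameters enter through assignments into \<open>Y\<close>, so formulas with constants
  need no syntax of their own. The test is what the existential case requires.\<close>

lemma tarski_vaught:
  assumes Y: "Y \<subseteq> universe M" "Y \<noteq> {}"
    and tv: "\<And>\<phi> \<sigma> v b. wf_form \<Sigma> \<phi> \<Longrightarrow> range \<sigma> \<subseteq> Y \<Longrightarrow> b \<in> universe M \<Longrightarrow> sat M (\<sigma>(v := b)) \<phi> \<Longrightarrow>
           \<exists>c\<in>Y. sat M (\<sigma>(v := c)) \<phi>"
  shows "wf_form \<Sigma> \<phi> \<Longrightarrow> range \<sigma> \<subseteq> Y \<Longrightarrow> sat (M\<lparr>universe := Y\<rparr>) \<sigma> \<phi> \<longleftrightarrow> sat M \<sigma> \<phi>"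
proof (induct \<phi> arbitrary: \<sigma>)
  case (Rel r ts)
  have "map (eval_trm (M\<lparr>universe := Y\<rparr>) \<sigma>) ts = map (eval_trm M \<sigma>) ts"
    by (simp add: eval_trm_universe_update)
  then show ?case by (simp only: sat.simps) simp
next
  case (Exists v \<phi>)
  have wf: "wf_form \<Sigma> \<phi>" using Exists(2) by simp
  have "sat (M\<lparr>universe := Y\<rparr>) (\<sigma>(v := c)) \<phi> \<longleftrightarrow> sat M (\<sigma>(v := c)) \<phi>" if "c \<in> Y" for c
    by (rule Exists(1)[OF wf]) (use Exists(3) that in auto)
  then have "sat (M\<lparr>universe := Y\<rparr>) \<sigma> (Exists v \<phi>) \<longleftrightarrow> (\<exists>c\<in>Y. sat M (\<sigma>(v := c)) \<phi>)" by simp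
  also have "\<dots> \<longleftrightarrow> (\<exists>b\<in>universe M. sat M (\<sigma>(v := b)) \<phi>)"
    using tv[OF wf Exists(3)] Y(1) by blast
  finally show ?case by simp
qed (simp_all add: eval_trm_universe_update)

text \<open>Closure under an operation is the test applied to its graph.\<close>

lemma tarski_vaught_closed:
  assumes str: "is_structure \<Sigma> M" and Y: "Y \<subseteq> universe M" "Y \<noteq> {}"
    and tv: "\<And>\<phi> \<sigma> v b. wf_form \<Sigma> \<phi> \<Longrightarrow> range \<sigma> \<subseteq> Y \<Longrightarrow> b \<in> universe M \<Longrightarrow> sat M (\<sigma>(v := b)) \<phi> \<Longrightarrow>
           \<exists>c\<in>Y. sat M (\<sigma>(v := c)) \<phi>"
  shows "is_structure \<Sigma> (M\<lparr>universe := Y\<rparr>)"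
proof (rule is_structureI)
  show "universe (M\<lparr>universe := Y\<rparr>) \<noteq> {}" using Y by simp
  fix f xs assume f: "(f, length xs) \<in> fun_syms \<Sigma>" and "set xs \<subseteq> universe (M\<lparr>universe := Y\<rparr>)"
  then have xs: "set xs \<subseteq> Y" by simp
  obtain y where y: "y \<in> Y" using Y(2) by blast
  define n where "n = length xs"
  define s where "s u = (if u < n then xs ! u else y)" for u
  have map: "map (s(n := a)) [0..<n] = xs" for a
    by (rule nth_equalityI) (auto simp: n_def s_def)
  have "wf_form \<Sigma> (graph_form f n)" using f by (simp add: graph_form_def n_def)
  moreover have "range s \<subseteq> Y" using xs y by (auto simp: s_def n_def)
  moreover have "fun_interp M f xs \<in> universe M"
    using is_structure_fun_interp[OF str f] xs Y(1) by auto
  moreover have "sat M (s(n := fun_interp M f xs)) (graph_form f n)"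
    unfolding sat_graph_form map by simp
  ultimately obtain c where "c \<in> Y" "sat M (s(n := c)) (graph_form f n)"
    using tv by blast
  then show "fun_interp (M\<lparr>universe := Y\<rparr>) f xs \<in> universe (M\<lparr>universe := Y\<rparr>)"
    unfolding sat_graph_form map by simp
qed

text \<open>
  The prime model: an elementary substructure enumerated in such a way that all initial segments
  are isolated. By categoricity it is isomorphic to the given structure.
\<close>

lemma omega_categorical_atomic:
  fixes M :: "('f::countable, 'r::countable, 'a) struc"
  assumes oc: "omega_categorical \<Sigma> M"
  shows "atomic_structure \<Sigma> M"
proof -
  have str: "is_structure \<Sigma> M" and cnt: "countable (universe M)"
    using oc by (simp_all add: omega_categorical_def)
  obtain a0 where a0: "a0 \<in> universe M" using str by (auto simp: is_structure_def)
  \<comment> \<open>A task is a formula, a list of indices as parameters, and the variable to be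
    witnessed. The second component of the pairing is left free, so each task returns at arbitrarily
    late stages, after its parameters have been enumerated.\<close>
  define task :: "nat \<Rightarrow> ('f, 'r) form \<times> nat list \<times> nat" where "task k = from_nat (fst (prod_decode k))" for k
  \<comment> \<open>The variable \<open>v\<close> becomes index \<open>k\<close>, the position of
    the element added at stage \<open>k\<close>; the other variables are sent to the listed
    indices.\<close>
  define req where "req k = (case task k of (\<phi>, es, v) \<Rightarrow> rename (\<lambda>u. if u = v then k else es ! u) \<phi>)" for k
  define P where "P k as \<longleftrightarrow> as \<in> tuples (universe M) k \<and> isolated \<Sigma> M as" for k as
  define Q where "Q k as as' \<longleftrightarrow> (\<exists>c. as' = as @ [c]) \<and> (req k \<in> formulas \<Sigma> (Suc k) \<longrightarrow>
      (\<exists>b\<in>universe M. sat M ((!) (as @ [b])) (req k)) \<longrightarrow> sat M ((!) as') (req k))" for k and as as' :: "'a list"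
  have "\<exists>f. \<forall>k. P k (f k) \<and> Q k (f k) (f (Suc k))"
  proof (rule dependent_nat_choice)
    have "complete_formula \<Sigma> M 0 truth" by (auto simp: complete_formula_def type_eq_def tuples_def)
    then have "P 0 []" using str by (auto simp: P_def tuples_def isolated_def)
    then show "\<exists>as. P 0 as" by blast
    fix as k assume "P k as"
    then have as: "as \<in> tuples (universe M) k" "isolated \<Sigma> M as" by (auto simp: P_def)
    show "\<exists>as'. P (Suc k) as' \<and> Q k as as'"
    proof (cases "req k \<in> formulas \<Sigma> (Suc k) \<and> (\<exists>b\<in>universe M. sat M ((!) (as @ [b])) (req k))")
      case True
      then obtain c where "c \<in> universe M" "sat M ((!) (as @ [c])) (req k)" "isolated \<Sigma> M (as @ [c])"
        using isolated_extend[OF oc as] by blast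
      then show ?thesis using tuples_snoc[OF as(1)] unfolding P_def Q_def by blast
    next
      \<comment> \<open>Without a satisfiable request any isolated extension will do;
        \<open>truth\<close> provides one.\<close>
      case False
      obtain c where "c \<in> universe M" "isolated \<Sigma> M (as @ [c])"
        using isolated_extend[OF oc as truth_formulas a0 sat_truth[OF str]] by blast
      then show ?thesis using tuples_snoc[OF as(1)] False unfolding P_def Q_def by blast
    qed
  qed
  then obtain f where f: "\<And>k. P k (f k)" "\<And>k. Q k (f k) (f (Suc k))" by blast
  define a where "a k = last (f (Suc k))" for k
  have f_eq: "f k = map a [0..<k]" for k
  proof (induct k)
    case 0
    then show ?case using f(1)[of 0] by (simp add: P_def tuples_def)
  next
    case (Suc k)
    have "f (Suc k) = f k @ [a k]" using f(2)[of k] unfolding Q_def a_def by auto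
    then show ?case using Suc by simp
  qed
  have aU: "a k \<in> universe M" for k
    using f(1)[of "Suc k"] by (auto simp: P_def f_eq tuples_def)
  have tv: "\<exists>c\<in>range a. sat M (\<sigma>(v := c)) \<phi>"
    if wf: "wf_form \<Sigma> \<phi>" and \<sigma>: "range \<sigma> \<subseteq> range a" and b: "b \<in> universe M" "sat M (\<sigma>(v := b)) \<phi>"
    for \<phi> \<sigma> v b
  proof -
    have "\<forall>u. \<exists>i. \<sigma> u = a i" using \<sigma> by (auto simp: image_iff subset_iff)
    then obtain e where e: "\<And>u. \<sigma> u = a (e u)" by metis
    define m where "m = Suc (Max (insert 0 (free_vars \<phi>)))"
    have m: "u < m" if "u \<in> free_vars \<phi>" for u
      using that finite_free_vars[of \<phi>] by (auto simp: m_def less_Suc_eq_le)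
    define es where "es = map e [0..<m]"
    \<comment> \<open>The second component pushes \<open>k\<close> above all parameter indices,
      since a pair code is at least as large as its components.\<close>
    define k where "k = prod_encode (to_nat (\<phi>, es, v), Suc (Max (insert 0 (set es))))"
    have "Suc (Max (insert 0 (set es))) \<le> k" unfolding k_def by (rule le_prod_encode_2)
    moreover have "e u \<le> Max (insert 0 (set es))" if "u < m" for u
      using that by (intro Max_ge) (auto simp: es_def)
    ultimately have k: "e u < k" if "u < m" for u
      using that by (meson le_imp_less_Suc less_le_trans)
    have req: "req k = rename (\<lambda>u. if u = v then k else es ! u) \<phi>"
      unfolding req_def task_def k_def by simp
    have "free_vars (req k) \<subseteq> {..<Suc k}"
      using free_vars_rename[of "\<lambda>u. if u = v then k else es ! u" \<phi>] m k
      unfolding req by (fastforce simp: es_def)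
    then have reqF: "req k \<in> formulas \<Sigma> (Suc k)"
      using wf_rename[OF wf] by (simp add: formulas_def req)
    have sat: "sat M ((!) (f k @ [x])) (req k) \<longleftrightarrow> sat M (\<sigma>(v := x)) \<phi>" for x
      unfolding req sat_rename by (rule sat_cong) (use m k in \<open>auto simp: es_def e f_eq nth_append\<close>)
    have "sat M ((!) (f (Suc k))) (req k)"
      using f(2)[of k] reqF b sat unfolding Q_def by blast
    moreover have "f (Suc k) = f k @ [a k]" by (simp add: f_eq)
    ultimately show ?thesis using sat by auto
  qed
  define N where "N = M\<lparr>universe := range a\<rparr>"
  have Y: "range a \<subseteq> universe M" "range a \<noteq> {}" using aU by auto
  have strN: "is_structure \<Sigma> N"
    unfolding N_def by (rule tarski_vaught_closed[OF str Y]) (use tv in blast)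
  have satN: "sat N ((!) xs) \<phi> \<longleftrightarrow> sat M ((!) xs) \<phi>"
    if xs: "xs \<in> tuples (range a) n" and \<phi>: "\<phi> \<in> formulas \<Sigma> n" for xs n \<phi>
  proof -
    define \<sigma> where "\<sigma> u = (if u < n then xs ! u else a 0)" for u
    have "sat N \<sigma> \<phi> \<longleftrightarrow> sat M \<sigma> \<phi>"
      unfolding N_def
      by (rule tarski_vaught[OF Y, of \<Sigma>]) (use tv \<phi> tuplesD(3)[OF xs] in \<open>auto simp: formulas_def \<sigma>_def\<close>)
    moreover have "sat N \<sigma> \<phi> \<longleftrightarrow> sat N ((!) xs) \<phi>" "sat M \<sigma> \<phi> \<longleftrightarrow> sat M ((!) xs) \<phi>"
      by (rule sat_formulas_cong[OF \<phi>], simp add: \<sigma>_def)+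
    ultimately show ?thesis by simp
  qed
  have "theory_of \<Sigma> N = theory_of \<Sigma> M"
    using satN[of "[]" 0] by (auto simp: theory_of_eq[OF str] theory_of_eq[OF strN] tuples_def)
  then obtain h where h: "isomorphism \<Sigma> M N h"
    using omega_categorical_isomorphic[OF oc strN] by (auto simp: N_def)
  have "isolated \<Sigma> N xs" if "set xs \<subseteq> universe N" for xs
  proof -
    define n where "n = length xs"
    have xs: "xs \<in> tuples (range a) n" using that by (simp add: N_def tuples_def n_def)
    have "\<forall>x\<in>set xs. \<exists>i. x = a i" using xs by (auto simp: tuples_def)
    then obtain g where g: "\<And>x. x \<in> set xs \<Longrightarrow> x = a (g x)" by metis
    define k where "k = Suc (Max (insert 0 (g ` set xs)))"
    have k: "g x < k" if "x \<in> set xs" for x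
      using that by (auto simp: k_def less_Suc_eq_le)
    \<comment> \<open>A tuple of the substructure is a selection from some initial segment, and
      those are isolated.\<close>
    have "isolated \<Sigma> M (map ((!) (f k)) (map g xs))"
      using f(1)[of k] k by (intro isolated_reindex[OF str]) (auto simp: P_def tuples_def)
    moreover have "map ((!) (f k)) (map g xs) = xs"
      using g k by (auto intro!: map_idI simp: f_eq)
    ultimately obtain \<phi> where \<phi>: "complete_formula \<Sigma> M n \<phi>" "sat M ((!) xs) \<phi>"
      by (auto simp: isolated_def n_def)
    \<comment> \<open>\<open>N\<close> is elementary in \<open>M\<close>, so a formula complete in
      \<open>M\<close> stays complete on the tuples of \<open>N\<close>.\<close>
    have "complete_formula \<Sigma> N n \<phi>"
      unfolding complete_formula_def
    proof (intro conjI ballI impI)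
      show \<phi>F: "\<phi> \<in> formulas \<Sigma> n" using \<phi>(1) by (simp add: complete_formula_def)
      fix us vs assume "us \<in> tuples (universe N) n" "vs \<in> tuples (universe N) n"
        and s: "sat N ((!) us) \<phi>" "sat N ((!) vs) \<phi>"
      then have uv: "us \<in> tuples (range a) n" "vs \<in> tuples (range a) n" by (simp_all add: N_def)
      then have "us \<in> tuples (universe M) n" "vs \<in> tuples (universe M) n"
        using Y(1) by (auto simp: tuples_def)
      then have "type_eq \<Sigma> M us M vs"
        using \<phi>(1) satN[OF _ \<phi>F] uv s unfolding complete_formula_def by blast
      then show "type_eq \<Sigma> N us N vs"
        using satN[OF uv(1)] satN[OF uv(2)] tuplesD(1)[OF uv(1)] unfolding type_eq_def by blast
    qed
    moreover have "sat N ((!) xs) \<phi>" using \<phi> satN[OF xs] by (simp add: complete_formula_def)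
    ultimately show ?thesis by (auto simp: isolated_def n_def)
  qed
  then have "atomic_structure \<Sigma> N" by (simp add: atomic_structure_def)
  then show ?thesis using atomic_structure_isomorphism[OF str h] by blast
qed

text \<open>Left to right: each tuple \<open>b k\<close> has an isolating formula
  \<open>F k\<close>. If no finitely many of these covered all tuples, their negations would form a
  finitely satisfiable type, realised by categoricity; but every tuple satisfies its own formula.
  Tuples sharing a formula are conjugate by back-and-forth.\<close>

theorem ryll_nardzewski:
  fixes M :: "('f::countable, 'r::countable, 'a) struc"
  shows "omega_categorical \<Sigma> M \<longleftrightarrow> is_structure \<Sigma> M \<and> countable (universe M) \<and>
     oligomorphic {h. isomorphism \<Sigma> M M h} (universe M)"
proof (intro iffI conjI)
  assume oc: "omega_categorical \<Sigma> M"
  then show str: "is_structure \<Sigma> M" and cnt: "countable (universe M)"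
    by (simp_all add: omega_categorical_def)
  note at = omega_categorical_atomic[OF oc]
  have "\<exists>R. covers_tuples {h. isomorphism \<Sigma> M M h} (universe M) n R" for n
  proof -
    let ?T = "tuples (universe M) n"
    obtain a where a: "a \<in> universe M" using str by (auto simp: is_structure_def)
    then have ne: "?T \<noteq> {}" by (auto simp: tuples_def intro!: exI[of _ "replicate n a"])
    define b where "b = from_nat_into ?T"
    have b: "b k \<in> ?T" for k using ne by (auto simp: b_def intro: from_nat_into)
    have b_surj: "\<exists>k. b k = ys" if "ys \<in> ?T" for ys
      using from_nat_into_surj countable_tuples[OF cnt] that unfolding b_def by metis
    have "\<exists>\<phi>. complete_formula \<Sigma> M n \<phi> \<and> sat M ((!) (b k)) \<phi>" for k
      using at tuplesD(1,2)[OF b[of k]] unfolding atomic_structure_def isolated_def by metis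
    then obtain F where F: "\<And>k. complete_formula \<Sigma> M n (F k)" "\<And>k. sat M ((!) (b k)) (F k)"
      by metis
    have FF: "F k \<in> formulas \<Sigma> n" for k using F(1)[of k] by (simp add: complete_formula_def)
    have "\<exists>K. \<forall>xs\<in>?T. \<exists>i\<le>K. sat M ((!) xs) (F i)"
    proof (rule ccontr)
      assume "\<not> ?thesis"
      then have "\<exists>xs\<in>?T. \<forall>i\<le>K. sat M ((!) xs) (Neg (F i))" for K :: nat by auto
      then obtain xs where "xs \<in> ?T" "\<And>k. sat M ((!) xs) (Neg (F k))"
        using omega_categorical_realises[OF oc, of "\<lambda>k. Neg (F k)" n] FF by auto
      then show False using F(2) b_surj by (metis sat.simps(3))
    qed
    then obtain K where K: "\<And>xs. xs \<in> ?T \<Longrightarrow> \<exists>i\<le>K. sat M ((!) xs) (F i)" by blast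
    have "\<exists>r\<in>b ` {..K}. \<exists>g\<in>{h. isomorphism \<Sigma> M M h}. map g r = xs" if xs: "xs \<in> ?T" for xs
    proof -
      obtain i where i: "i \<le> K" "sat M ((!) xs) (F i)" using K[OF xs] by blast
      then have "type_eq \<Sigma> M (b i) M xs"
        using F b xs unfolding complete_formula_def by blast
      then obtain h where "isomorphism \<Sigma> M M h" "map h (b i) = xs"
        using back_and_forth[OF str cnt at str cnt at] tuplesD(2)[OF b] tuplesD(2)[OF xs] by metis
      then show ?thesis using i(1) by blast
    qed
    then show ?thesis using b by (intro exI[of _ "b ` {..K}"]) (auto simp: covers_tuples_def)
  qed
  then show "oligomorphic {h. isomorphism \<Sigma> M M h} (universe M)"
    using oligomorphic_iff[OF acts_on_automorphisms[OF str]] by blast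
qed (use omega_categorical_if_oligomorphic in blast)

section \<open>Branches of a monounary algebra\<close>

lemma funpow_funpow: "(f ^^ m) ((f ^^ n) x) = (f ^^ (m + n)) x"
  by (simp add: funpow_add)

locale monounary =
  fixes A :: "'a set" and \<theta> :: "'a \<Rightarrow> 'a"
  assumes monounary: "monounary_algebra A \<theta>"
begin

abbreviation "C \<equiv> cyc A \<theta>"
abbreviation "B \<equiv> branch_set A \<theta>"

lemma closed: "x \<in> A \<Longrightarrow> \<theta> x \<in> A"
  using monounary by (simp add: monounary_algebra_def)

lemma funpow_closed: "x \<in> A \<Longrightarrow> (\<theta> ^^ n) x \<in> A"
  by (induct n) (auto simp: closed)

lemma cyc_subset: "C \<subseteq> A"
  by (auto simp: cyc_def)

lemma cyc_closed: "x \<in> C \<Longrightarrow> \<theta> x \<in> C"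
  by (auto simp: cyc_def closed funpow_swap1[symmetric])

lemma funpow_cyc: "x \<in> C \<Longrightarrow> (\<theta> ^^ n) x \<in> C"
  by (induct n) (auto simp: cyc_closed)

lemma funpow_cyc_mono: "(\<theta> ^^ m) x \<in> C \<Longrightarrow> m \<le> n \<Longrightarrow> (\<theta> ^^ n) x \<in> C"
  using funpow_cyc[of "(\<theta> ^^ m) x" "n - m"] by (simp add: funpow_funpow)

lemma cyc_if_funpow_eq:
  assumes "x \<in> A" "(\<theta> ^^ i) x = (\<theta> ^^ j) x" "i < j"
  shows "(\<theta> ^^ i) x \<in> C"
proof -
  have "(\<theta> ^^ (j - i)) ((\<theta> ^^ i) x) = (\<theta> ^^ j) x"
    using assms(3) by (simp add: funpow_funpow)
  also have "\<dots> = (\<theta> ^^ i) x" by (rule assms(2)[symmetric])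
  finally show ?thesis using assms funpow_closed by (auto simp: cyc_def intro!: exI[of _ "j - i"])
qed

text \<open>After \<open>n\<close> steps the iterates repeat with period \<open>p\<close>, so the
  first \<open>n + p\<close> of them are all.\<close>

lemma finite_funpow_orbit:
  assumes "(\<theta> ^^ n) x \<in> C"
  shows "finite (range (\<lambda>k. (\<theta> ^^ k) x))"
proof -
  obtain p where p: "p \<ge> 1" "(\<theta> ^^ p) ((\<theta> ^^ n) x) = (\<theta> ^^ n) x"
    using assms by (auto simp: cyc_def)
  have "(\<theta> ^^ k) x \<in> (\<lambda>k. (\<theta> ^^ k) x) ` {..<n + p}" for k
  proof (cases "k < n")
    case False
    have "(\<theta> ^^ k) x = (\<theta> ^^ (k - n)) ((\<theta> ^^ n) x)"
      using False by (simp add: funpow_funpow)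
    also have "\<dots> = (\<theta> ^^ ((k - n) mod p)) ((\<theta> ^^ n) x)"
      using funpow_mod_eq[OF p(2)] by simp
    also have "\<dots> = (\<theta> ^^ ((k - n) mod p + n)) x" by (simp add: funpow_add)
    finally have "(\<theta> ^^ k) x = (\<theta> ^^ ((k - n) mod p + n)) x" .
    moreover have "(k - n) mod p + n < n + p" using p(1) by simp
    ultimately show ?thesis by blast
  next
    case True
    then show ?thesis by (intro image_eqI[of _ _ k]) simp_all
  qed
  then have "range (\<lambda>k. (\<theta> ^^ k) x) \<subseteq> (\<lambda>k. (\<theta> ^^ k) x) ` {..<n + p}" by blast
  then show ?thesis using finite_surj by blast
qed

text \<open>The subalgebra generated by one element is its forward orbit, finite exactly if it runs
  into a cycle; a finite union of forward orbits is closed, which settles finitely many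
  generators.\<close>

lemma locally_finite_iff: "locally_finite A \<theta> \<longleftrightarrow> (\<forall>x\<in>A. \<exists>n. (\<theta> ^^ n) x \<in> C)"
proof (intro iffI ballI)
  fix x assume lf: "locally_finite A \<theta>" and x: "x \<in> A"
  have "finite (subalgebra A \<theta> hull {x})" using lf x by (auto simp: locally_finite_def)
  moreover have "(\<theta> ^^ k) x \<in> subalgebra A \<theta> hull {x}" for k
    unfolding hull_def by (induct k) (auto simp: subalgebra_def)
  ultimately have "finite (range (\<lambda>k. (\<theta> ^^ k) x))" by (auto intro: finite_subset)
  then have "\<not> inj (\<lambda>k. (\<theta> ^^ k) x)" using range_inj_infinite by blast
  then obtain i j where "(\<theta> ^^ i) x = (\<theta> ^^ j) x" "i < j"
    unfolding inj_def by (metis linorder_neqE_nat)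
  then show "\<exists>n. (\<theta> ^^ n) x \<in> C" using cyc_if_funpow_eq[OF x] by blast
next
  assume cyc: "\<forall>x\<in>A. \<exists>n. (\<theta> ^^ n) x \<in> C"
  show "locally_finite A \<theta>"
    unfolding locally_finite_def
  proof (intro allI impI, elim conjE)
    fix S assume S: "S \<noteq> {}" "S \<subseteq> A" "finite S"
    define T where "T = (\<Union>x\<in>S. range (\<lambda>k. (\<theta> ^^ k) x))"
    have "finite T" using S cyc finite_funpow_orbit unfolding T_def by blast
    moreover have "S \<subseteq> T"
    proof
      fix x assume "x \<in> S"
      then have "(\<theta> ^^ 0) x \<in> T" unfolding T_def by blast
      then show "x \<in> T" by simp
    qed
    moreover have "subalgebra A \<theta> T"
      unfolding subalgebra_def
    proof (intro conjI ballI)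
      show "T \<noteq> {}" using \<open>S \<subseteq> T\<close> S(1) by blast
      show "T \<subseteq> A" using S(2) funpow_closed by (auto simp: T_def)
      fix y assume "y \<in> T"
      then obtain x k where x: "x \<in> S" "y = (\<theta> ^^ k) x" by (auto simp: T_def)
      then have "\<theta> y = (\<theta> ^^ Suc k) x" by simp
      then show "\<theta> y \<in> T" using x(1) unfolding T_def by blast
    qed
    ultimately show "finite (subalgebra A \<theta> hull S)"
      using hull_minimal[of S T "subalgebra A \<theta>"] finite_subset by blast
  qed
qed

text \<open>Iterates of cyclic elements are cyclic, so bounding the least exponent amounts to
  testing a single one.\<close>

lemma height_le_iff: "height A \<theta> x \<le> enat n \<longleftrightarrow> (\<theta> ^^ n) x \<in> C"
proof
  assume le: "height A \<theta> x \<le> enat n"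
  have "{enat m | m. (\<theta> ^^ m) x \<in> C} \<noteq> {}"
  proof
    assume "{enat m | m. (\<theta> ^^ m) x \<in> C} = {}"
    then have "height A \<theta> x = \<infinity>" by (simp only: height_def) (simp add: Inf_enat_def)
    then show False using le by simp
  qed
  then obtain h where "h \<in> {enat m | m. (\<theta> ^^ m) x \<in> C}" by blast
  then have "height A \<theta> x \<in> {enat m | m. (\<theta> ^^ m) x \<in> C}"
    unfolding height_def by (rule wellorder_InfI)
  then show "(\<theta> ^^ n) x \<in> C" using le funpow_cyc_mono by auto
qed (auto simp: height_def intro: Inf_lower)

lemma algebra_height_iff: "algebra_height A \<theta> \<noteq> \<infinity> \<longleftrightarrow> (\<exists>n. \<forall>x\<in>A. (\<theta> ^^ n) x \<in> C)"
proof
  assume fin: "algebra_height A \<theta> \<noteq> \<infinity>"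
  have "{enat n | n. \<forall>x\<in>A. height A \<theta> x \<le> enat n} \<noteq> {}"
  proof
    assume "{enat n | n. \<forall>x\<in>A. height A \<theta> x \<le> enat n} = {}"
    then have "algebra_height A \<theta> = \<infinity>" by (simp only: algebra_height_def) (simp add: Inf_enat_def)
    then show False using fin by simp
  qed
  then show "\<exists>n. \<forall>x\<in>A. (\<theta> ^^ n) x \<in> C" by (auto simp: height_le_iff)
next
  assume "\<exists>n. \<forall>x\<in>A. (\<theta> ^^ n) x \<in> C"
  then obtain n where "enat n \<in> {enat n | n. \<forall>x\<in>A. height A \<theta> x \<le> enat n}"
    by (auto simp: height_le_iff)
  then have "algebra_height A \<theta> \<le> enat n" unfolding algebra_height_def by (rule Inf_lower)
  then show "algebra_height A \<theta> \<noteq> \<infinity>" by (cases "algebra_height A \<theta>") auto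
qed

section \<open>Branches as rooted trees\<close>

lemma branch_self: "z \<in> B z"
  by (simp add: branch_set_def)

lemma branch_back:
  assumes "\<theta> x \<in> B z" "x \<in> A" "x \<notin> C"
  shows "x \<in> B z"
proof (cases "\<theta> x = z")
  case True
  then show ?thesis using assms by (auto simp: branch_set_def intro!: exI[of _ "Suc 0"])
next
  case False
  then obtain n where n: "n \<ge> 1" "(\<theta> ^^ n) (\<theta> x) = z" "(\<theta> ^^ (n - 1)) (\<theta> x) \<notin> C"
    using assms(1) by (auto simp: branch_set_def)
  have "(\<theta> ^^ (Suc n)) x = z" using n(2) by (simp add: funpow_swap1)
  moreover have "(\<theta> ^^ (Suc n - 1)) x \<notin> C"
    using n(1,3) by (cases n) (auto simp: funpow_swap1)
  ultimately show ?thesis using assms(2,3) by (auto simp: branch_set_def intro!: exI[of _ "Suc n"])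
qed

lemma branch_step:
  assumes "x \<in> B z" "x \<noteq> z"
  shows "x \<in> A" "x \<notin> C" "\<theta> x \<in> B z"
proof -
  obtain n where n: "n \<ge> 1" "(\<theta> ^^ n) x = z" "(\<theta> ^^ (n - 1)) x \<notin> C"
    and x: "x \<in> A" "x \<notin> C"
    using assms by (auto simp: branch_set_def)
  show "x \<in> A" "x \<notin> C" by fact+
  obtain m where m: "n = Suc m" using n(1) by (cases n) auto
  show "\<theta> x \<in> B z"
  proof (cases m)
    case 0
    then show ?thesis using n m branch_self by auto
  next
    case (Suc l)
    have "(\<theta> ^^ m) (\<theta> x) = z" "(\<theta> ^^ (m - 1)) (\<theta> x) \<notin> C"
      using n m Suc by (auto simp: funpow_swap1)
    moreover from this(2) have "\<theta> x \<notin> C" using funpow_cyc by blast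
    ultimately show ?thesis using Suc closed[OF x(1)]
      by (auto simp: branch_set_def intro!: exI[of _ m])
  qed
qed

text \<open>Induction on the distance from the root: \<open>\<theta>\<close> brings every other
  element of the branch one step closer to \<open>z\<close>.\<close>

lemma branch_induct [consumes 1, case_names root step]:
  assumes "x \<in> B z" and "P z"
    and step: "\<And>x. x \<in> A \<Longrightarrow> x \<notin> C \<Longrightarrow> \<theta> x \<in> B z \<Longrightarrow> P (\<theta> x) \<Longrightarrow> P x"
  shows "P x"
proof -
  have "P x" if "x \<in> B z" "(\<theta> ^^ n) x = z" for n
    using that
  proof (induct n arbitrary: x)
    case 0
    then show ?case using assms(2) by simp
  next
    case (Suc n)
    show ?case
    proof (cases "x = z")
      case False
      have "(\<theta> ^^ n) (\<theta> x) = z" using Suc(3) by (simp add: funpow_swap1)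
      then show ?thesis using Suc(1) branch_step[OF Suc(2) False] step by blast
    qed (use assms(2) in simp)
  qed
  moreover have "\<exists>n. (\<theta> ^^ n) x = z" using assms(1) by (auto simp: branch_set_def intro: exI[of _ 0])
  ultimately show ?thesis using assms(1) by blast
qed

lemma branch_funpow: "x \<in> B z \<Longrightarrow> \<exists>n. (\<theta> ^^ n) x = z"
proof (induct rule: branch_induct)
  case root
  show ?case by (rule exI[of _ 0]) simp
next
  case (step x)
  then obtain n where "(\<theta> ^^ n) (\<theta> x) = z" by blast
  then show ?case by (intro exI[of _ "Suc n"]) (simp add: funpow_swap1)
qed

lemma branch_subset: "z \<in> A \<Longrightarrow> B z \<subseteq> A"
  by (auto simp: branch_set_def)

lemma branch_cyc: "x \<in> B z \<Longrightarrow> x \<in> C \<Longrightarrow> x = z"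
  by (auto simp: branch_set_def)

text \<open>A root whose image fell back into its branch would return to itself and be cyclic. Thus
  a noncyclic root is the only point of its branch where the partial operation is undefined.\<close>

lemma theta_notin_branch: "z \<in> A \<Longrightarrow> z \<notin> C \<Longrightarrow> \<theta> z \<notin> B z"
proof
  assume z: "z \<in> A" "z \<notin> C" "\<theta> z \<in> B z"
  obtain n where "(\<theta> ^^ n) (\<theta> z) = z" using branch_funpow[OF z(3)] by blast
  then have "(\<theta> ^^ Suc n) z = z" by (simp add: funpow_swap1)
  then have "z \<in> C" using z(1) by (auto simp: cyc_def intro!: exI[of _ "Suc n"])
  then show False using z(2) by simp
qed

lemma cyc_branch_cover: "x \<in> A \<Longrightarrow> (\<theta> ^^ n) x \<in> C \<Longrightarrow> \<exists>c\<in>C. x \<in> B c"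
proof (induct n arbitrary: x)
  case 0
  then show ?case using branch_self by auto
next
  case (Suc n)
  show ?case
  proof (cases "x \<in> C")
    case True
    then show ?thesis using branch_self by blast
  next
    case False
    have "(\<theta> ^^ n) (\<theta> x) \<in> C" using Suc(3) by (simp add: funpow_swap1)
    then obtain c where "c \<in> C" "\<theta> x \<in> B c" using Suc(1,2) closed by blast
    then show ?thesis using branch_back Suc(2) False by blast
  qed
qed

text \<open>A common element, moved along \<open>\<theta>\<close>, would reach one root inside the
  branch of the other; then the common image of the two roots would lie in that branch, contrary to
  \<open>theta_notin_branch\<close>.\<close>

lemma sibling_branches_disjoint:
  assumes "x \<in> A" "x \<notin> C" "y \<in> A" "y \<notin> C" "\<theta> x = \<theta> y" "x \<noteq> y"
  shows "B x \<inter> B y = {}"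
proof -
  have "u \<notin> B y" if "u \<in> B x" for u
    using that
  proof (induct rule: branch_induct)
    case root
    show ?case using branch_step(3)[of x y] theta_notin_branch[of y] assms by auto
  next
    case (step u)
    show ?case
    proof
      assume u: "u \<in> B y"
      show False
      proof (cases "u = y")
        case True
        then show False using step(3) assms theta_notin_branch[of x] by simp
      next
        case False
        then show False using branch_step(3)[OF u] step(4) by simp
      qed
    qed
  qed
  then show ?thesis by blast
qed

section \<open>Isomorphisms of branches\<close>

definition branch_iso :: "'a \<Rightarrow> 'a \<Rightarrow> ('a \<Rightarrow> 'a) \<Rightarrow> bool" where
  "branch_iso z w h \<longleftrightarrow> bij_betw h (B z) (B w) \<and>
     (\<forall>x\<in>B z. (\<theta> x \<in> B z \<longleftrightarrow> \<theta> (h x) \<in> B w) \<and> (\<theta> x \<in> B z \<longrightarrow> h (\<theta> x) = \<theta> (h x)))"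

lemma partial_isomorphism_branch:
  "partial_isomorphism (branch_algebra A \<theta> z) (branch_algebra A \<theta> w) h \<longleftrightarrow> branch_iso z w h"
proof (cases "bij_betw h (B z) (B w)")
  case True
  then have "h x \<in> B w" if "x \<in> B z" for x using that by (auto simp: bij_betw_def)
  then show ?thesis
    using True by (auto simp: partial_isomorphism_def branch_iso_def branch_algebra_def dom_def)
qed (simp add: partial_isomorphism_def branch_iso_def branch_algebra_def)

lemma branch_iso_in: "branch_iso z w h \<Longrightarrow> x \<in> B z \<Longrightarrow> h x \<in> B w"
  by (auto simp: branch_iso_def bij_betw_def)

lemma branch_iso_id: "branch_iso z z id"
  by (simp add: branch_iso_def)

lemma branch_iso_comp:
  assumes "branch_iso z w h" "branch_iso w v g"
  shows "branch_iso z v (g \<circ> h)"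
proof -
  have "bij_betw (g \<circ> h) (B z) (B v)"
    using assms by (auto simp: branch_iso_def intro: bij_betw_trans)
  then show ?thesis using assms branch_iso_in[OF assms(1)] by (auto simp: branch_iso_def)
qed

lemma branch_iso_inv:
  assumes "branch_iso z w h"
  shows "branch_iso w z (inv_into (B z) h)"
proof -
  have h: "bij_betw h (B z) (B w)" using assms by (simp add: branch_iso_def)
  have "(\<theta> y \<in> B w \<longleftrightarrow> \<theta> (inv_into (B z) h y) \<in> B z) \<and>
      (\<theta> y \<in> B w \<longrightarrow> inv_into (B z) h (\<theta> y) = \<theta> (inv_into (B z) h y))" if "y \<in> B w" for y
  proof -
    define x where "x = inv_into (B z) h y"
    have x: "x \<in> B z" "h x = y"
      using that h by (auto simp: x_def bij_betw_def inv_into_into f_inv_into_f)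
    have inv: "inv_into (B z) h (h u) = u" if "u \<in> B z" for u
      using that h by (simp add: bij_betw_def)
    show ?thesis using assms x inv unfolding branch_iso_def x_def[symmetric] by metis
  qed
  then show ?thesis using bij_betw_inv_into[OF h] by (simp add: branch_iso_def)
qed

lemma finite_up_to_iso_iff:
  "finite_up_to_iso (branch_algebra A \<theta> ` A) \<longleftrightarrow>
     (\<exists>T. finite T \<and> T \<subseteq> A \<and> (\<forall>x\<in>A. \<exists>t\<in>T. \<exists>h. branch_iso t x h))"
proof -
  define E where "E = {(P, Q). P \<in> branch_algebra A \<theta> ` A \<and> Q \<in> branch_algebra A \<theta> ` A \<and> partial_isomorphic P Q}"
  define cls where "cls x = E `` {branch_algebra A \<theta> x}" for x
  have E: "(branch_algebra A \<theta> x, branch_algebra A \<theta> y) \<in> E \<longleftrightarrow> (\<exists>h. branch_iso x y h)"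
    if "x \<in> A" "y \<in> A" for x y
    using that by (auto simp: E_def partial_isomorphic_def partial_isomorphism_branch)
  have cls: "cls x = {branch_algebra A \<theta> y | y. y \<in> A \<and> (\<exists>h. branch_iso x y h)}" if "x \<in> A" for x
    using that E by (auto simp: cls_def) (auto simp: E_def)
  have "(branch_algebra A \<theta> ` A) // E = cls ` A"
    by (auto simp: quotient_def cls_def)
  then have fin: "finite_up_to_iso (branch_algebra A \<theta> ` A) \<longleftrightarrow> finite (cls ` A)"
    by (simp add: finite_up_to_iso_def E_def)
  show ?thesis
    unfolding fin
  proof
    assume "finite (cls ` A)"
    then obtain T where T: "T \<subseteq> A" "finite T" "cls ` A = cls ` T"
      using finite_subset_image[of "cls ` A" cls A] by auto
    have "\<exists>t\<in>T. \<exists>h. branch_iso t x h" if x: "x \<in> A" for x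
    proof -
      have "cls x \<in> cls ` T" using x unfolding T(3)[symmetric] by (rule imageI)
      then obtain t where t: "t \<in> T" "cls x = cls t" by blast
      have "branch_algebra A \<theta> x \<in> cls x" using E[OF x x] branch_iso_id by (auto simp: cls_def)
      then show ?thesis using t E[of t x] T(1) x by (auto simp: cls_def)
    qed
    then show "\<exists>T. finite T \<and> T \<subseteq> A \<and> (\<forall>x\<in>A. \<exists>t\<in>T. \<exists>h. branch_iso t x h)" using T by blast
  next
    assume "\<exists>T. finite T \<and> T \<subseteq> A \<and> (\<forall>x\<in>A. \<exists>t\<in>T. \<exists>h. branch_iso t x h)"
    then obtain T where T: "finite T" "T \<subseteq> A" "\<And>x. x \<in> A \<Longrightarrow> \<exists>t\<in>T. \<exists>h. branch_iso t x h" by blast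
    have "cls ` A \<subseteq> cls ` T"
    proof (rule image_subsetI)
      fix x assume x: "x \<in> A"
      then obtain t h where t: "t \<in> T" "branch_iso t x h" using T(3) by blast
      have "(\<exists>h. branch_iso x y h) \<longleftrightarrow> (\<exists>h. branch_iso t y h)" for y
        using t(2) branch_iso_comp branch_iso_inv by blast
      moreover have "t \<in> A" using t(1) T(2) by blast
      ultimately have "cls x = cls t" by (simp only: cls[OF x] cls)
      then show "cls x \<in> cls ` T" using t(1) by blast
    qed
    then show "finite (cls ` A)" using T(1) finite_subset by blast
  qed
qed

section \<open>Automorphisms\<close>

abbreviation "AUT \<equiv> algebra_automorphisms A \<theta>"

lemma aut_in: "g \<in> AUT \<Longrightarrow> x \<in> A \<Longrightarrow> g x \<in> A"
  by (auto simp: algebra_automorphisms_def bij_betw_def)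

lemma aut_commute: "g \<in> AUT \<Longrightarrow> x \<in> A \<Longrightarrow> g (\<theta> x) = \<theta> (g x)"
  by (simp add: algebra_automorphisms_def)

lemma aut_inj: "g \<in> AUT \<Longrightarrow> x \<in> A \<Longrightarrow> y \<in> A \<Longrightarrow> g x = g y \<longleftrightarrow> x = y"
  by (auto simp: algebra_automorphisms_def bij_betw_def inj_on_def)

lemma aut_funpow: "g \<in> AUT \<Longrightarrow> x \<in> A \<Longrightarrow> g ((\<theta> ^^ n) x) = (\<theta> ^^ n) (g x)"
  by (induct n) (auto simp: aut_commute funpow_closed)

lemma aut_cyc: "g \<in> AUT \<Longrightarrow> x \<in> A \<Longrightarrow> g x \<in> C \<longleftrightarrow> x \<in> C"
  by (auto simp: cyc_def aut_in aut_funpow[symmetric] aut_inj funpow_closed)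

lemma aut_id: "id \<in> AUT"
  by (simp add: algebra_automorphisms_def)

lemma aut_comp: "g \<in> AUT \<Longrightarrow> h \<in> AUT \<Longrightarrow> g \<circ> h \<in> AUT"
  using aut_in[of h] by (auto simp: algebra_automorphisms_def intro: bij_betw_trans)

lemma aut_inv:
  assumes "g \<in> AUT"
  shows "inv_into A g \<in> AUT" "x \<in> A \<Longrightarrow> inv_into A g (g x) = x" "x \<in> A \<Longrightarrow> g (inv_into A g x) = x"
proof -
  have g: "bij_betw g A A" using assms by (simp add: algebra_automorphisms_def)
  show 1: "inv_into A g (g x) = x" if "x \<in> A" for x using g that by (simp add: bij_betw_def)
  show 2: "g (inv_into A g x) = x" if "x \<in> A" for x using g that by (simp add: bij_betw_def f_inv_into_f)
  have b: "bij_betw (inv_into A g) A A" using g by (rule bij_betw_inv_into)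
  have "inv_into A g (\<theta> x) = \<theta> (inv_into A g x)" if "x \<in> A" for x
  proof -
    have "inv_into A g x \<in> A" using b that by (auto simp: bij_betw_def)
    then show ?thesis using 1 2 that aut_commute[OF assms] closed by metis
  qed
  then show "inv_into A g \<in> AUT" using b by (simp add: algebra_automorphisms_def)
qed

lemma aut_branch:
  assumes "g \<in> AUT" "z \<in> A" "x \<in> B z"
  shows "g x \<in> B (g z)"
  using assms(3)
proof (induct rule: branch_induct)
  case root
  show ?case by (rule branch_self)
next
  case (step x)
  then show ?case using assms(1) branch_back[of "g x" "g z"] aut_commute aut_in aut_cyc by metis
qed

lemma aut_branch_iff: "g \<in> AUT \<Longrightarrow> z \<in> A \<Longrightarrow> x \<in> A \<Longrightarrow> g x \<in> B (g z) \<longleftrightarrow> x \<in> B z"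
  using aut_branch[of g z x] aut_branch[OF aut_inv(1), of g "g z" "g x"] aut_inv(2) aut_in by auto

lemma aut_branch_iso:
  assumes g: "g \<in> AUT" and z: "z \<in> A"
  shows "branch_iso z (g z) g"
proof -
  note sub = branch_subset[OF z] branch_subset[OF aut_in[OF g z]]
  have "B (g z) \<subseteq> g ` B z"
  proof
    fix y assume y: "y \<in> B (g z)"
    then have "y \<in> A" using sub by blast
    then have "inv_into A g y \<in> A" "g (inv_into A g y) = y"
      using aut_inv(1,3)[OF g] aut_in by auto
    then show "y \<in> g ` B z" using aut_branch_iff[OF g z] y by (metis image_eqI)
  qed
  then have "bij_betw g (B z) (B (g z))"
    using sub aut_branch[OF g z] aut_inj[OF g] by (auto simp: bij_betw_def inj_on_def subset_iff)
  then show ?thesis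
    using sub aut_branch_iff[OF g z] closed aut_commute[OF g]
    by (auto simp: branch_iso_def subset_iff) (metis)+
qed

lemma acts_on_aut: "acts_on AUT A"
  unfolding acts_on_def
proof (intro conjI ballI)
  fix g assume g: "g \<in> AUT"
  show "g ` A \<subseteq> A" using aut_in[OF g] by blast
  show "\<exists>g'\<in>AUT. \<forall>x\<in>A. g' (g x) = x" using aut_inv[OF g] by blast
qed (simp_all add: aut_id aut_comp)

text \<open>Points are treated as tuples of length one; \<open>hd\<close> and the singleton map
  translate between the two kinds of orbits.\<close>

lemma finite_one_orbits_iff: "finite (one_orbits A \<theta>) \<longleftrightarrow> (\<exists>R. covers_tuples AUT A 1 R)"
proof -
  let ?O = "(\<lambda>xs. (\<lambda>g. map g xs) ` AUT) ` tuples A 1"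
  have t: "tuples A 1 = (\<lambda>x. [x]) ` A" by (auto simp: tuples_def length_Suc_conv)
  have "one_orbits A \<theta> = (`) hd ` ?O"
    unfolding one_orbits_def t image_image by simp
  moreover have "?O = (`) (\<lambda>x. [x]) ` one_orbits A \<theta>"
    unfolding one_orbits_def t image_image by simp
  ultimately have "finite (one_orbits A \<theta>) \<longleftrightarrow> finite ?O"
    by (metis finite_imageI)
  then show ?thesis using finite_orbits_iff[OF acts_on_aut, of 1] by simp
qed

lemma automorphisms_algebra_struc:
  "{h. isomorphism monounary_sig (algebra_struc A \<theta>) (algebra_struc A \<theta>) h} = AUT"
proof -
  have "(\<forall>xs. length xs = 1 \<and> set xs \<subseteq> A \<longrightarrow> h (\<theta> (hd xs)) = \<theta> (hd (map h xs))) \<longleftrightarrow>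
      (\<forall>x\<in>A. h (\<theta> x) = \<theta> (h x))" for h
    by (auto simp: length_Suc_conv dest: spec[of _ "[_]"])
  then show ?thesis
    by (auto simp: isomorphism_def monounary_sig_def algebra_struc_def algebra_automorphisms_def)
qed

lemma omega_categorical_algebra_iff:
  assumes "countable A"
  shows "omega_categorical monounary_sig (algebra_struc A \<theta>) \<longleftrightarrow> oligomorphic AUT A"
proof -
  have "is_structure monounary_sig (algebra_struc A \<theta>)"
    using monounary
    by (auto simp: is_structure_def monounary_sig_def algebra_struc_def monounary_algebra_def length_Suc_conv)
  moreover have "universe (algebra_struc A \<theta>) = A" by (simp add: algebra_struc_def)
  ultimately show ?thesis
    using assms by (simp add: ryll_nardzewski automorphisms_algebra_struc)
qed

section \<open>Oligomorphicity from finitely many branches\<close>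

text \<open>Fixing the cycle pointwise, these automorphisms map each \<open>B c\<close> with cyclic
  \<open>c\<close> onto itself, so one group acts on the algebra and on all these branches.\<close>

definition cyc_aut :: "('a \<Rightarrow> 'a) set" where
  "cyc_aut = {g \<in> AUT. \<forall>c\<in>C. g c = c}"

lemma cyc_aut_in: "g \<in> cyc_aut \<Longrightarrow> x \<in> A \<Longrightarrow> g x \<in> A"
  by (simp add: cyc_aut_def aut_in)

lemma acts_on_cyc_aut: "acts_on cyc_aut A"
  unfolding acts_on_def
proof (intro conjI ballI)
  fix g assume g: "g \<in> cyc_aut"
  then have aut: "g \<in> AUT" by (simp add: cyc_aut_def)
  show "g ` A \<subseteq> A" using aut_in[OF aut] by blast
  have "inv_into A g c = c" if "c \<in> C" for c
    using g that aut_inv(2)[OF aut, of c] cyc_subset by (auto simp: cyc_aut_def)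
  then have "inv_into A g \<in> cyc_aut" using aut_inv(1)[OF aut] by (simp add: cyc_aut_def)
  then show "\<exists>g'\<in>cyc_aut. \<forall>x\<in>A. g' (g x) = x" using aut_inv(2)[OF aut] by blast
qed (auto simp: cyc_aut_def aut_id intro: aut_comp)

lemma branch_noncyc: "z \<notin> C \<Longrightarrow> x \<in> B z \<Longrightarrow> x \<notin> C"
  using branch_cyc by blast

definition swap :: "'a \<Rightarrow> 'a \<Rightarrow> ('a \<Rightarrow> 'a) \<Rightarrow> 'a \<Rightarrow> 'a" where
  "swap x y h u = (if u \<in> B x then h u else if u \<in> B y then inv_into (B x) h u else u)"

text \<open>A noncyclic root is recognised as the point where the partial operation is
  undefined.\<close>

lemma branch_iso_root:
  assumes "branch_iso x y h" "x \<in> A" "x \<notin> C"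
  shows "h x = y"
proof (rule ccontr)
  assume "h x \<noteq> y"
  then have "\<theta> (h x) \<in> B y" using branch_step(3) branch_iso_in[OF assms(1) branch_self] by blast
  then show False
    using assms theta_notin_branch branch_self unfolding branch_iso_def by blast
qed

text \<open>Both branches hang from the same point, so exchanging them respects
  \<open>\<theta>\<close> at their roots, and disjointness makes the exchange an involution. A set
  closed under \<open>\<theta>\<close> that avoids both roots avoids both branches, since every
  branch element runs into its root.\<close>

lemma swap_aut:
  assumes x: "x \<in> A" "x \<notin> C" and y: "y \<in> A" "y \<notin> C" and eq: "\<theta> x = \<theta> y" and "x \<noteq> y"
    and h: "branch_iso x y h"
  shows "swap x y h \<in> cyc_aut" "swap x y h x = y"
    and "\<And>F z. z \<in> F \<Longrightarrow> (\<And>u. u \<in> F \<Longrightarrow> \<theta> u \<in> F) \<Longrightarrow> x \<notin> F \<Longrightarrow> y \<notin> F \<Longrightarrow> swap x y h z = z"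
proof -
  define k where "k = inv_into (B x) h"
  define g where "g = swap x y h"
  have k: "branch_iso y x k" unfolding k_def by (rule branch_iso_inv[OF h])
  have disj: "B x \<inter> B y = {}" using sibling_branches_disjoint assms(1-6) .
  have gx: "g u = h u" if "u \<in> B x" for u using that by (simp add: g_def swap_def)
  have gy: "g u = k u" if "u \<in> B y" for u using that disj by (auto simp: g_def swap_def k_def)
  have go: "g u = u" if "u \<notin> B x" "u \<notin> B y" for u using that by (simp add: g_def swap_def)
  have kh: "k (h u) = u" if "u \<in> B x" for u
    using h that by (simp add: k_def branch_iso_def bij_betw_def)
  have hk: "h (k u) = u" if "u \<in> B y" for u
    using h that by (simp add: k_def branch_iso_def bij_betw_def f_inv_into_f)
  have gg: "g (g u) = u" for u
    using gx gy go kh hk branch_iso_in[OF h] branch_iso_in[OF k] by metis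
  have gA: "g u \<in> A" if "u \<in> A" for u
    using that gx gy go branch_iso_in[OF h] branch_iso_in[OF k] branch_subset[OF x(1)] branch_subset[OF y(1)]
    by (metis subsetD)
  have bij: "bij_betw g A A"
    by (rule bij_betw_byWitness[of _ g]) (use gg gA in auto)
  have top: "g (\<theta> x) = \<theta> x"
    using go theta_notin_branch[OF x] theta_notin_branch[OF y] eq by simp
  have hx: "h x = y" using branch_iso_root[OF h x] .
  have ky: "k y = x" using branch_iso_root[OF k y] .
  have comm: "g (\<theta> u) = \<theta> (g u)" if u: "u \<in> A" for u
  proof -
    consider "u = x" | "u = y" | "u \<in> B x" "u \<noteq> x" | "u \<in> B y" "u \<noteq> y" | "u \<notin> B x" "u \<notin> B y"
      by blast
    then show ?thesis
    proof cases
      case 1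
      then show ?thesis using top gx[OF branch_self] hx eq by simp
    next
      case 2
      then show ?thesis using top gy[OF branch_self] ky eq by simp
    next
      case 3
      then show ?thesis using branch_step(3)[OF 3] h gx unfolding branch_iso_def by metis
    next
      case 4
      then show ?thesis using branch_step(3)[OF 4] k gy unfolding branch_iso_def by metis
    next
      case 5
      \<comment> \<open>Nothing outside enters a branch with noncyclic root: a noncyclic element
        mapped into it belongs to it, and a cyclic element has a cyclic image.\<close>
      have "\<theta> u \<notin> B z" if "z \<notin> C" "u \<notin> B z" for z
        using that u branch_back[of u z] branch_noncyc[of z "\<theta> u"] cyc_closed[of u] by blast
      then show ?thesis using go[of u] go[of "\<theta> u"] 5 x(2) y(2) by simp
    qed
  qed
  have "g c = c" if "c \<in> C" for c
    using go branch_noncyc x(2) y(2) that by blast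
  then show "swap x y h \<in> cyc_aut"
    using bij comm by (auto simp: cyc_aut_def algebra_automorphisms_def simp flip: g_def)
  show "swap x y h x = y" using gx[OF branch_self] hx by (simp flip: g_def)
  fix F z assume z: "z \<in> F" and F: "\<And>u. u \<in> F \<Longrightarrow> \<theta> u \<in> F" "x \<notin> F" "y \<notin> F"
  have iter: "(\<theta> ^^ n) z \<in> F" for n by (induct n) (use z F(1) in auto)
  have "z \<notin> B x" "z \<notin> B y" using branch_funpow iter F(2,3) by metis+
  then show "swap x y h z = z" using go by (simp flip: g_def)
qed

text \<open>Each new element outside the cycle is attached directly to the part already enumerated.\<close>

inductive goodseq :: "'a list \<Rightarrow> bool" where
  Nil: "goodseq []"
| snoc: "goodseq xs \<Longrightarrow> x \<in> A \<Longrightarrow> x \<in> C \<or> \<theta> x \<in> C \<union> set xs \<Longrightarrow> goodseq (xs @ [x])"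

lemma goodseq_subset: "goodseq xs \<Longrightarrow> set xs \<subseteq> A"
  by (induct rule: goodseq.induct) auto

lemma goodseq_closed: "goodseq xs \<Longrightarrow> u \<in> C \<union> set xs \<Longrightarrow> \<theta> u \<in> C \<union> set xs"
  by (induct rule: goodseq.induct) (auto simp: cyc_closed)

lemma goodseq_snocD:
  assumes "goodseq (xs @ [x])"
  shows "goodseq xs" "x \<in> A" "x \<in> C \<or> \<theta> x \<in> C \<union> set xs"
  using assms by (auto elim: goodseq.cases)

lemma goodseq_map: "goodseq xs \<Longrightarrow> g \<in> cyc_aut \<Longrightarrow> goodseq (map g xs)"
proof (induct rule: goodseq.induct)
  case Nil
  show ?case by (simp add: goodseq.Nil)
next
  case (snoc xs x)
  have g: "g \<in> AUT" "\<And>c. c \<in> C \<Longrightarrow> g c = c" using snoc(5) by (auto simp: cyc_aut_def)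
  have "g x \<in> C \<or> \<theta> (g x) \<in> C \<union> set (map g xs)"
    using snoc(4) aut_commute[OF g(1) snoc(3), symmetric] g(2) by auto
  then show ?case using snoc aut_in[OF g(1)] by (auto intro: goodseq.snoc)
qed

text \<open>Up to \<open>cyc_aut\<close> an enumeration \<open>r\<close> has finitely many
  extensions by one element: the new element is cyclic, repeats an old one, or is a new child of a
  cyclic or old point \<open>f\<close> with a branch of one of finitely many kinds \<open>t\<close>.
  New children with equal \<open>f\<close> and \<open>t\<close> are exchanged by a swap that fixes
  \<open>r\<close>.\<close>

lemma goodseq_orbits:
  assumes T: "finite T" "\<And>x. x \<in> A \<Longrightarrow> \<exists>t\<in>T. \<exists>h. branch_iso t x h" and finC: "finite C"
  shows "\<exists>R. finite R \<and> (\<forall>r\<in>R. goodseq r \<and> length r = n) \<and>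
    (\<forall>xs. goodseq xs \<longrightarrow> length xs = n \<longrightarrow> (\<exists>r\<in>R. \<exists>g\<in>cyc_aut. map g r = xs))"
proof (induct n)
  case 0
  have "id \<in> cyc_aut" using acts_on_cyc_aut by (simp add: acts_on_def)
  then show ?case by (intro exI[of _ "{[]}"]) (auto intro: goodseq.Nil)
next
  case (Suc n)
  then obtain R where R: "finite R" "\<And>r. r \<in> R \<Longrightarrow> goodseq r \<and> length r = n"
    "\<And>xs. goodseq xs \<Longrightarrow> length xs = n \<Longrightarrow> \<exists>r\<in>R. \<exists>g\<in>cyc_aut. map g r = xs"
    by blast
  define child where "child r f t u \<longleftrightarrow> u \<in> A - (C \<union> set r) \<and> \<theta> u = f \<and> (\<exists>h. branch_iso t u h)"
    for r f t u
  \<comment> \<open>One chosen child for each parent and kind of branch; if there is none, the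
    arbitrary value does no harm, as \<open>R'\<close> keeps only good sequences.\<close>
  define w where "w r f t = (SOME u. child r f t u)" for r f t
  have w: "child r f t (w r f t)" if "child r f t u" for r f t u
    unfolding w_def using that by (rule someI)
  define E where "E r = C \<union> set r \<union> (\<lambda>(f, t). w r f t) ` ((C \<union> set r) \<times> T)" for r
  have finE: "finite (E r)" for r using finC T(1) by (simp add: E_def)
  define R' where "R' = {s \<in> (\<Union>r\<in>R. (\<lambda>u. r @ [u]) ` E r). goodseq s}"
  have finR': "finite R'" using R(1) finE by (simp add: R'_def)
  have R': "goodseq r \<and> length r = Suc n" if "r \<in> R'" for r
    using that R(2) by (auto simp: R'_def)
  have "\<exists>r\<in>R'. \<exists>g\<in>cyc_aut. map g r = xs" if good: "goodseq xs" and len: "length xs = Suc n" for xs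
  proof -
    obtain ys x where xs: "xs = ys @ [x]" using len by (cases xs rule: rev_cases) auto
    note snoc = goodseq_snocD[OF good[unfolded xs]]
    obtain r g where r: "r \<in> R" and g: "g \<in> cyc_aut" "map g r = ys"
      using R(3)[OF snoc(1)] len xs by auto
    have rA: "set r \<subseteq> A" using R(2)[OF r] goodseq_subset by blast
    obtain g' where g': "g' \<in> cyc_aut" "\<And>x. x \<in> A \<Longrightarrow> g' (g x) = x"
      "\<And>xs. set xs \<subseteq> A \<Longrightarrow> map g' (map g xs) = xs"
      using acts_on_inverse[OF acts_on_cyc_aut g(1)] by blast
    \<comment> \<open>This inverse of \<open>g'\<close> shows that \<open>g'\<close> is injective on
      \<open>A\<close>, which yields \<open>g x' = x\<close> below.\<close>
    obtain g'' where g'': "g'' \<in> cyc_aut" "\<And>x. x \<in> A \<Longrightarrow> g'' (g' x) = x"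
      using acts_on_inverse[OF acts_on_cyc_aut g'(1)] by blast
    \<comment> \<open>The problem is pulled back to the representative: \<open>x'\<close> extends
      \<open>r\<close> as \<open>x\<close> extends \<open>ys\<close>.\<close>
    define x' where "x' = g' x"
    have x'A: "x' \<in> A" using cyc_aut_in[OF g'(1) snoc(2)] by (simp add: x'_def)
    have gx': "g x' = x"
    proof -
      have "g' (g x') = g' x" using g'(2)[OF x'A] by (simp add: x'_def)
      then show ?thesis using g''(2) snoc(2) cyc_aut_in[OF g(1) x'A] by metis
    qed
    have "map g' (ys @ [x]) = r @ [x']" using g'(3)[OF rA] g(2) by (simp add: x'_def)
    then have good': "goodseq (r @ [x'])"
      using goodseq_map[OF good[unfolded xs] g'(1)] by simp
    note snoc' = goodseq_snocD[OF good']
    show ?thesis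
    proof (cases "x' \<in> C \<union> set r")
      case True
      then have "r @ [x'] \<in> R'" using r good' by (auto simp: R'_def E_def)
      moreover have "map g (r @ [x']) = xs" using g(2) gx' xs by simp
      ultimately show ?thesis using g(1) by blast
    next
      case False
      then have f: "\<theta> x' \<in> C \<union> set r" using snoc'(3) by blast
      obtain t k where t: "t \<in> T" "branch_iso t x' k" using T(2)[OF x'A] by blast
      have "child r (\<theta> x') t x'" using False x'A t(2) by (auto simp: child_def)
      then have c: "child r (\<theta> x') t (w r (\<theta> x') t)" by (rule w)
      define u where "u = w r (\<theta> x') t"
      have u: "u \<in> A" "u \<notin> C \<union> set r" "\<theta> u = \<theta> x'" using c by (auto simp: child_def u_def)
      obtain l where "branch_iso t u l" using c by (auto simp: child_def u_def)
      then obtain h where h: "branch_iso u x' h"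
        using branch_iso_comp branch_iso_inv t(2) by blast
      have "u \<in> E r" using f t(1) by (force simp: E_def u_def)
      moreover have "goodseq (r @ [u])" using snoc'(1) u f by (auto intro: goodseq.snoc)
      ultimately have uR: "r @ [u] \<in> R'" using r by (auto simp: R'_def)
      have "\<exists>s\<in>cyc_aut. s u = x' \<and> map s r = r"
      proof (cases "u = x'")
        case True
        then show ?thesis using acts_on_cyc_aut by (intro bexI[of _ id]) (auto simp: acts_on_def)
      next
        case ne: False
        have uC: "u \<notin> C" "x' \<notin> C" using u(2) False by auto
        note sw = swap_aut[OF u(1) uC(1) x'A uC(2) u(3) ne h]
        \<comment> \<open>\<open>C \<union> set r\<close> is closed under \<open>\<theta>\<close>
          and contains neither root, so the swap does not move \<open>r\<close>.\<close>
        have "swap u x' h z = z" if "z \<in> set r" for z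
          using sw(3)[of z "C \<union> set r"] that goodseq_closed[OF snoc'(1)] u(2) False by blast
        then show ?thesis using sw(1,2) by (intro bexI[of _ "swap u x' h"]) (auto intro: map_idI)
      qed
      then obtain s where s: "s \<in> cyc_aut" "s u = x'" "map s r = r" by blast
      have "map (g \<circ> s) (r @ [u]) = map g (map s r @ [s u])" by simp
      then have "map (g \<circ> s) (r @ [u]) = xs" using s g(2) gx' xs by simp
      moreover have "g \<circ> s \<in> cyc_aut" using acts_on_cyc_aut g(1) s(1) by (simp add: acts_on_def)
      ultimately show ?thesis using uR by blast
    qed
  qed
  then show ?case using finR' R' by blast
qed

text \<open>Listing the iterates from the cyclic end \<open>(\<theta> ^^ N) x\<close> down to
  \<open>x\<close> puts every element but the first after its image.\<close>

lemma goodseq_block: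
  assumes "goodseq ys" "x \<in> A" "(\<theta> ^^ N) x \<in> C"
  shows "k \<le> Suc N \<Longrightarrow> goodseq (ys @ map (\<lambda>i. (\<theta> ^^ (N - i)) x) [0..<k])"
proof (induct k)
  case (Suc k)
  have "(\<theta> ^^ (N - k)) x \<in> C \<or>
      \<theta> ((\<theta> ^^ (N - k)) x) \<in> C \<union> set (ys @ map (\<lambda>i. (\<theta> ^^ (N - i)) x) [0..<k])"
  proof (cases k)
    case 0
    then show ?thesis using assms(3) by simp
  next
    case (Suc j)
    then have "N - j = Suc (N - k)" using \<open>Suc k \<le> Suc N\<close> by simp
    then have "\<theta> ((\<theta> ^^ (N - k)) x) = (\<theta> ^^ (N - j)) x" by simp
    moreover have "j \<in> set [0..<k]" using Suc by simp
    ultimately have "\<theta> ((\<theta> ^^ (N - k)) x) \<in> set (map (\<lambda>i. (\<theta> ^^ (N - i)) x) [0..<k])"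
      unfolding set_map by (rule image_eqI)
    then show ?thesis by simp
  qed
  then have "goodseq ((ys @ map (\<lambda>i. (\<theta> ^^ (N - i)) x) [0..<k]) @ [(\<theta> ^^ (N - k)) x])"
    using Suc by (intro goodseq.snoc funpow_closed[OF assms(2)]) simp_all
  then show ?case by simp
qed (use assms in simp)

text \<open>The height bound lets each entry be replaced by a block of exactly \<open>Suc N\<close>
  elements, repetitions allowed, so all \<open>n\<close>-tuples come from good sequences of one
  fixed length.\<close>

lemma covers_tuples_cyc_aut:
  assumes T: "finite T" "\<And>x. x \<in> A \<Longrightarrow> \<exists>t\<in>T. \<exists>h. branch_iso t x h" and finC: "finite C"
    and N: "\<And>x. x \<in> A \<Longrightarrow> (\<theta> ^^ N) x \<in> C"
  shows "\<exists>R. covers_tuples cyc_aut A n R"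
proof -
  \<comment> \<open>The entry itself closes its block, hence the offset \<open>N\<close>.\<close>
  define proj where "proj n ys = map (\<lambda>j. ys ! (j * Suc N + N)) [0..<n]" for n and ys :: "'a list"
  have idx: "j * Suc N + N < n * Suc N" if "j < n" for j n
  proof -
    have "Suc j * Suc N \<le> n * Suc N" using that by (intro mult_le_mono1) simp
    then show ?thesis by simp
  qed
  have ext: "\<exists>ys. goodseq ys \<and> length ys = n * Suc N \<and> proj n ys = xs" if "xs \<in> tuples A n" for xs n
    using that
  proof (induct n arbitrary: xs)
    case 0
    then show ?case by (intro exI[of _ "[]"]) (auto simp: proj_def tuples_def goodseq.Nil)
  next
    case (Suc n)
    obtain us x where xs: "xs = us @ [x]" "us \<in> tuples A n" "x \<in> A"
      using tuples_Suc_cases[OF Suc(2)] by metis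
    obtain ys where ys: "goodseq ys" "length ys = n * Suc N" "proj n ys = us"
      using Suc(1)[OF xs(2)] by blast
    define zs where "zs = ys @ map (\<lambda>i. (\<theta> ^^ (N - i)) x) [0..<Suc N]"
    have "goodseq zs" unfolding zs_def by (rule goodseq_block[OF ys(1) xs(3) N[OF xs(3)] order_refl])
    moreover have "length zs = Suc n * Suc N" using ys(2) by (simp add: zs_def)
    moreover have "proj (Suc n) zs = xs"
    proof -
      have "zs ! (j * Suc N + N) = ys ! (j * Suc N + N)" if "j < n" for j
        using idx[OF that] ys(2) unfolding zs_def by (simp only: nth_append) simp
      then have "proj n zs = us" using ys(3) by (auto simp: proj_def)
      moreover have "zs ! (n * Suc N + N) = x"
        unfolding zs_def ys(2)[symmetric] nth_append_length_plus by (simp add: nth_append)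
      ultimately show ?thesis by (simp add: proj_def xs(1))
    qed
    ultimately show ?case by blast
  qed
  obtain R where R: "finite R" "\<And>r. r \<in> R \<Longrightarrow> goodseq r \<and> length r = n * Suc N"
    "\<And>xs. goodseq xs \<Longrightarrow> length xs = n * Suc N \<Longrightarrow> \<exists>r\<in>R. \<exists>g\<in>cyc_aut. map g r = xs"
    using goodseq_orbits[OF T finC, of "n * Suc N"] by blast
  have "proj n ` R \<subseteq> tuples A n"
  proof (rule image_subsetI)
    fix r assume "r \<in> R"
    then have "set r \<subseteq> A" "length r = n * Suc N" using R(2) goodseq_subset by auto
    then have "r ! (j * Suc N + N) \<in> A" if "j < n" for j using idx[OF that] by (metis nth_mem subsetD)
    then show "proj n r \<in> tuples A n" by (auto simp: proj_def tuples_def)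
  qed
  moreover have "\<exists>s\<in>proj n ` R. \<exists>g\<in>cyc_aut. map g s = xs" if xs: "xs \<in> tuples A n" for xs
  proof -
    obtain ys where ys: "goodseq ys" "length ys = n * Suc N" "proj n ys = xs" using ext[OF xs] by blast
    then obtain r g where r: "r \<in> R" "g \<in> cyc_aut" "map g r = ys" using R(3) by blast
    have "length r = n * Suc N" using R(2) r(1) by blast
    then have "map g (proj n r) = proj n (map g r)" using idx by (auto simp: proj_def)
    then show ?thesis using r ys(3) by blast
  qed
  ultimately show ?thesis using R(1) by (intro exI[of _ "proj n ` R"]) (simp add: covers_tuples_def)
qed

text \<open>Representatives for the smaller group serve the larger one; as \<open>cyc_aut\<close>
  moves no point of \<open>A\<close> from outside into \<open>X\<close>, the representatives not
  inside \<open>X\<close> can be discarded.\<close>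

lemma oligomorphic_overgroup:
  assumes cov: "\<And>n. \<exists>R. covers_tuples cyc_aut A n R"
    and "acts_on K X" "cyc_aut \<subseteq> K" "X \<subseteq> A"
    and X: "\<And>g x. g \<in> cyc_aut \<Longrightarrow> x \<in> A \<Longrightarrow> g x \<in> X \<Longrightarrow> x \<in> X"
  shows "oligomorphic K X"
  unfolding oligomorphic_iff[OF assms(2)]
proof (intro allI impI)
  fix n
  obtain R where R: "covers_tuples cyc_aut A n R" using cov by blast
  have "\<exists>r\<in>R \<inter> tuples X n. \<exists>g\<in>K. map g r = xs" if xs: "xs \<in> tuples X n" for xs
  proof -
    have "xs \<in> tuples A n" using xs assms(4) by (auto simp: tuples_def)
    then obtain r g where r: "r \<in> R" "r \<in> tuples A n" "g \<in> cyc_aut" "map g r = xs"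
      using covers_tuplesE[OF R] by metis
    then have "r \<in> tuples X n" using xs X[OF r(3)] by (auto simp: tuples_def subset_iff)
    then show ?thesis using r assms(3) by blast
  qed
  then show "\<exists>R. covers_tuples K X n R"
    using R by (intro exI[of _ "R \<inter> tuples X n"]) (simp add: covers_tuples_def)
qed

section \<open>Extending automorphisms of a branch\<close>

definition extend :: "'a \<Rightarrow> ('a \<Rightarrow> 'a) \<Rightarrow> 'a \<Rightarrow> 'a" where
  "extend c g u = (if u \<in> B c then g u else u)"

text \<open>At the root commutation comes for free, since the whole cycle is fixed pointwise;
  elsewhere a noncyclic element whose image lies in \<open>B c\<close> lies in \<open>B c\<close>
  itself.\<close>

lemma extend_aut:
  assumes c: "c \<in> C" and bij: "bij_betw g (B c) (B c)" and gc: "g c = c"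
    and comm: "\<And>x. x \<in> B c \<Longrightarrow> x \<noteq> c \<Longrightarrow> g (\<theta> x) = \<theta> (g x)"
  shows "extend c g \<in> AUT"
proof -
  have sub: "B c \<subseteq> A" using branch_subset c cyc_subset by blast
  have "bij_betw (extend c g) (B c) (B c)"
    using bij by (subst bij_betw_cong[of _ _ g]) (auto simp: extend_def)
  moreover have "bij_betw (extend c g) (A - B c) (A - B c)"
    by (subst bij_betw_cong[of _ _ id]) (auto simp: extend_def)
  ultimately have "bij_betw (extend c g) (B c \<union> (A - B c)) (B c \<union> (A - B c))"
    by (intro bij_betw_combine) auto
  then have "bij_betw (extend c g) A A" using sub by (simp add: Un_absorb1)
  moreover have "extend c g (\<theta> x) = \<theta> (extend c g x)" if x: "x \<in> A" for x
  proof -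
    have fix_cyc: "extend c g d = d" if "d \<in> C" for d
      using that branch_cyc[of d c] gc by (auto simp: extend_def)
    show ?thesis
    proof (cases "x \<in> C")
      case True
      then show ?thesis using fix_cyc cyc_closed by simp
    next
      case False
      show ?thesis
      proof (cases "x \<in> B c")
        case True
        then show ?thesis
          using False c branch_step(3)[OF True] comm[OF True] by (auto simp: extend_def)
      next
        case out: False
        then show ?thesis using branch_back[of x c] x False by (auto simp: extend_def)
      qed
    qed
  qed
  ultimately show ?thesis by (simp add: algebra_automorphisms_def)
qed

text \<open>\<open>K c\<close> stands for either of the two groups acting on a branch, so that (2)
  and (3) are treated together. Every element lies in the branch of a cyclic point, and there are
  finitely many of these.\<close>

lemma covers_one_from_branches:
  assumes finC: "finite C" and cyc: "\<And>x. x \<in> A \<Longrightarrow> \<exists>n. (\<theta> ^^ n) x \<in> C"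
    and K: "\<And>c. c \<in> C \<Longrightarrow> acts_on (K c) (B c)" "\<And>c. c \<in> C \<Longrightarrow> oligomorphic (K c) (B c)"
    and ext: "\<And>c g. c \<in> C \<Longrightarrow> g \<in> K c \<Longrightarrow> extend c g \<in> AUT"
  shows "\<exists>R. covers_tuples AUT A 1 R"
proof -
  have "\<exists>R. covers_tuples (K c) (B c) 1 R" if "c \<in> C" for c
    using K(2)[OF that] oligomorphic_iff[OF K(1)[OF that]] by blast
  then obtain R where R: "\<And>c. c \<in> C \<Longrightarrow> covers_tuples (K c) (B c) 1 (R c)" by metis
  have BA: "tuples (B c) 1 \<subseteq> tuples A 1" if "c \<in> C" for c
    using branch_subset[of c] cyc_subset that by (auto simp: tuples_def)
  have "covers_tuples AUT A 1 (\<Union>c\<in>C. R c)"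
    unfolding covers_tuples_def
  proof (intro conjI ballI)
    show "finite (\<Union>c\<in>C. R c)" using finC R by (auto simp: covers_tuples_def)
    show "(\<Union>c\<in>C. R c) \<subseteq> tuples A 1" using R BA unfolding covers_tuples_def by blast
    fix xs assume "xs \<in> tuples A 1"
    then obtain x where x: "xs = [x]" "x \<in> A" by (auto simp: tuples_def length_Suc_conv)
    then obtain c where c: "c \<in> C" "x \<in> B c" using cyc cyc_branch_cover by blast
    then have "xs \<in> tuples (B c) 1" using x by (simp add: tuples_def)
    then obtain r g where r: "r \<in> R c" "r \<in> tuples (B c) 1" "g \<in> K c" "map g r = xs"
      using covers_tuplesE[OF R[OF c(1)]] by metis
    have "map (extend c g) r = xs"
      using r(2,4) by (auto simp: tuples_def extend_def)
    then show "\<exists>r\<in>\<Union>c\<in>C. R c. \<exists>g\<in>AUT. map g r = xs"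
      using r ext[OF c(1)] c(1) by blast
  qed
  then show ?thesis by blast
qed

lemma acts_on_branch_iso: "acts_on {g. branch_iso c c g} (B c)"
  unfolding acts_on_def
proof (intro conjI ballI)
  fix g assume "g \<in> {g. branch_iso c c g}"
  then have g: "branch_iso c c g" by simp
  then show "g ` B c \<subseteq> B c" using branch_iso_in by blast
  have "\<forall>x\<in>B c. inv_into (B c) g (g x) = x" using g by (simp add: branch_iso_def bij_betw_def)
  then show "\<exists>g'\<in>{g. branch_iso c c g}. \<forall>x\<in>B c. g' (g x) = x" using branch_iso_inv[OF g] by blast
qed (auto simp: branch_iso_id intro: branch_iso_comp)

lemma branch_iso_extend:
  assumes c: "c \<in> C" and g: "branch_iso c c g"
  shows "extend c g \<in> AUT"
proof (rule extend_aut[OF c])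
  show "bij_betw g (B c) (B c)" using g by (simp add: branch_iso_def)
  show "g (\<theta> x) = \<theta> (g x)" if "x \<in> B c" "x \<noteq> c" for x
    using g branch_step(3)[OF that] that(1) by (simp add: branch_iso_def)
  have gc: "g c \<in> B c" using branch_iso_in[OF g branch_self] .
  show "g c = c"
  \<comment> \<open>The partial operation is defined at \<open>c\<close> only if \<open>c\<close> is
    a fixed point; then \<open>g c\<close> is one too, hence cyclic. Otherwise \<open>c\<close> is
    the only point where it is undefined.\<close>
  proof (cases "\<theta> c \<in> B c")
    case True
    then have "\<theta> c = c" using branch_cyc cyc_closed c by blast
    then have "\<theta> (g c) = g c" using g branch_self[of c] by (auto simp: branch_iso_def)
    moreover have "g c \<in> A" using gc branch_subset c cyc_subset by blast
    ultimately have "g c \<in> C" by (auto simp: cyc_def intro!: exI[of _ 1])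
    then show ?thesis using branch_cyc gc by blast
  next
    case False
    then have "\<theta> (g c) \<notin> B c" using g branch_self[of c] by (simp add: branch_iso_def)
    then show ?thesis using branch_step(3)[OF gc] by blast
  qed
qed

section \<open>The order on a branch\<close>

definition branch_le :: "'a \<Rightarrow> 'a \<Rightarrow> bool" where
  "branch_le x y \<longleftrightarrow> (\<exists>k. (\<theta> ^^ k) y = x)"

definition order_iso :: "'a \<Rightarrow> ('a \<Rightarrow> 'a) \<Rightarrow> bool" where
  "order_iso c h \<longleftrightarrow> bij_betw h (B c) (B c) \<and>
     (\<forall>x\<in>B c. \<forall>y\<in>B c. branch_le x y \<longleftrightarrow> branch_le (h x) (h y))"

lemma automorphisms_order_struc:
  "{h. isomorphism order_sig (order_struc A \<theta> c) (order_struc A \<theta> c) h} = {h. order_iso c h}"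
proof -
  have "isomorphism order_sig (order_struc A \<theta> c) (order_struc A \<theta> c) h \<longleftrightarrow>
      bij_betw h (B c) (B c) \<and> (\<forall>xs. length xs = 2 \<and> set xs \<subseteq> B c \<longrightarrow>
        (branch_le (xs ! 0) (xs ! 1) \<longleftrightarrow> branch_le (map h xs ! 0) (map h xs ! 1)))" for h
    by (simp add: isomorphism_def order_sig_def order_struc_def branch_le_def)
  moreover have "(\<forall>xs. length xs = 2 \<and> set xs \<subseteq> B c \<longrightarrow>
        (branch_le (xs ! 0) (xs ! 1) \<longleftrightarrow> branch_le (map h xs ! 0) (map h xs ! 1))) \<longleftrightarrow>
      (\<forall>x\<in>B c. \<forall>y\<in>B c. branch_le x y \<longleftrightarrow> branch_le (h x) (h y))" (is "?l \<longleftrightarrow> ?r") for h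
  proof
    show "?l \<Longrightarrow> ?r"
    proof (intro ballI)
      fix x y assume l: ?l and "x \<in> B c" "y \<in> B c"
      then show "branch_le x y \<longleftrightarrow> branch_le (h x) (h y)" using spec[OF l, of "[x, y]"] by simp
    qed
    show "?r \<Longrightarrow> ?l" by (auto simp: length_Suc_conv numeral_2_eq_2)
  qed
  ultimately show ?thesis by (simp add: order_iso_def)
qed

lemma is_structure_order: "is_structure order_sig (order_struc A \<theta> c)"
  using branch_self by (auto simp: is_structure_def order_sig_def order_struc_def)

lemma acts_on_order_iso: "acts_on {h. order_iso c h} (B c)"
  using acts_on_automorphisms[OF is_structure_order, of c]
  unfolding automorphisms_order_struc by (simp add: order_struc_def)

lemma omega_categorical_order_iff:
  assumes "countable (B c)"
  shows "omega_categorical order_sig (order_struc A \<theta> c) \<longleftrightarrow> oligomorphic {h. order_iso c h} (B c)"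
  using assms unfolding ryll_nardzewski automorphisms_order_struc
  by (simp add: is_structure_order) (simp add: order_struc_def)

text \<open>Distinct points below each other would lie on a cycle, and a branch meets the cycle only
  in its root.\<close>

lemma branch_le_antisym:
  assumes "c \<in> C" "x \<in> B c" "y \<in> B c" "branch_le x y" "branch_le y x"
  shows "x = y"
proof -
  obtain k m where k: "(\<theta> ^^ k) y = x" and m: "(\<theta> ^^ m) x = y"
    using assms(4,5) by (auto simp: branch_le_def)
  show ?thesis
  proof (cases k)
    case 0
    then show ?thesis using k by simp
  next
    case (Suc j)
    have "(\<theta> ^^ (k + m)) x = x" using k m by (simp add: funpow_add)
    moreover have "x \<in> A" using assms(1,2) branch_subset cyc_subset by blast
    ultimately have "x \<in> C" using Suc by (auto simp: cyc_def intro!: exI[of _ "k + m"])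
    moreover from this have "y \<in> C" using funpow_cyc[of x m] m by simp
    ultimately show ?thesis using branch_cyc assms by blast
  qed
qed

lemma theta_neq:
  assumes "c \<in> C" "x \<in> B c" "x \<noteq> c"
  shows "\<theta> x \<noteq> x"
proof
  assume "\<theta> x = x"
  then have "x \<in> C" using branch_step(1)[OF assms(2,3)] by (auto simp: cyc_def intro!: exI[of _ 1])
  then show False using branch_step(2)[OF assms(2,3)] by simp
qed

text \<open>Away from the root, \<open>\<theta> x\<close> is the unique lower cover of \<open>x\<close>.\<close>

lemma branch_le_theta: "branch_le y x \<Longrightarrow> y \<noteq> x \<Longrightarrow> branch_le y (\<theta> x)"
proof -
  assume y: "branch_le y x" "y \<noteq> x"
  then obtain k where k: "(\<theta> ^^ k) x = y" by (auto simp: branch_le_def)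
  then obtain j where "k = Suc j" using y(2) by (cases k) auto
  then show ?thesis using k by (auto simp: branch_le_def funpow_swap1)
qed

lemma theta_branch_le: "branch_le (\<theta> x) x"
  unfolding branch_le_def by (rule exI[of _ 1]) simp

text \<open>The root is fixed as the least element. Away from it, \<open>h (\<theta> x)\<close> and
  \<open>\<theta> (h x)\<close> lie below each other, each because everything strictly below a point
  is below its image; for one direction \<open>\<theta> (h x)\<close> is first written as
  \<open>h y\<close>.\<close>

lemma order_iso_extend:
  assumes c: "c \<in> C" and h: "order_iso c h"
  shows "extend c h \<in> AUT"
proof -
  have bij: "bij_betw h (B c) (B c)"
    and le: "\<And>x y. x \<in> B c \<Longrightarrow> y \<in> B c \<Longrightarrow> branch_le (h x) (h y) \<longleftrightarrow> branch_le x y"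
    using h by (auto simp: order_iso_def)
  have hB: "h x \<in> B c" if "x \<in> B c" for x using bij that by (auto simp: bij_betw_def)
  have inj: "h x = h y \<longleftrightarrow> x = y" if "x \<in> B c" "y \<in> B c" for x y
    using bij that by (auto simp: bij_betw_def inj_on_def)
  have surj: "\<exists>x\<in>B c. h x = y" if "y \<in> B c" for y using bij that by (force simp: bij_betw_def)
  have least: "branch_le c x" if "x \<in> B c" for x using branch_funpow[OF that] by (simp add: branch_le_def)
  have hc: "h c = c"
  proof -
    obtain y where y: "y \<in> B c" "h y = c" using surj[OF branch_self] by blast
    have "branch_le (h c) c" using le[OF branch_self y(1)] least[OF y(1)] y(2) by simp
    then show ?thesis using branch_le_antisym[OF c] least hB branch_self by blast
  qed
  show ?thesis
  proof (rule extend_aut[OF c bij hc])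
    fix x assume x: "x \<in> B c" "x \<noteq> c"
    note tx = branch_step(3)[OF x]
    have hx: "h x \<in> B c" "h x \<noteq> c" using hB[OF x(1)] inj[OF x(1) branch_self] hc x(2) by auto
    note thx = branch_step(3)[OF hx]
    obtain y where y: "y \<in> B c" "h y = \<theta> (h x)" using surj[OF thx] by blast
    have "branch_le (h (\<theta> x)) (\<theta> (h x))"
      using branch_le_theta le[OF tx x(1)] theta_branch_le inj[OF tx x(1)] theta_neq[OF c x] by blast
    moreover have "branch_le y x" using le[OF y(1) x(1)] theta_branch_le y(2) by metis
    then have "branch_le y (\<theta> x)"
      using branch_le_theta inj[OF y(1) x(1)] y(2) theta_neq[OF c hx] by metis
    then have "branch_le (\<theta> (h x)) (h (\<theta> x))" using le[OF y(1) tx] y(2) by simp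
    ultimately show "h (\<theta> x) = \<theta> (h x)"
      using branch_le_antisym[OF c hB[OF tx] thx] by blast
  qed
qed

lemma cyc_aut_branch_iso: "g \<in> cyc_aut \<Longrightarrow> c \<in> C \<Longrightarrow> branch_iso c c g"
  using aut_branch_iso[of g c] cyc_subset by (auto simp: cyc_aut_def)

lemma cyc_aut_order_iso:
  assumes g: "g \<in> cyc_aut" and c: "c \<in> C"
  shows "order_iso c g"
proof -
  have aut: "g \<in> AUT" using g by (simp add: cyc_aut_def)
  have sub: "B c \<subseteq> A" using branch_subset c cyc_subset by blast
  have "branch_le x y \<longleftrightarrow> branch_le (g x) (g y)" if "x \<in> B c" "y \<in> B c" for x y
  proof -
    have "x \<in> A" "y \<in> A" using that sub by auto
    then have "(\<theta> ^^ k) (g y) = g x \<longleftrightarrow> (\<theta> ^^ k) y = x" for k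
      using aut_inj[OF aut funpow_closed] by (simp add: aut_funpow[OF aut, symmetric])
    then show ?thesis by (simp add: branch_le_def)
  qed
  then show ?thesis using cyc_aut_branch_iso[OF assms] by (simp add: order_iso_def branch_iso_def)
qed

lemma cyc_aut_branch:
  assumes "g \<in> cyc_aut" "c \<in> C" "x \<in> A" "g x \<in> B c"
  shows "x \<in> B c"
  using assms aut_branch_iff[of g c x] cyc_subset by (auto simp: cyc_aut_def)

text \<open>Pigeonhole on orbits of pairs: for some \<open>i < j\<close> the pairs of
  \<open>x\<close> with its \<open>i\<close>-th and \<open>j\<close>-th iterates share a
  representative \<open>[u, v]\<close>. Then \<open>v\<close> is both the \<open>i\<close>-th and
  the \<open>j\<close>-th iterate of \<open>u\<close>, and this coincidence is carried back to
  \<open>x\<close>.\<close>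

lemma oligomorphic_imp_locally_finite:
  assumes "oligomorphic AUT A"
  shows "locally_finite A \<theta>"
  unfolding locally_finite_iff
proof
  fix x assume x: "x \<in> A"
  obtain R where R: "covers_tuples AUT A 2 R"
    using assms oligomorphic_iff[OF acts_on_aut] by fastforce
  have "\<exists>r\<in>R. \<exists>g\<in>AUT. map g r = [x, (\<theta> ^^ i) x]" for i
  proof -
    have "[x, (\<theta> ^^ i) x] \<in> tuples A 2" using x funpow_closed[OF x] by (simp add: tuples_def)
    then show ?thesis using covers_tuplesE[OF R] by metis
  qed
  then obtain r g where rg: "\<And>i. r i \<in> R" "\<And>i. g i \<in> AUT" "\<And>i. map (g i) (r i) = [x, (\<theta> ^^ i) x]"
    by metis
  have "finite (range r)" using R rg(1) by (auto simp: covers_tuples_def intro: finite_subset)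
  then have "\<not> inj r" using range_inj_infinite by blast
  then obtain i j where ij: "r i = r j" "i < j" unfolding inj_def by (metis linorder_neqE_nat)
  have "r i \<in> tuples A 2" using R rg(1) by (auto simp: covers_tuples_def)
  then obtain u v where uv: "r i = [u, v]" "u \<in> A" "v \<in> A"
    by (auto simp: tuples_def numeral_2_eq_2 length_Suc_conv)
  have v: "v = (\<theta> ^^ k) u" if "r k = [u, v]" for k
  proof -
    have "g k v = g k ((\<theta> ^^ k) u)"
      using rg(3)[of k] that aut_funpow[OF rg(2) uv(2), of k k] by simp
    then show ?thesis using aut_inj[OF rg(2) uv(3) funpow_closed[OF uv(2)]] by blast
  qed
  have "(\<theta> ^^ i) u = (\<theta> ^^ j) u" using v[of i] v[of j] uv(1) ij(1) by simp
  then have "(\<theta> ^^ i) x = (\<theta> ^^ j) x"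
    using rg(3)[of i] uv(1) aut_funpow[OF rg(2) uv(2)] by (metis list.inject list.simps(9))
  then show "\<exists>n. (\<theta> ^^ n) x \<in> C" using cyc_if_funpow_eq[OF x _ ij(2)] by blast
qed

text \<open>Automorphisms preserve the exponents that lead into the cycle and the isomorphism type
  of branches, so finitely many orbit representatives decide both.\<close>

lemma finite_orbits_imp_finite_branches:
  assumes lf: "locally_finite A \<theta>" and R: "covers_tuples AUT A 1 R"
  shows "\<exists>n. \<forall>x\<in>A. (\<theta> ^^ n) x \<in> C" "finite_up_to_iso (branch_algebra A \<theta> ` A)"
proof -
  define T where "T = hd ` R"
  have T: "finite T" "T \<subseteq> A" using R by (auto simp: T_def covers_tuples_def tuples_def length_Suc_conv)
  have cov: "\<exists>t\<in>T. \<exists>g\<in>AUT. g t = x" if "x \<in> A" for x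
  proof -
    have "[x] \<in> tuples A 1" using that by (simp add: tuples_def)
    then obtain r g where r: "r \<in> R" "r \<in> tuples A 1" "g \<in> AUT" "map g r = [x]"
      using covers_tuplesE[OF R] by metis
    then have "hd r \<in> T" "g (hd r) = x" by (auto simp: T_def tuples_def length_Suc_conv)
    then show ?thesis using r(3) by blast
  qed
  have "\<forall>t\<in>T. \<exists>n. (\<theta> ^^ n) t \<in> C" using lf T(2) by (auto simp: locally_finite_iff)
  then obtain n where n: "\<And>t. t \<in> T \<Longrightarrow> (\<theta> ^^ n t) t \<in> C" by metis
  define N where "N = Max (n ` T)"
  have "(\<theta> ^^ N) x \<in> C" if x: "x \<in> A" for x
  proof -
    obtain t g where t: "t \<in> T" "g \<in> AUT" "g t = x" using cov x by blast
    have "n t \<le> N" using t(1) T(1) by (simp add: N_def)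
    then have "(\<theta> ^^ N) t \<in> C" using n[OF t(1)] funpow_cyc_mono by blast
    then show ?thesis
      using t aut_cyc[OF t(2)] aut_funpow[OF t(2)] funpow_closed T(2) by (metis subsetD)
  qed
  then show "\<exists>n. \<forall>x\<in>A. (\<theta> ^^ n) x \<in> C" by blast
  have "\<exists>t\<in>T. \<exists>h. branch_iso t x h" if x: "x \<in> A" for x
  proof -
    obtain t g where t: "t \<in> T" "g \<in> AUT" "g t = x" using cov x by blast
    then show ?thesis using aut_branch_iso[OF t(2), of t] T(2) by blast
  qed
  then show "finite_up_to_iso (branch_algebra A \<theta> ` A)"
    unfolding finite_up_to_iso_iff using T by blast
qed

section \<open>The cycle of a connected algebra\<close>

lemma connected_cyclic:
  assumes "connected_algebra A \<theta>" "C \<noteq> {}" "x \<in> A"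
  shows "\<exists>n. (\<theta> ^^ n) x \<in> C"
proof -
  obtain c where c: "c \<in> C" using assms(2) by blast
  then obtain n m where "(\<theta> ^^ n) x = (\<theta> ^^ m) c"
    using assms(1,3) cyc_subset unfolding connected_algebra_def by blast
  then show ?thesis using funpow_cyc[OF c] by metis
qed

lemma connected_finite_cyc:
  assumes "connected_algebra A \<theta>"
  shows "finite C"
proof (cases "C = {}")
  case False
  then obtain c where c: "c \<in> C" by blast
  have "C \<subseteq> range (\<lambda>k. (\<theta> ^^ k) c)"
  proof
    fix d assume d: "d \<in> C"
    then obtain n m where nm: "(\<theta> ^^ n) d = (\<theta> ^^ m) c"
      using assms c cyc_subset unfolding connected_algebra_def by blast
    obtain p where p: "p \<ge> 1" "(\<theta> ^^ p) d = d" using d by (auto simp: cyc_def)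
    \<comment> \<open>\<open>n * p\<close> is a multiple of the period of \<open>d\<close> and at
      least \<open>n\<close>, so iterating further from \<open>(\<theta> ^^ n) d\<close> leads back
      to \<open>d\<close>.\<close>
    have le: "n \<le> n * p" using p(1) by simp
    have "d = (\<theta> ^^ (n * p)) d" using funpow_mod_eq[OF p(2), of "n * p"] by simp
    also have "\<dots> = (\<theta> ^^ (n * p - n)) ((\<theta> ^^ n) d)" using le by (simp add: funpow_funpow)
    also have "\<dots> = (\<theta> ^^ (n * p - n + m)) c" by (simp add: nm funpow_funpow)
    finally show "d \<in> range (\<lambda>k. (\<theta> ^^ k) c)" by blast
  qed
  moreover have "finite (range (\<lambda>k. (\<theta> ^^ k) c))" using finite_funpow_orbit[of 0 c] c by simp
  ultimately show ?thesis by (rule finite_subset)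
qed simp

end

theorem theorem5p9:
  fixes A :: "'a set" and \<theta> :: "'a \<Rightarrow> 'a"
  assumes "monounary_algebra A \<theta>"
    and "countable A"
    and "connected_algebra A \<theta>"
  shows "let
      S1 = omega_categorical monounary_sig (algebra_struc A \<theta>);
      S2 = (cyc A \<theta> \<noteq> {} \<and>
            (\<forall>c\<in>cyc A \<theta>. partial_omega_categorical (branch_algebra A \<theta> c)));
      S3 = (cyc A \<theta> \<noteq> {} \<and>
            (\<forall>c\<in>cyc A \<theta>. omega_categorical order_sig (order_struc A \<theta> c)));
      S4 = (algebra_height A \<theta> \<noteq> \<infinity> \<and>
            finite_up_to_iso (branch_algebra A \<theta> ` A));
      S5 = (locally_finite A \<theta> \<and> finite (one_orbits A \<theta>))
    in (S1 \<longleftrightarrow> S2) \<and> (S2 \<longleftrightarrow> S3) \<and> (S3 \<longleftrightarrow> S4) \<and> (S4 \<longleftrightarrow> S5)"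
proof -
  interpret monounary A \<theta> by unfold_locales (rule assms(1))
  have sub: "B c \<subseteq> A" if "c \<in> C" for c using branch_subset cyc_subset that by blast
  have cnt: "countable (B c)" if "c \<in> C" for c using sub[OF that] assms(2) countable_subset by blast
  have finC: "finite C" using connected_finite_cyc[OF assms(3)] .
  define S1 where "S1 = oligomorphic AUT A"
  define S2 where "S2 \<longleftrightarrow> C \<noteq> {} \<and> (\<forall>c\<in>C. oligomorphic {g. branch_iso c c g} (B c))"
  define S3 where "S3 \<longleftrightarrow> C \<noteq> {} \<and> (\<forall>c\<in>C. oligomorphic {h. order_iso c h} (B c))"
  define S4 where "S4 \<longleftrightarrow> algebra_height A \<theta> \<noteq> \<infinity> \<and> finite_up_to_iso (branch_algebra A \<theta> ` A)"
  define S5 where "S5 \<longleftrightarrow> locally_finite A \<theta> \<and> finite (one_orbits A \<theta>)"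
  have S1: "omega_categorical monounary_sig (algebra_struc A \<theta>) = S1"
    unfolding S1_def by (rule omega_categorical_algebra_iff[OF assms(2)])
  have "partial_omega_categorical (branch_algebra A \<theta> c) \<longleftrightarrow> oligomorphic {g. branch_iso c c g} (B c)"
    if "c \<in> C" for c
    using cnt[OF that]
    by (simp add: partial_omega_categorical_def partial_isomorphism_branch) (simp add: branch_algebra_def)
  then have S2: "(C \<noteq> {} \<and> (\<forall>c\<in>C. partial_omega_categorical (branch_algebra A \<theta> c))) = S2"
    unfolding S2_def by blast
  have S3: "(C \<noteq> {} \<and> (\<forall>c\<in>C. omega_categorical order_sig (order_struc A \<theta> c))) = S3"
    unfolding S3_def using omega_categorical_order_iff[OF cnt] by blast
  have "S1 \<Longrightarrow> S5"
    using oligomorphic_imp_locally_finite oligomorphic_iff[OF acts_on_aut]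
    unfolding S1_def S5_def finite_one_orbits_iff by blast
  moreover have "S5 \<Longrightarrow> S4"
    using finite_orbits_imp_finite_branches
    unfolding S5_def S4_def finite_one_orbits_iff algebra_height_iff by blast
  moreover have "S1 \<and> S2 \<and> S3" if s4: S4
  proof -
    obtain N where N: "\<And>x. x \<in> A \<Longrightarrow> (\<theta> ^^ N) x \<in> C"
      using s4 unfolding S4_def algebra_height_iff by blast
    obtain T where T: "finite T" "\<And>x. x \<in> A \<Longrightarrow> \<exists>t\<in>T. \<exists>h. branch_iso t x h"
      using s4 unfolding S4_def finite_up_to_iso_iff by blast
    note olig = oligomorphic_overgroup[OF covers_tuples_cyc_aut[OF T finC N]]
    have "A \<noteq> {}" using assms(1) by (simp add: monounary_algebra_def)
    then have "C \<noteq> {}" using N by blast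
    moreover have S1 unfolding S1_def
      by (rule olig[OF _ _ acts_on_aut]) (auto simp: cyc_aut_def)
    moreover have "oligomorphic {g. branch_iso c c g} (B c)" if "c \<in> C" for c
      by (rule olig[OF _ _ acts_on_branch_iso])
        (use sub[OF that] cyc_aut_branch_iso[OF _ that] cyc_aut_branch[OF _ that] in blast)+
    moreover have "oligomorphic {h. order_iso c h} (B c)" if "c \<in> C" for c
      by (rule olig[OF _ _ acts_on_order_iso])
        (use sub[OF that] cyc_aut_order_iso[OF _ that] cyc_aut_branch[OF _ that] in blast)+
    ultimately show ?thesis by (simp add: S2_def S3_def)
  qed
  moreover have branches: S5 if "C \<noteq> {}"
    and K: "\<And>c. c \<in> C \<Longrightarrow> acts_on (K c) (B c)" "\<And>c. c \<in> C \<Longrightarrow> oligomorphic (K c) (B c)"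
      "\<And>c g. c \<in> C \<Longrightarrow> g \<in> K c \<Longrightarrow> extend c g \<in> AUT" for K
    using covers_one_from_branches[OF finC connected_cyclic[OF assms(3) that(1)] K]
      connected_cyclic[OF assms(3) that(1)]
    unfolding S5_def finite_one_orbits_iff locally_finite_iff by blast
  moreover have "S2 \<Longrightarrow> S5"
    unfolding S2_def
    by (rule branches[of "\<lambda>c. {g. branch_iso c c g}"]) (auto intro: acts_on_branch_iso branch_iso_extend)
  moreover have "S3 \<Longrightarrow> S5"
    unfolding S3_def
    by (rule branches[of "\<lambda>c. {h. order_iso c h}"]) (auto intro: acts_on_order_iso order_iso_extend)
  ultimately show ?thesis
    unfolding Let_def S1 S2 S3 S4_def[symmetric] S5_def[symmetric] by blast
qed

end
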